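(* Let $T>0$. Assume that for a.e. $t\in[0,T]$ the derivative $\frac{\partial F(t,s)}{\partial t}$ exists with $\frac{\partial F(t,s)}{\partial t}\in L^2([0,T]^2;\mathbb{R})$, that $F\in C([0,T]^2;\mathbb{R})$, and that $\Theta\in L^2([0,T]^2;\mathbb{R})\cap C^1((0,T)^2;\mathbb{R})$ and $0<\zeta_1,\zeta_2\in L^2([0,T];\mathbb{R})$ with $\frac1{\zeta_1},\frac1{\zeta_2}\in L^2([0,T];\mathbb{R})$ satisfy, for any $0\le t\le r\le T$, $$\begin{cases}\dfrac{\Theta(r,t)}{\zeta_1(r)}F(r,r)+\displaystyle\int_t^r\frac{\Theta(s,t)}{\zeta_1(s)}\frac{\partial F(r,s)}{\partial r}\,ds=\zeta_2(r),\\[2mm] \dfrac{\Theta(r,t)}{\zeta_2(t)}F(t,t)+\displaystyle\int_t^r\frac{\partial F(s,t)}{\partial s}\frac{\Theta(r,s)}{\zeta_2(s)}\,ds=\zeta_1(t),\\[2mm] \dfrac{\partial\Theta(r,t)}{\partial r}+\dfrac{\partial\Theta(r,t)}{\partial t}\equiv0.\end{cases}$$ Then $$M(t)=\int_0^t\frac{\Theta(t,s)}{\zeta_2(s)}\,dB_s^F,\qquad t\in[0,T],$$ is a martingale with respect to the filtration generated by the $F$-Gaussian process $B^F$.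
   Context: $(\Omega,\mathcal{F},\mathbb{P})$ is a complete probability space carrying a standard real Brownian motion $(B_t)_{t\ge0}$. The kernel $F:\mathbb{R}\times\mathbb{R}\to\mathbb{R}$ is assumed throughout to be continuous, with $F\in L^2(\mathbb{R}^2)$, $\int_0^{t\wedge s}F(t,r)F(s,r)\,dr\ne0$ for all $t,s>0$, and $F(t,\cdot)\in L^2(\mathbb{R})$ for all $t\ge0$. The $F$-Gaussian process is $B^F_t:=\int_0^tF(t,s)\,dB_s$. For $g\in L^2([0,T];\mathbb{R})$, $(K_F^*g)(s):=F(s,s)g(s)+\int_s^T\frac{\partial F(t,s)}{\partial t}g(t)\,dt$, and $(K_F^* )^{-1}g(t)=-\frac1{\zeta_2(t)}\frac{d}{dt}\int_t^T\frac{\Theta(s,t)}{\zeta_1(s)}g(s)\,ds$ (derivative in the $L^2$-sense). For $\psi\in(K_F^* )^{-1}(L^2([0,T];\mathbb{R}))$, $\int_0^T\psi(s)\,dB^F_s$ is the limit in $L^2(\mathbb{P})$, over partitions $0=t_0<\dots<t_n=T$ with mesh tending to $0$, of $\sum_{i=0}^{n-1}\big(\frac1{t_{i+1}-t_i}\int_{t_i}^{t_{i+1}}\psi(s)\,ds\big)(B^F_{t_{i+1}}-B^F_{t_i})$. Moreover $\int_0^t\psi(s)\,dB^F_s:=\int_0^T\psi(s)1_{[0,t]}(s)\,dB^F_s$.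
   Formalization: The formal theorem also assumes that F(·,s) is absolutely continuous on [0,T] for a.e. s (it is the integral of ∂F/∂t); with mere a.e. differentiability the claim fails, e.g. F(t,s)=1+c(t) with c the Cantor function. The filtration of B^F is augmented by null sets. *)

theory Defs
  imports "HOL-Probability.Probability"
begin

text \<open>Elements of \<open>L\<^sup>2\<close> are represented by functions, not by classes.\<close>

definition L2 :: "'b measure \<Rightarrow> ('b \<Rightarrow> real) set" where
  "L2 N = {f \<in> borel_measurable N. integrable N (\<lambda>x. (f x)\<^sup>2)}"

definition C1_on :: "(real \<times> real) set \<Rightarrow> (real \<Rightarrow> real \<Rightarrow> real) \<Rightarrow> bool" where
  "C1_on S f \<longleftrightarrow> (\<exists>D :: real \<times> real \<Rightarrow> (real \<times> real) \<Rightarrow>\<^sub>L real.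
     (\<forall>z\<in>S. ((\<lambda>(r, t). f r t) has_derivative blinfun_apply (D z)) (at z)) \<and> continuous_on S D)"


section \<open>Brownian motion and the Gaussian process with kernel \<open>F\<close>\<close>

text \<open>Processes are functions of a real time, of which only the times \<open>t \<ge> 0\<close> matter.\<close>

definition standard_Brownian_motion :: "'a measure \<Rightarrow> (real \<Rightarrow> 'a \<Rightarrow> real) \<Rightarrow> bool" where
  "standard_Brownian_motion M B \<longleftrightarrow>
     prob_space M \<and>
     (\<forall>t\<ge>0. B t \<in> borel_measurable M) \<and>
     (AE \<omega> in M. B 0 \<omega> = 0) \<and>
     (\<forall>(n::nat) \<tau>. 0 \<le> \<tau> 0 \<and> (\<forall>i<n. \<tau> i \<le> \<tau> (Suc i)) \<longrightarrow>
        prob_space.indep_vars M (\<lambda>_. borel) (\<lambda>i \<omega>. B (\<tau> (Suc i)) \<omega> - B (\<tau> i) \<omega>) {..<n}) \<and>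
     (\<forall>s t. 0 \<le> s \<and> s < t \<longrightarrow>
        distributed M lborel (\<lambda>\<omega>. B t \<omega> - B s \<omega>) (normal_density 0 (sqrt (t - s)))) \<and>
     (AE \<omega> in M. continuous_on {0..} (\<lambda>t. B t \<omega>))"

text \<open>\<open>is_Wiener_integral M B t f X\<close>: the random variable \<open>X\<close> is a version of the Wiener integral of
  \<open>f\<close> against \<open>B\<close> over \<open>[0, t]\<close>, that is, the \<open>L\<^sup>2\<close>-limit of the integrals of step functions
  approximating \<open>f\<close> in \<open>L\<^sup>2([0, t])\<close>. It determines \<open>X\<close> up to almost sure equality.\<close>

definition step_function :: "nat \<Rightarrow> (nat \<Rightarrow> real) \<Rightarrow> (nat \<Rightarrow> real) \<Rightarrow> real \<Rightarrow> real" where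
  "step_function n \<tau> c s = (\<Sum>i<n. c i * indicator {\<tau> i<..\<tau> (Suc i)} s)"

definition step_integral ::
    "(real \<Rightarrow> 'a \<Rightarrow> real) \<Rightarrow> nat \<Rightarrow> (nat \<Rightarrow> real) \<Rightarrow> (nat \<Rightarrow> real) \<Rightarrow> 'a \<Rightarrow> real" where
  "step_integral B n \<tau> c \<omega> = (\<Sum>i<n. c i * (B (\<tau> (Suc i)) \<omega> - B (\<tau> i) \<omega>))"

definition is_Wiener_integral ::
    "'a measure \<Rightarrow> (real \<Rightarrow> 'a \<Rightarrow> real) \<Rightarrow> real \<Rightarrow> (real \<Rightarrow> real) \<Rightarrow> ('a \<Rightarrow> real) \<Rightarrow> bool" where
  "is_Wiener_integral M B t f X \<longleftrightarrow>
     f \<in> L2 (lebesgue_on {0..t}) \<and> X \<in> L2 M \<and>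
     (\<exists>(n :: nat \<Rightarrow> nat) \<tau> c.
        (\<forall>k. 0 \<le> \<tau> k 0 \<and> (\<forall>i < n k. \<tau> k i \<le> \<tau> k (Suc i)) \<and> \<tau> k (n k) \<le> t) \<and>
        (\<lambda>k. LINT s|lebesgue_on {0..t}. (step_function (n k) (\<tau> k) (c k) s - f s)\<^sup>2)
          \<longlonglongrightarrow> 0 \<and>
        (\<lambda>k. LINT \<omega>|M. (step_integral B (n k) (\<tau> k) (c k) \<omega> - X \<omega>)\<^sup>2) \<longlonglongrightarrow> 0)"

definition Gaussian_kernel :: "(real \<Rightarrow> real \<Rightarrow> real) \<Rightarrow> bool" where
  "Gaussian_kernel F \<longleftrightarrow>
     continuous_on UNIV (\<lambda>(t, s). F t s) \<and>
     (\<lambda>(t, s). F t s) \<in> L2 lebesgue \<and>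
     (\<forall>t>0. \<forall>s>0. (LINT r:{0..min t s}|lebesgue. F t r * F s r) \<noteq> 0) \<and>
     (\<forall>t\<ge>0. F t \<in> L2 lebesgue)"

definition F_Gaussian_process ::
    "'a measure \<Rightarrow> (real \<Rightarrow> 'a \<Rightarrow> real) \<Rightarrow> (real \<Rightarrow> real \<Rightarrow> real) \<Rightarrow> (real \<Rightarrow> 'a \<Rightarrow> real) \<Rightarrow> bool"
  where
  "F_Gaussian_process M B F BF \<longleftrightarrow> (\<forall>t\<ge>0. is_Wiener_integral M B t (F t) (BF t))"


section \<open>Integration against the Gaussian process\<close>

text \<open>\<open>D\<close> is the derivative in the \<open>L\<^sup>2\<close>-sense on \<open>[0, T]\<close> of (the almost everywhere class of) \<open>H\<close>.\<close>

definition has_L2_derivative :: "real \<Rightarrow> (real \<Rightarrow> real) \<Rightarrow> (real \<Rightarrow> real) \<Rightarrow> bool" where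
  "has_L2_derivative T H D \<longleftrightarrow>
     D \<in> L2 (lebesgue_on {0..T}) \<and>
     (\<exists>c. AE t in lebesgue_on {0..T}. H t = c + (LINT u:{0..t}|lebesgue. D u))"

text \<open>\<open>is_KF_inverse T \<Theta> \<zeta>1 \<zeta>2 g \<psi>\<close> expresses \<open>\<psi> = (K\<^sub>F\<^sup>*)\<^sup>-\<^sup>1 g\<close>, i.e.
  \<open>\<psi>(t) = - 1 / \<zeta>2(t) * d/dt \<integral>\<^sub>t\<^sup>T \<Theta>(s, t) / \<zeta>1(s) * g(s) ds\<close>; the domain of the integral below is
  the set of all such \<open>\<psi>\<close> with \<open>g \<in> L\<^sup>2([0, T])\<close>.\<close>

definition is_KF_inverse ::
    "real \<Rightarrow> (real \<Rightarrow> real \<Rightarrow> real) \<Rightarrow> (real \<Rightarrow> real) \<Rightarrow> (real \<Rightarrow> real) \<Rightarrow>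
     (real \<Rightarrow> real) \<Rightarrow> (real \<Rightarrow> real) \<Rightarrow> bool" where
  "is_KF_inverse T \<Theta> \<zeta>1 \<zeta>2 g \<psi> \<longleftrightarrow>
     (AE t in lebesgue_on {0..T}. set_integrable lebesgue {t..T} (\<lambda>s. \<Theta> s t / \<zeta>1 s * g s)) \<and>
     (\<exists>D. has_L2_derivative T (\<lambda>t. LINT s:{t..T}|lebesgue. \<Theta> s t / \<zeta>1 s * g s) D \<and>
          (AE t in lebesgue_on {0..T}. \<psi> t = - (1 / \<zeta>2 t) * D t))"

definition KF_inverse_range ::
    "real \<Rightarrow> (real \<Rightarrow> real \<Rightarrow> real) \<Rightarrow> (real \<Rightarrow> real) \<Rightarrow> (real \<Rightarrow> real) \<Rightarrow> (real \<Rightarrow> real) set" where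
  "KF_inverse_range T \<Theta> \<zeta>1 \<zeta>2 =
     {\<psi>. \<exists>g \<in> L2 (lebesgue_on {0..T}). is_KF_inverse T \<Theta> \<zeta>1 \<zeta>2 g \<psi>}"

definition is_partition :: "real \<Rightarrow> nat \<Rightarrow> (nat \<Rightarrow> real) \<Rightarrow> bool" where
  "is_partition T n \<tau> \<longleftrightarrow> \<tau> 0 = 0 \<and> \<tau> n = T \<and> (\<forall>i<n. \<tau> i < \<tau> (Suc i))"

definition averaged_sum ::
    "(real \<Rightarrow> 'a \<Rightarrow> real) \<Rightarrow> (real \<Rightarrow> real) \<Rightarrow> nat \<Rightarrow> (nat \<Rightarrow> real) \<Rightarrow> 'a \<Rightarrow> real" where
  "averaged_sum BF \<psi> n \<tau> \<omega> =
     (\<Sum>i<n. (1 / (\<tau> (Suc i) - \<tau> i) * (LINT s:{\<tau> i..\<tau> (Suc i)}|lebesgue. \<psi> s)) *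
            (BF (\<tau> (Suc i)) \<omega> - BF (\<tau> i) \<omega>))"

text \<open>\<open>X\<close> is a version of \<open>\<integral>\<^sub>0\<^sup>T \<psi>(s) dB\<^sup>F\<^sub>s\<close>.\<close>

definition is_F_integral ::
    "'a measure \<Rightarrow> (real \<Rightarrow> 'a \<Rightarrow> real) \<Rightarrow> real \<Rightarrow> (real \<Rightarrow> real \<Rightarrow> real) \<Rightarrow> (real \<Rightarrow> real) \<Rightarrow>
     (real \<Rightarrow> real) \<Rightarrow> (real \<Rightarrow> real) \<Rightarrow> ('a \<Rightarrow> real) \<Rightarrow> bool" where
  "is_F_integral M BF T \<Theta> \<zeta>1 \<zeta>2 \<psi> X \<longleftrightarrow>
     \<psi> \<in> KF_inverse_range T \<Theta> \<zeta>1 \<zeta>2 \<and> X \<in> L2 M \<and>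
     (\<forall>\<epsilon>>0. \<exists>\<delta>>0. \<forall>n \<tau>. is_partition T n \<tau> \<and> (\<forall>i<n. \<tau> (Suc i) - \<tau> i < \<delta>) \<longrightarrow>
        (LINT \<omega>|M. (averaged_sum BF \<psi> n \<tau> \<omega> - X \<omega>)\<^sup>2) < \<epsilon>)"

definition is_F_integral_upto ::
    "'a measure \<Rightarrow> (real \<Rightarrow> 'a \<Rightarrow> real) \<Rightarrow> real \<Rightarrow> (real \<Rightarrow> real \<Rightarrow> real) \<Rightarrow> (real \<Rightarrow> real) \<Rightarrow>
     (real \<Rightarrow> real) \<Rightarrow> real \<Rightarrow> (real \<Rightarrow> real) \<Rightarrow> ('a \<Rightarrow> real) \<Rightarrow> bool" where
  "is_F_integral_upto M BF T \<Theta> \<zeta>1 \<zeta>2 t \<psi> X \<longleftrightarrow>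
     is_F_integral M BF T \<Theta> \<zeta>1 \<zeta>2 (\<lambda>s. \<psi> s * indicator {0..t} s) X"


section \<open>Martingales\<close>

text \<open>Since \<open>B\<^sup>F\<^sub>t\<close> and the integrals are only determined almost surely, the generated filtration is
  taken with the null sets of \<open>M\<close> adjoined.\<close>

definition generated_filtration ::
    "'a measure \<Rightarrow> (real \<Rightarrow> 'a \<Rightarrow> real) \<Rightarrow> real \<Rightarrow> 'a measure" where
  "generated_filtration M X t =
     sigma (space M)
       ({X s -` A \<inter> space M | s A. 0 \<le> s \<and> s \<le> t \<and> A \<in> sets borel} \<union> null_sets M)"

definition martingale_on ::
    "'a measure \<Rightarrow> (real \<Rightarrow> 'a measure) \<Rightarrow> real set \<Rightarrow> (real \<Rightarrow> 'a \<Rightarrow> real) \<Rightarrow> bool" where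
  "martingale_on M G I X \<longleftrightarrow>
     (\<forall>t\<in>I. subalgebra M (G t)) \<and>
     (\<forall>s\<in>I. \<forall>t\<in>I. s \<le> t \<longrightarrow> sets (G s) \<subseteq> sets (G t)) \<and>
     (\<forall>t\<in>I. X t \<in> borel_measurable (G t) \<and> integrable M (X t)) \<and>
     (\<forall>s\<in>I. \<forall>t\<in>I. s \<le> t \<longrightarrow> (AE \<omega> in M. real_cond_exp M (G s) (X t) \<omega> = X s \<omega>))"


section \<open>The hypotheses on the kernel\<close>

text \<open>\<open>F' t s\<close> stands for \<open>\<partial>F(t, s)/\<partial>t\<close> on \<open>[0, T]\<^sup>2\<close>. Differentiability at almost every \<open>t\<close> alone would
  allow \<open>F(\<cdot>, s)\<close> to be the Cantor function, with \<open>F' = 0\<close>; the last clause says that \<open>F(\<cdot>, s)\<close>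
  is absolutely continuous, i.e. recovered from its derivative.\<close>

definition L2_time_derivative ::
    "real \<Rightarrow> (real \<Rightarrow> real \<Rightarrow> real) \<Rightarrow> (real \<Rightarrow> real \<Rightarrow> real) \<Rightarrow> bool" where
  "L2_time_derivative T F F' \<longleftrightarrow>
     (\<forall>s\<in>{0..T}. AE t in lebesgue_on {0..T}. ((\<lambda>u. F u s) has_real_derivative F' t s) (at t)) \<and>
     (\<lambda>(t, s). F' t s) \<in> L2 (lebesgue_on ({0..T} \<times> {0..T})) \<and>
     (AE s in lebesgue_on {0..T}. \<forall>t\<in>{0..T}.
        set_integrable lebesgue {0..t} (\<lambda>u. F' u s) \<and>
        F t s = F 0 s + (LINT u:{0..t}|lebesgue. F' u s))"

text \<open>On the boundary of \<open>[0, T]\<^sup>2\<close> the derivatives of \<open>\<Theta>\<close> are one-sided.\<close>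

definition kernel_equations ::
    "real \<Rightarrow> (real \<Rightarrow> real \<Rightarrow> real) \<Rightarrow> (real \<Rightarrow> real \<Rightarrow> real) \<Rightarrow> (real \<Rightarrow> real \<Rightarrow> real) \<Rightarrow>
     (real \<Rightarrow> real) \<Rightarrow> (real \<Rightarrow> real) \<Rightarrow> bool" where
  "kernel_equations T F F' \<Theta> \<zeta>1 \<zeta>2 \<longleftrightarrow>
     (\<forall>t r. 0 \<le> t \<and> t \<le> r \<and> r \<le> T \<longrightarrow>
        set_integrable lebesgue {t..r} (\<lambda>s. \<Theta> s t / \<zeta>1 s * F' r s) \<and>
        \<Theta> r t / \<zeta>1 r * F r r + (LINT s:{t..r}|lebesgue. \<Theta> s t / \<zeta>1 s * F' r s) = \<zeta>2 r \<and>
        set_integrable lebesgue {t..r} (\<lambda>s. F' s t * (\<Theta> r s / \<zeta>2 s)) \<and>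
        \<Theta> r t / \<zeta>2 t * F t t + (LINT s:{t..r}|lebesgue. F' s t * (\<Theta> r s / \<zeta>2 s)) = \<zeta>1 t \<and>
        (\<exists>a b. ((\<lambda>u. \<Theta> u t) has_real_derivative a) (at r within {0..T}) \<and>
               ((\<lambda>u. \<Theta> r u) has_real_derivative b) (at t within {0..T}) \<and> a + b = 0))"

end

theory Submission
  imports Defs
begin

text \<open>
  Formally \<open>\<integral> \<psi> dB\<^sup>F = \<integral> K\<^sub>F\<^sup>* \<psi> dB\<close>, and for \<open>\<psi>\<^sub>t(s) = \<Theta>(t, s) / \<zeta>2(s)\<close> on \<open>[0, t]\<close> the second kernel
  equation says \<open>K\<^sub>F\<^sup>* \<psi>\<^sub>t = \<zeta>1 1\<^bsub>[0, t]\<^esub>\<close>. So \<open>M(t) = \<integral>\<^sub>0\<^sup>t \<zeta>1 dB\<close>: the dependence of the kernel on \<open>t\<close> has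
  disappeared, and \<open>M\<close> has orthogonal increments with respect to the past of \<open>B\<close>. The past of \<open>B\<^sup>F\<close>
  is contained in that of \<open>B\<close>, and \<open>M(t)\<close> is measurable with respect to the past of \<open>B\<^sup>F\<close>, being a
  limit of sums of increments of \<open>B\<^sup>F\<close> up to time \<open>t\<close>; hence \<open>M\<close> is a martingale for the smaller
  filtration.

  Three points need work. First, the sums that define \<open>\<integral> \<psi> dB\<^sup>F\<close> must converge. By absolute continuity
  of \<open>F(\<cdot>, s)\<close>, such a sum over a partition \<open>\<tau>\<close> is exactly the Wiener integral of \<open>K\<^sub>F\<^sup>* \<psi>\<^sup>\<tau>\<close>, where \<open>\<psi>\<^sup>\<tau>\<close> is
  the step function of the averages of \<open>\<psi>\<close> (\<open>averaged_sum_Wiener\<close>). As \<open>K\<^sub>F\<^sup>*\<close> is bounded on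
  \<open>L\<^sup>2\<close> (\<open>kernel_operator_bounded\<close>) and \<open>\<psi>\<^sup>\<tau> \<rightarrow> \<psi>\<close> in \<open>L\<^sup>2\<close> (\<open>averages_tendsto\<close>), the Wiener isometry gives
  convergence to \<open>\<integral> K\<^sub>F\<^sup>* \<psi> dB\<close>.

  Second, \<open>\<psi>\<^sub>t\<close> has to lie in the domain of the integral. It is \<open>(K\<^sub>F\<^sup>*)\<^sup>-\<^sup>1\<close> of \<open>\<zeta>1 1\<^bsub>[0, t]\<^esub>\<close>, because the
  third kernel equation makes \<open>\<Theta>\<close> constant along diagonals, so that
  \<open>\<integral>\<^sub>u\<^sup>t \<Theta>(s, u) ds = \<integral>\<^sub>u\<^sup>t \<Theta>(t, s) ds\<close> has the derivative \<open>- \<Theta>(t, u)\<close> in \<open>u\<close> (\<open>integrand_is_KF_inverse\<close>).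

  Third, an increment of a Wiener integral must be orthogonal to every event of the past
  (\<open>Wiener_orthogonal_past\<close>). For \<open>B\<close> itself this is independence of increments and a
  \<open>\<pi>\<close>-\<open>\<lambda>\<close> argument; it extends to limits because the projection onto the past corresponds to
  restricting the integrand to \<open>(-\<infinity>, s]\<close>.
\<close>

section \<open>Square-integrable functions\<close>

lemma L2_iff: "f \<in> L2 N \<longleftrightarrow> f \<in> borel_measurable N \<and> integrable N (\<lambda>x. (f x)\<^sup>2)"
  by (simp add: L2_def)

lemma L2_measurable: "f \<in> L2 N \<Longrightarrow> f \<in> borel_measurable N"
  and L2_integrable_square: "f \<in> L2 N \<Longrightarrow> integrable N (\<lambda>x. (f x)\<^sup>2)"
  by (simp_all add: L2_iff)

lemma L2_mult_integrable:
  assumes "f \<in> L2 N" "g \<in> L2 N"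
  shows "integrable N (\<lambda>x. f x * g x)"
proof (rule Bochner_Integration.integrable_bound)
  show "integrable N (\<lambda>x. (f x)\<^sup>2 + (g x)\<^sup>2)"
    using assms by (auto simp: L2_iff)
  show "(\<lambda>x. f x * g x) \<in> borel_measurable N"
    using assms by (auto simp: L2_iff)
  have "\<bar>a * b\<bar> \<le> a\<^sup>2 + b\<^sup>2" for a b :: real
    using sum_squares_bound[of "\<bar>a\<bar>" "\<bar>b\<bar>"] abs_ge_zero[of "a * b"] unfolding abs_mult power2_abs by linarith
  then show "AE x in N. norm (f x * g x) \<le> norm ((f x)\<^sup>2 + (g x)\<^sup>2)"
    by auto
qed

lemma L2_lincomb:
  assumes "f \<in> L2 N" "g \<in> L2 N"
  shows "(\<lambda>x. f x + c * g x) \<in> L2 N"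
proof -
  have "integrable N (\<lambda>x. (f x)\<^sup>2 + (2 * c) * (f x * g x) + c\<^sup>2 * (g x)\<^sup>2)"
    using assms L2_mult_integrable[OF assms] by (auto simp: L2_iff)
  moreover have "(\<lambda>x. (f x + c * g x)\<^sup>2) = (\<lambda>x. (f x)\<^sup>2 + (2 * c) * (f x * g x) + c\<^sup>2 * (g x)\<^sup>2)"
    by (auto simp: power2_eq_square algebra_simps)
  ultimately show ?thesis
    using assms by (auto simp: L2_iff)
qed

lemma L2_add: "f \<in> L2 N \<Longrightarrow> g \<in> L2 N \<Longrightarrow> (\<lambda>x. f x + g x) \<in> L2 N"
  using L2_lincomb[of f N g 1] by simp

lemma L2_diff: "f \<in> L2 N \<Longrightarrow> g \<in> L2 N \<Longrightarrow> (\<lambda>x. f x - g x) \<in> L2 N"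
  using L2_lincomb[of f N g "-1"] by simp

lemma L2_bounded_mult:
  assumes "f \<in> L2 N" "b \<in> borel_measurable N" "\<And>x. x \<in> space N \<Longrightarrow> \<bar>b x\<bar> \<le> C"
  shows "(\<lambda>x. b x * f x) \<in> L2 N"
proof -
  have "integrable N (\<lambda>x. (b x * f x)\<^sup>2)"
  proof (rule Bochner_Integration.integrable_bound)
    show "integrable N (\<lambda>x. C\<^sup>2 * (f x)\<^sup>2)"
      using assms by (auto simp: L2_iff)
    show "(\<lambda>x. (b x * f x)\<^sup>2) \<in> borel_measurable N"
      using assms by (auto simp: L2_iff)
    show "AE x in N. norm ((b x * f x)\<^sup>2) \<le> norm (C\<^sup>2 * (f x)\<^sup>2)"
      using assms(3) by (intro AE_I2) (auto simp: power_mult_distrib intro!: mult_right_mono abs_le_square_iff[THEN iffD1] order_trans[OF assms(3) abs_ge_self])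
  qed
  then show ?thesis
    using assms by (auto simp: L2_iff)
qed

lemma L2_indicator_mult:
  assumes "f \<in> L2 N" "A \<inter> space N \<in> sets N"
  shows "(\<lambda>x. f x * indicator A x) \<in> L2 N"
proof -
  have "(\<lambda>x. indicator A x * f x) \<in> L2 N"
    by (rule L2_bounded_mult[where C = 1])
       (use assms in \<open>simp_all add: borel_measurable_indicator_iff\<close>)
  then show ?thesis
    by (simp add: mult.commute)
qed

lemma L2_AE_cong:
  assumes "f \<in> L2 N" "AE x in N. f x = g x" "g \<in> borel_measurable N"
  shows "g \<in> L2 N"
proof -
  have "AE x in N. (f x)\<^sup>2 = (g x)\<^sup>2"
    using assms(2) by eventually_elim simp
  then have "integrable N (\<lambda>x. (g x)\<^sup>2)"
    using assms(3) by (intro integrable_cong_AE_imp[OF L2_integrable_square[OF assms(1)]]) auto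
  with assms(3) show ?thesis
    by (simp add: L2_iff)
qed

lemma indicator_L2:
  assumes "A \<in> fmeasurable N"
  shows "indicat_real A \<in> L2 N"
proof -
  have "(\<lambda>x. (indicat_real A x)\<^sup>2) = indicat_real A"
    by (auto simp: indicator_def)
  moreover have "integrable N (indicat_real A)"
    using assms by (intro integrable_real_indicator) (auto simp: fmeasurable_def)
  ultimately show ?thesis
    using borel_measurable_integrable[of N "indicat_real A"] by (simp add: L2_iff)
qed

lemma L2_Cauchy_Schwarz:
  assumes "f \<in> L2 N" "g \<in> L2 N"
  shows "(LINT x|N. f x * g x)\<^sup>2 \<le> (LINT x|N. (f x)\<^sup>2) * (LINT x|N. (g x)\<^sup>2)"
proof -
  let ?A = "LINT x|N. (f x)\<^sup>2" and ?B = "LINT x|N. f x * g x" and ?C = "LINT x|N. (g x)\<^sup>2"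
  have q: "0 \<le> ?A + 2 * c * ?B + c\<^sup>2 * ?C" for c
  proof -
    have "0 \<le> (LINT x|N. (f x + c * g x)\<^sup>2)"
      by simp
    also have "\<dots> = (LINT x|N. (f x)\<^sup>2 + ((2 * c) * (f x * g x) + c\<^sup>2 * (g x)\<^sup>2))"
      by (rule Bochner_Integration.integral_cong) (auto simp: power2_eq_square algebra_simps)
    also have "\<dots> = ?A + 2 * c * ?B + c\<^sup>2 * ?C"
      using assms L2_mult_integrable[OF assms] by (simp add: L2_iff)
    finally show ?thesis .
  qed
  show ?thesis
  proof (cases "?C = 0")
    case True
    have "?B = 0"
    proof (rule ccontr)
      assume "?B \<noteq> 0"
      then show False
        using q[of "- (?A + 1) / (2 * ?B)"] True by (simp add: field_simps)
    qed
    then show ?thesis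
      using True by simp
  next
    case False
    moreover have "?C \<ge> 0"
      by simp
    ultimately have "?C > 0"
      by linarith
    then show ?thesis
      using q[of "- ?B / ?C"] by (simp add: field_simps power2_eq_square)
  qed
qed

lemma L2_square_triangle:
  assumes "f \<in> L2 N" "g \<in> L2 N"
  shows "(LINT x|N. (f x + g x)\<^sup>2) \<le> 2 * (LINT x|N. (f x)\<^sup>2) + 2 * (LINT x|N. (g x)\<^sup>2)"
proof -
  have "(LINT x|N. (f x + g x)\<^sup>2) \<le> (LINT x|N. 2 * (f x)\<^sup>2 + 2 * (g x)\<^sup>2)"
  proof (rule integral_mono)
    show "integrable N (\<lambda>x. (f x + g x)\<^sup>2)"
      using L2_add[OF assms] by (simp add: L2_iff)
    show "integrable N (\<lambda>x. 2 * (f x)\<^sup>2 + 2 * (g x)\<^sup>2)"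
      using assms by (auto simp: L2_iff)
    show "(f x + g x)\<^sup>2 \<le> 2 * (f x)\<^sup>2 + 2 * (g x)\<^sup>2" for x
      using zero_le_power2[of "f x - g x"] by (simp add: power2_eq_square algebra_simps)
  qed
  also have "\<dots> = 2 * (LINT x|N. (f x)\<^sup>2) + 2 * (LINT x|N. (g x)\<^sup>2)"
    using assms by (simp add: L2_iff)
  finally show ?thesis .
qed

abbreviation L2_tendsto :: "'b measure \<Rightarrow> (nat \<Rightarrow> 'b \<Rightarrow> real) \<Rightarrow> ('b \<Rightarrow> real) \<Rightarrow> bool" where
  "L2_tendsto N f g \<equiv> (\<lambda>k. LINT x|N. (f k x - g x)\<^sup>2) \<longlonglongrightarrow> 0"

lemma L2_tendsto_inner:
  assumes f: "\<And>k. f k \<in> L2 N" "f' \<in> L2 N" "L2_tendsto N f f'" and g: "g \<in> L2 N"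
  shows "(\<lambda>k. LINT x|N. f k x * g x) \<longlonglongrightarrow> (LINT x|N. f' x * g x)"
proof -
  have "(\<lambda>k. (LINT x|N. f k x * g x) - (LINT x|N. f' x * g x)) \<longlonglongrightarrow> 0"
  proof (rule Lim_null_comparison)
    show "\<forall>\<^sub>F k in sequentially. norm ((LINT x|N. f k x * g x) - (LINT x|N. f' x * g x))
        \<le> sqrt ((LINT x|N. (f k x - f' x)\<^sup>2) * (LINT x|N. (g x)\<^sup>2))"
    proof (intro always_eventually allI)
      fix k
      have "(LINT x|N. f k x * g x) - (LINT x|N. f' x * g x) = (LINT x|N. (f k x - f' x) * g x)"
        using f g by (simp add: L2_mult_integrable left_diff_distrib)
      then show "norm ((LINT x|N. f k x * g x) - (LINT x|N. f' x * g x))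
          \<le> sqrt ((LINT x|N. (f k x - f' x)\<^sup>2) * (LINT x|N. (g x)\<^sup>2))"
        using L2_Cauchy_Schwarz[OF L2_diff[OF f(1)[of k] f(2)] g]
        by (simp add: real_le_rsqrt)
    qed
    have "(\<lambda>k. sqrt ((LINT x|N. (f k x - f' x)\<^sup>2) * (LINT x|N. (g x)\<^sup>2))) \<longlonglongrightarrow> sqrt (0 * (LINT x|N. (g x)\<^sup>2))"
      by (intro tendsto_intros f(3))
    then show "(\<lambda>k. sqrt ((LINT x|N. (f k x - f' x)\<^sup>2) * (LINT x|N. (g x)\<^sup>2))) \<longlonglongrightarrow> 0"
      by simp
  qed
  then show ?thesis
    by (simp add: Lim_null[symmetric])
qed

lemma L2_tendsto_AE_subsequence:
  assumes f: "\<And>k. f k \<in> L2 N" "f' \<in> L2 N" "L2_tendsto N f f'"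
  obtains r where "strict_mono r" "AE x in N. (\<lambda>k. f (r k) x) \<longlonglongrightarrow> f' x"
proof -
  have "\<exists>r::nat\<Rightarrow>nat. strict_mono r \<and> (AE x in N. (\<lambda>n. (f (r n) x - f' x)\<^sup>2) \<longlonglongrightarrow> 0)"
    by (rule tendsto_L1_AE_subseq) (use f L2_diff[OF f(1,2)] in \<open>auto simp: L2_iff\<close>)
  then obtain r where r: "strict_mono r" "AE x in N. (\<lambda>n. (f (r n) x - f' x)\<^sup>2) \<longlonglongrightarrow> 0"
    by auto
  have "AE x in N. (\<lambda>k. f (r k) x) \<longlonglongrightarrow> f' x"
    using r(2)
  proof eventually_elim
    case (elim x)
    then have "(\<lambda>n. sqrt ((f (r n) x - f' x)\<^sup>2)) \<longlonglongrightarrow> sqrt 0"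
      by (intro tendsto_real_sqrt)
    then show ?case
      by (simp add: tendsto_rabs_zero_iff LIM_zero_iff)
  qed
  with r(1) show thesis
    by (rule that)
qed

text \<open>Riesz--Fischer: a subsequence whose successive distances decrease geometrically converges
  almost everywhere, because \<open>\<bar>d\<bar> \<le> 2\<^sup>-\<^sup>k + 2\<^sup>k d\<^sup>2\<close> turns summability of the weighted square
  integrals into absolute summability of the increments; Fatou's lemma then gives convergence in
  \<open>L\<^sup>2\<close> to the pointwise limit.\<close>

lemma L2_complete:
  assumes f: "\<And>k. f k \<in> L2 N"
    and Cauchy: "\<And>e. e > 0 \<Longrightarrow> \<exists>K. \<forall>m\<ge>K. \<forall>n\<ge>K. (LINT x|N. (f m x - f n x)\<^sup>2) < e"
  obtains f' where "f' \<in> L2 N" "L2_tendsto N f f'"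
proof -
  have [measurable]: "f k \<in> borel_measurable N" for k
    using f by (simp add: L2_iff)
  have int: "integrable N (\<lambda>x. (f m x - f n x)\<^sup>2)" for m n
    using L2_diff[OF f f] by (simp add: L2_iff)
  have nn: "(\<integral>\<^sup>+x. ennreal ((f m x - f n x)\<^sup>2) \<partial>N) = ennreal (LINT x|N. (f m x - f n x)\<^sup>2)" for m n
    using int by (simp add: nn_integral_eq_integral)
  \<comment> \<open>Squared distances below \<open>4\<^sup>-\<^sup>k\<close> are summable even after multiplication by \<open>2\<^sup>k\<close>.\<close>
  obtain R where R: "\<And>k m n. m \<ge> R k \<Longrightarrow> n \<ge> R k \<Longrightarrow> (LINT x|N. (f m x - f n x)\<^sup>2) < (1/4) ^ k"
    using Cauchy[of "(1/4) ^ k" for k] by (metis zero_less_divide_1_iff zero_less_numeral zero_less_power)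
  define r where "r k = (\<Sum>i\<le>k. R i) + k" for k
  have rR: "R k \<le> r k" for k
    using member_le_sum[of k "{..k}" R] by (auto simp: r_def)
  have rS: "r k < r (Suc k)" for k
    by (simp add: r_def)
  then have r_mono: "strict_mono r"
    by (simp add: strict_mono_Suc_iff)
  define d where "d k x = f (r (Suc k)) x - f (r k) x" for k x
  have [measurable]: "d k \<in> borel_measurable N" for k
    unfolding d_def by measurable
  have "(\<integral>\<^sup>+x. (\<Sum>k. ennreal (2 ^ k * (d k x)\<^sup>2)) \<partial>N) = (\<Sum>k. \<integral>\<^sup>+x. ennreal (2 ^ k * (d k x)\<^sup>2) \<partial>N)"
    by (rule nn_integral_suminf) measurable
  also have "\<dots> \<le> (\<Sum>k. ennreal ((1/2) ^ k))"
  proof (rule suminf_le)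
    fix k
    have "(\<integral>\<^sup>+x. ennreal (2 ^ k * (d k x)\<^sup>2) \<partial>N) = ennreal (2 ^ k) * (\<integral>\<^sup>+x. ennreal ((d k x)\<^sup>2) \<partial>N)"
      by (simp add: ennreal_mult nn_integral_cmult)
    also have "\<dots> = ennreal (2 ^ k * (LINT x|N. (d k x)\<^sup>2))"
      by (simp add: d_def nn ennreal_mult)
    also have "\<dots> \<le> ennreal (2 ^ k * (1/4) ^ k)"
      using R[of k "r (Suc k)" "r k"] rR[of k] rS[of k]
      by (intro ennreal_leI mult_left_mono) (auto simp: d_def)
    also have "\<dots> = ennreal ((1/2) ^ k)"
      by (simp add: power_mult_distrib[symmetric])
    finally show "(\<integral>\<^sup>+x. ennreal (2 ^ k * (d k x)\<^sup>2) \<partial>N) \<le> ennreal ((1/2) ^ k)" .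
  qed auto
  also have "\<dots> < \<infinity>"
    by (subst suminf_ennreal_eq[OF _ geometric_sums]) auto
  finally have "AE x in N. (\<Sum>k. ennreal (2 ^ k * (d k x)\<^sup>2)) \<noteq> \<infinity>"
    by (intro nn_integral_PInf_AE) auto
  then have conv: "AE x in N. convergent (\<lambda>k. f (r k) x)"
  proof eventually_elim
    case (elim x)
    then have "summable (\<lambda>k. 2 ^ k * (d k x)\<^sup>2)"
      by (intro summable_suminf_not_top) auto
    then have "summable (\<lambda>k. (1/2) ^ k + 2 ^ k * (d k x)\<^sup>2)"
      by (intro summable_add) (auto intro: summable_geometric)
    then have "summable (\<lambda>k. d k x)"
    proof (rule summable_comparison_test_ev[rotated], intro always_eventually allI)
      fix k
      have *: "\<bar>a\<bar> \<le> 1 / p + p * a\<^sup>2" if "p > 0" for a p :: real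
      proof (cases "\<bar>a\<bar> \<le> 1 / p")
        case True
        with that show ?thesis by (simp add: add_increasing2)
      next
        case False
        then have "\<bar>a\<bar> * 1 \<le> \<bar>a\<bar> * (p * \<bar>a\<bar>)"
          using that by (intro mult_left_mono) (auto simp: field_simps)
        moreover have "\<bar>a\<bar> * (p * \<bar>a\<bar>) = p * a\<^sup>2"
          by (simp add: power2_eq_square)
        ultimately show ?thesis
          using that by (simp add: add_increasing)
      qed
      show "norm (d k x) \<le> (1/2) ^ k + 2 ^ k * (d k x)\<^sup>2"
        using *[of "2 ^ k" "d k x"] by (simp add: power_one_over)
    qed
    then have "convergent (\<lambda>n. \<Sum>k<n. d k x)"
      by (simp add: summable_iff_convergent)
    moreover have "(\<Sum>k<n. d k x) = f (r n) x - f (r 0) x" for n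
      unfolding d_def by (rule sum_lessThan_telescope)
    ultimately have "convergent (\<lambda>n. (f (r n) x - f (r 0) x) + f (r 0) x)"
      by (intro convergent_add convergent_const) simp
    then show ?case
      by simp
  qed
  define f' where "f' x = lim (\<lambda>k. f (r k) x)" for x
  have [measurable]: "f' \<in> borel_measurable N"
    unfolding f'_def by measurable
  have lim: "AE x in N. (\<lambda>k. f (r k) x) \<longlonglongrightarrow> f' x"
    using conv by eventually_elim (simp add: f'_def convergent_LIMSEQ_iff)
  have fatou: "(\<integral>\<^sup>+x. ennreal ((f m x - f' x)\<^sup>2) \<partial>N) \<le> ennreal e"
    if "\<And>n. n \<ge> K \<Longrightarrow> (LINT x|N. (f m x - f n x)\<^sup>2) \<le> e" for m e K
  proof -
    have "(\<integral>\<^sup>+x. ennreal ((f m x - f' x)\<^sup>2) \<partial>N)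
        = (\<integral>\<^sup>+x. liminf (\<lambda>k. ennreal ((f m x - f (r k) x)\<^sup>2)) \<partial>N)"
    proof (rule nn_integral_cong_AE)
      show "AE x in N. ennreal ((f m x - f' x)\<^sup>2) = liminf (\<lambda>k. ennreal ((f m x - f (r k) x)\<^sup>2))"
        using lim
      proof eventually_elim
        case (elim x)
        then have "(\<lambda>k. ennreal ((f m x - f (r k) x)\<^sup>2)) \<longlonglongrightarrow> ennreal ((f m x - f' x)\<^sup>2)"
          by (intro tendsto_intros)
        then show ?case
          by (intro lim_imp_Liminf[symmetric]) auto
      qed
    qed
    also have "\<dots> \<le> liminf (\<lambda>k. \<integral>\<^sup>+x. ennreal ((f m x - f (r k) x)\<^sup>2) \<partial>N)"
      by (rule nn_integral_liminf) auto
    also have "\<dots> \<le> limsup (\<lambda>k. \<integral>\<^sup>+x. ennreal ((f m x - f (r k) x)\<^sup>2) \<partial>N)"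
      by (rule Liminf_le_Limsup) simp
    also have "\<dots> \<le> ennreal e"
    proof (rule Limsup_bounded)
      show "\<forall>\<^sub>F k in sequentially. (\<integral>\<^sup>+x. ennreal ((f m x - f (r k) x)\<^sup>2) \<partial>N) \<le> ennreal e"
        using eventually_ge_at_top[of K]
      proof eventually_elim
        case (elim k)
        then have "r k \<ge> K"
          using seq_suble[OF r_mono, of k] by linarith
        then show ?case
          using that by (simp add: nn ennreal_leI)
      qed
    qed
    finally show ?thesis .
  qed
  have fin: "integrable N (\<lambda>x. (f m x - f' x)\<^sup>2) \<and> (LINT x|N. (f m x - f' x)\<^sup>2) \<le> e"
    if K: "\<And>n. n \<ge> K \<Longrightarrow> (LINT x|N. (f m x - f n x)\<^sup>2) \<le> e" for m e K
  proof -
    have *: "(\<integral>\<^sup>+x. ennreal ((f m x - f' x)\<^sup>2) \<partial>N) \<le> ennreal e"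
      using fatou K by blast
    have "e \<ge> 0"
      using K[of K] by (rule order_trans[rotated]) auto
    have i: "integrable N (\<lambda>x. (f m x - f' x)\<^sup>2)"
      using * by (intro integrableI_bounded) (auto simp: top.not_eq_extremum[symmetric] top_unique)
    then show ?thesis
      using * \<open>e \<ge> 0\<close> by (simp add: nn_integral_eq_integral)
  qed
  obtain K where K: "\<forall>m\<ge>K. \<forall>n\<ge>K. (LINT x|N. (f m x - f n x)\<^sup>2) < 1"
    using Cauchy[of 1] by auto
  have "(\<lambda>x. f K x - f' x) \<in> L2 N"
    using fin[of K K 1] K by (auto simp: L2_iff less_imp_le)
  from L2_diff[OF f[of K] this] have "f' \<in> L2 N"
    by simp
  moreover have "L2_tendsto N f f'"
  proof (rule LIMSEQ_I)
    fix e :: real assume "e > 0"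
    then obtain K where K: "\<forall>m\<ge>K. \<forall>n\<ge>K. (LINT x|N. (f m x - f n x)\<^sup>2) < e / 2"
      using Cauchy[of "e / 2"] by auto
    have "norm ((LINT x|N. (f m x - f' x)\<^sup>2) - 0) < e" if "m \<ge> K" for m
      using fin[of K m "e / 2"] K that \<open>e > 0\<close> by (auto simp: less_imp_le)
    then show "\<exists>no. \<forall>n\<ge>no. norm ((LINT x|N. (f n x - f' x)\<^sup>2) - 0) < e"
      by blast
  qed
  ultimately show thesis
    by (rule that)
qed

lemma L2_tendsto_Cauchy:
  assumes f: "\<And>k. f k \<in> L2 N" "f' \<in> L2 N" "L2_tendsto N f f'" and "e > 0"
  shows "\<exists>K. \<forall>m\<ge>K. \<forall>n\<ge>K. (LINT x|N. (f m x - f n x)\<^sup>2) < e"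
proof -
  obtain K where K: "\<And>k. k \<ge> K \<Longrightarrow> (LINT x|N. (f k x - f' x)\<^sup>2) < e / 4"
    using LIMSEQ_D[OF f(3), of "e / 4"] \<open>e > 0\<close> by auto
  have "(LINT x|N. (f m x - f n x)\<^sup>2) < e" if "m \<ge> K" "n \<ge> K" for m n
  proof -
    have "(LINT x|N. (f m x - f n x)\<^sup>2) = (LINT x|N. ((f m x - f' x) + (f' x - f n x))\<^sup>2)"
      by simp
    also have "\<dots> \<le> 2 * (LINT x|N. (f m x - f' x)\<^sup>2) + 2 * (LINT x|N. (f' x - f n x)\<^sup>2)"
      by (intro L2_square_triangle L2_diff f)
    also have "\<dots> = 2 * (LINT x|N. (f m x - f' x)\<^sup>2) + 2 * (LINT x|N. (f n x - f' x)\<^sup>2)"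
      by (simp add: power2_commute)
    also have "\<dots> < e"
      using K[OF that(1)] K[OF that(2)] by simp
    finally show ?thesis .
  qed
  then show ?thesis
    by blast
qed

lemma integral_lebesgue_on:
  fixes S :: "'b::euclidean_space set"
  assumes "S \<in> sets lebesgue"
  shows "(LINT x|lebesgue_on S. f x) = (LINT x|lebesgue. f x * indicator S x :: real)"
  using assms by (subst integral_restrict_space) (auto simp: mult.commute)

lemma L2_lebesgue_on_iff:
  fixes S :: "'b::euclidean_space set"
  assumes "S \<in> sets lebesgue"
  shows "f \<in> L2 (lebesgue_on S) \<longleftrightarrow> (\<lambda>x. f x * indicator S x) \<in> L2 lebesgue"
proof -
  have "f \<in> borel_measurable (lebesgue_on S) \<longleftrightarrow> (\<lambda>x. f x * indicator S x) \<in> borel_measurable lebesgue"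
    using assms by (subst borel_measurable_restrict_space_iff) (auto simp: mult.commute)
  moreover have "integrable (lebesgue_on S) (\<lambda>x. (f x)\<^sup>2) \<longleftrightarrow> integrable lebesgue (\<lambda>x. indicator S x *\<^sub>R (f x)\<^sup>2)"
    using assms by (intro integrable_restrict_space) auto
  moreover have "(\<lambda>x. indicator S x *\<^sub>R (f x)\<^sup>2) = (\<lambda>x. (f x * indicator S x)\<^sup>2)"
    by (auto simp: indicator_def)
  ultimately show ?thesis
    by (simp add: L2_iff)
qed

lemma indicator_Ioc_L2: "indicat_real {a<..b::real} \<in> L2 lebesgue"
  by (intro indicator_L2 bounded_set_imp_lmeasurable) auto

lemma L2_tendsto_diff:
  assumes "\<And>k. f k \<in> L2 N" "f' \<in> L2 N" "L2_tendsto N f f'"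
    and "\<And>k. g k \<in> L2 N" "g' \<in> L2 N" "L2_tendsto N g g'"
  shows "L2_tendsto N (\<lambda>k x. f k x - g k x) (\<lambda>x. f' x - g' x)"
proof (rule Lim_null_comparison)
  show "\<forall>\<^sub>F k in sequentially. norm (LINT x|N. (f k x - g k x - (f' x - g' x))\<^sup>2)
      \<le> 2 * (LINT x|N. (f k x - f' x)\<^sup>2) + 2 * (LINT x|N. (g k x - g' x)\<^sup>2)"
  proof (intro always_eventually allI)
    fix k
    have "(LINT x|N. (f k x - g k x - (f' x - g' x))\<^sup>2) = (LINT x|N. ((f k x - f' x) + (g' x - g k x))\<^sup>2)"
      by (simp add: algebra_simps)
    also have "\<dots> \<le> 2 * (LINT x|N. (f k x - f' x)\<^sup>2) + 2 * (LINT x|N. (g' x - g k x)\<^sup>2)"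
      by (intro L2_square_triangle L2_diff assms)
    finally show "norm (LINT x|N. (f k x - g k x - (f' x - g' x))\<^sup>2)
      \<le> 2 * (LINT x|N. (f k x - f' x)\<^sup>2) + 2 * (LINT x|N. (g k x - g' x)\<^sup>2)"
      by (simp add: power2_commute[of "g' _"])
  qed
  have "(\<lambda>k. 2 * (LINT x|N. (f k x - f' x)\<^sup>2) + 2 * (LINT x|N. (g k x - g' x)\<^sup>2)) \<longlonglongrightarrow> 2 * 0 + 2 * 0"
    by (intro tendsto_intros assms)
  then show "(\<lambda>k. 2 * (LINT x|N. (f k x - f' x)\<^sup>2) + 2 * (LINT x|N. (g k x - g' x)\<^sup>2)) \<longlonglongrightarrow> 0"
    by simp
qed

lemma L2_tendsto_mult_indicator:
  assumes "\<And>k. f k \<in> L2 N" "f' \<in> L2 N" "L2_tendsto N f f'" and A: "A \<inter> space N \<in> sets N"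
  shows "L2_tendsto N (\<lambda>k x. f k x * indicator A x) (\<lambda>x. f' x * indicator A x)"
proof (rule Lim_null_comparison[OF _ assms(3)], intro always_eventually allI)
  fix k
  have "(LINT x|N. (f k x * indicator A x - f' x * indicator A x)\<^sup>2) \<le> (LINT x|N. (f k x - f' x)\<^sup>2)"
    using L2_diff[OF assms(1)[of k] assms(2)]
      L2_diff[OF L2_indicator_mult[OF assms(1)[of k] A] L2_indicator_mult[OF assms(2) A]]
    by (intro integral_mono) (auto simp: L2_iff indicator_def)
  then show "norm (LINT x|N. (f k x * indicator A x - f' x * indicator A x)\<^sup>2) \<le> (LINT x|N. (f k x - f' x)\<^sup>2)"
    by simp
qed


section \<open>Generated filtrations\<close>

lemma sets_generated_filtration:
  "sets (generated_filtration M X t) =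
    sigma_sets (space M) ({X s -` A \<inter> space M | s A. 0 \<le> s \<and> s \<le> t \<and> A \<in> sets borel} \<union> null_sets M)"
  unfolding generated_filtration_def
  by (rule sets_measure_of) (blast dest: sets.sets_into_space null_setsD2)

lemma space_generated_filtration [simp]: "space (generated_filtration M X t) = space M"
  by (simp add: generated_filtration_def space_measure_of_conv)

lemma subalgebra_generated_filtration:
  assumes X: "\<And>s. 0 \<le> s \<Longrightarrow> s \<le> t \<Longrightarrow> X s \<in> borel_measurable M"
  shows "subalgebra M (generated_filtration M X t)"
  unfolding subalgebra_def
proof
  show "sets (generated_filtration M X t) \<subseteq> sets M"
    unfolding sets_generated_filtration
    by (rule sets.sigma_sets_subset) (auto intro: measurable_sets[OF X])
qed simp

lemma generated_filtration_mono:
  assumes "s \<le> t"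
  shows "sets (generated_filtration M X s) \<subseteq> sets (generated_filtration M X t)"
  unfolding sets_generated_filtration
proof (rule sigma_sets_mono', intro Un_mono subset_refl subsetI)
  fix A assume "A \<in> {X r -` C \<inter> space M | r C. 0 \<le> r \<and> r \<le> s \<and> C \<in> sets borel}"
  then show "A \<in> {X r -` C \<inter> space M | r C. 0 \<le> r \<and> r \<le> t \<and> C \<in> sets borel}"
    using \<open>s \<le> t\<close> by (blast intro: order_trans)
qed

lemma null_sets_generated_filtration:
  "null_sets M \<subseteq> sets (generated_filtration M X t)"
  unfolding sets_generated_filtration by (rule subsetI, rule sigma_sets.Basic, rule UnI2)

lemma measurable_generated_filtration:
  assumes "0 \<le> s" "s \<le> t"
  shows "X s \<in> borel_measurable (generated_filtration M X t)"
proof (rule measurableI)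
  fix A :: "real set" assume "A \<in> sets borel"
  then show "X s -` A \<inter> space (generated_filtration M X t) \<in> sets (generated_filtration M X t)"
    unfolding sets_generated_filtration space_generated_filtration
    using assms by (intro sigma_sets.Basic) auto
qed simp

lemma generated_filtration_subset:
  assumes G: "subalgebra M G" "null_sets M \<subseteq> sets G"
    and X: "\<And>s. 0 \<le> s \<Longrightarrow> s \<le> t \<Longrightarrow> X s \<in> borel_measurable G"
  shows "sets (generated_filtration M X t) \<subseteq> sets G"
proof -
  have sp: "space G = space M"
    using G(1) by (simp add: subalgebra_def)
  show ?thesis
    unfolding sets_generated_filtration sp[symmetric]
    by (rule sets.sigma_sets_subset) (use G(2) in \<open>auto intro: measurable_sets[OF X]\<close>)
qed

text \<open>Because the null sets are adjoined, measurability with respect to the filtration is a property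
  of almost sure equivalence classes, and hence stable under limits in \<open>L\<^sup>2\<close>.\<close>

lemma L2_limit_measurable_subalgebra:
  assumes G: "subalgebra M G" "null_sets M \<subseteq> sets G"
    and f: "\<And>k. f k \<in> borel_measurable G" "\<And>k. f k \<in> L2 M" "f' \<in> L2 M" "L2_tendsto M f f'"
  shows "f' \<in> borel_measurable G"
proof -
  have sp: "space G = space M"
    using G(1) by (simp add: subalgebra_def)
  obtain r where r: "AE x in M. (\<lambda>k. f (r k) x) \<longlonglongrightarrow> f' x"
    using L2_tendsto_AE_subsequence[OF f(2-4)] by blast
  define g where "g x = lim (\<lambda>k. f (r k) x)" for x
  have gG: "g \<in> borel_measurable G"
    unfolding g_def using f(1) by measurable
  have gM: "g \<in> borel_measurable M"
    by (rule measurable_from_subalg[OF G(1) gG])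
  have fM: "f' \<in> borel_measurable M"
    using f(3) by (rule L2_measurable)
  have "AE x in M. f' x = g x"
    using r by eventually_elim (simp add: g_def limI)
  define N where "N = {x \<in> space M. f' x \<noteq> g x}"
  have [measurable]: "N \<in> sets M"
    unfolding N_def using fM gM by measurable
  have N: "N \<in> null_sets M"
  proof -
    have "AE x in M. x \<notin> N"
      using \<open>AE x in M. f' x = g x\<close> by eventually_elim (simp add: N_def)
    then show ?thesis
      by (simp add: AE_iff_null_sets)
  qed
  show ?thesis
  proof (rule measurableI)
    fix A :: "real set" assume A: "A \<in> sets borel"
    have eq: "f' -` A \<inter> space G = ((g -` A \<inter> space G) - N) \<union> (f' -` A \<inter> space M \<inter> N)"
      by (auto simp: sp N_def)
    have "f' -` A \<inter> space M \<inter> N \<in> null_sets M"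
      by (rule null_sets_subset[OF N]) (use measurable_sets[OF fM A] in auto)
    then show "f' -` A \<inter> space G \<in> sets G"
      unfolding eq using N G(2) by (intro sets.Un sets.Diff measurable_sets[OF gG A]) blast+
  qed simp
qed


section \<open>Brownian motion\<close>

locale Brownian_motion = prob_space M for M :: "'a measure" +
  fixes B :: "real \<Rightarrow> 'a \<Rightarrow> real"
  assumes standard: "standard_Brownian_motion M B"
begin

lemma B_measurable: "0 \<le> t \<Longrightarrow> B t \<in> borel_measurable M"
  using standard unfolding standard_Brownian_motion_def by simp

lemma B_0: "AE \<omega> in M. B 0 \<omega> = 0"
  using standard unfolding standard_Brownian_motion_def by (elim conjE)

lemma B_indep:
  assumes "0 \<le> \<tau> 0" "\<And>i. i < n \<Longrightarrow> \<tau> i \<le> \<tau> (Suc i)"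
  shows "indep_vars (\<lambda>_. borel) (\<lambda>i \<omega>. B (\<tau> (Suc i)) \<omega> - B (\<tau> i) \<omega>) {..<n}"
proof -
  have "\<forall>(n::nat) \<tau>. 0 \<le> \<tau> 0 \<and> (\<forall>i<n. \<tau> i \<le> \<tau> (Suc i)) \<longrightarrow>
      indep_vars (\<lambda>_. borel) (\<lambda>i \<omega>. B (\<tau> (Suc i)) \<omega> - B (\<tau> i) \<omega>) {..<n}"
    using standard unfolding standard_Brownian_motion_def by (elim conjE)
  from this[rule_format, of \<tau> n] assms show ?thesis
    by simp
qed

lemma B_distributed:
  assumes "0 \<le> s" "s < t"
  shows "distributed M lborel (\<lambda>\<omega>. B t \<omega> - B s \<omega>) (normal_density 0 (sqrt (t - s)))"
proof -
  have "\<forall>s t. 0 \<le> s \<and> s < t \<longrightarrow>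
      distributed M lborel (\<lambda>\<omega>. B t \<omega> - B s \<omega>) (normal_density 0 (sqrt (t - s)))"
    using standard unfolding standard_Brownian_motion_def by (elim conjE)
  from this[rule_format, of s t] assms show ?thesis
    by simp
qed

lemma L2_integrable:
  assumes "X \<in> L2 M"
  shows "integrable M X"
proof -
  have "(\<lambda>_. 1) \<in> L2 M"
    by (simp add: L2_iff)
  from L2_mult_integrable[OF assms this] show ?thesis
    by simp
qed

lemma increment:
  assumes "0 \<le> s" "s \<le> t"
  shows increment_L2: "(\<lambda>\<omega>. B t \<omega> - B s \<omega>) \<in> L2 M"
    and increment_mean: "expectation (\<lambda>\<omega>. B t \<omega> - B s \<omega>) = 0"
    and increment_variance: "expectation (\<lambda>\<omega>. (B t \<omega> - B s \<omega>)\<^sup>2) = t - s"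
proof -
  have "(\<lambda>\<omega>. B t \<omega> - B s \<omega>) \<in> L2 M \<and> expectation (\<lambda>\<omega>. B t \<omega> - B s \<omega>) = 0
      \<and> expectation (\<lambda>\<omega>. (B t \<omega> - B s \<omega>)\<^sup>2) = t - s"
  proof (cases "s = t")
    case True
    then show ?thesis
      by (simp add: L2_iff)
  next
    case False
    then have "s < t"
      using assms by simp
    then have pos: "sqrt (t - s) > 0"
      by simp
    note D = B_distributed[OF \<open>0 \<le> s\<close> \<open>s < t\<close>]
    have mean: "expectation (\<lambda>\<omega>. B t \<omega> - B s \<omega>) = 0"
      by (rule normal_distributed_expectation[OF pos D])
    have "variance (\<lambda>\<omega>. B t \<omega> - B s \<omega>) = (sqrt (t - s))\<^sup>2"
      by (rule normal_distributed_variance[OF pos D])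
    then have var: "expectation (\<lambda>\<omega>. (B t \<omega> - B s \<omega>)\<^sup>2) = t - s"
      using mean \<open>s < t\<close> by simp
    moreover have "integrable M (\<lambda>\<omega>. (B t \<omega> - B s \<omega>)\<^sup>2)"
    proof (rule ccontr)
      assume "\<not> ?thesis"
      then show False
        using var \<open>s < t\<close> by (simp add: not_integrable_integral_eq)
    qed
    ultimately show ?thesis
      using mean assms by (auto simp: L2_iff intro!: borel_measurable_diff B_measurable)
  qed
  then show "(\<lambda>\<omega>. B t \<omega> - B s \<omega>) \<in> L2 M" "expectation (\<lambda>\<omega>. B t \<omega> - B s \<omega>) = 0"
    "expectation (\<lambda>\<omega>. (B t \<omega> - B s \<omega>)\<^sup>2) = t - s" by auto
qed

lemma B_L2:
  assumes "0 \<le> t"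
  shows "B t \<in> L2 M"
proof (rule L2_AE_cong)
  show "(\<lambda>\<omega>. B t \<omega> - B 0 \<omega>) \<in> L2 M"
    using assms by (rule increment_L2[OF order_refl])
  show "AE \<omega> in M. B t \<omega> - B 0 \<omega> = B t \<omega>"
    using B_0 by eventually_elim simp
qed (rule B_measurable[OF assms])

text \<open>For finitely many times in \<open>[0, s]\<close>, the sorted list of these times and \<open>0\<close>, \<open>s\<close>, followed by
  \<open>u\<close>, is a grid whose last increment is \<open>B u - B s\<close>; the values of \<open>B\<close> at the given times are almost
  surely partial sums of the other increments, because \<open>B 0 = 0\<close>.\<close>

lemma increment_orthogonal_cylinder:
  assumes "finite R" "R \<subseteq> {0..s}" "0 \<le> s" "s \<le> u" and A: "\<And>r. A r \<in> sets borel"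
  shows "(LINT \<omega>:{\<omega> \<in> space M. \<forall>r\<in>R. B r \<omega> \<in> A r}|M. B u \<omega> - B s \<omega>) = 0"
proof -
  define L where "L = sorted_list_of_set (insert 0 (insert s R))"
  define m where "m = length L - 1"
  have setL: "set L = insert 0 (insert s R)"
    using \<open>finite R\<close> by (simp only: L_def set_sorted_list_of_set finite_insert)
  have sortedL: "sorted L" 
    by (simp only: L_def sorted_sorted_list_of_set)
  have "L \<noteq> []"
    using setL by auto
  then have len: "length L = Suc m"
    by (simp add: m_def)
  have bounds: "0 \<le> L ! i" "L ! i \<le> s" if "i \<le> m" for i
  proof -
    have "L ! i \<in> set L"
      using that len by simp
    then show "0 \<le> L ! i" "L ! i \<le> s"
      using setL assms(2,3) by auto
  qed
  have L0: "L ! 0 = 0"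
  proof -
    obtain i where "i < length L" "L ! i = 0"
      using setL by (metis in_set_conv_nth insertI1)
    then have "L ! 0 \<le> 0"
      using sorted_nth_mono[OF sortedL, of 0 i] by simp
    then show ?thesis
      using bounds[of 0] by simp
  qed
  have Lm: "L ! m = s"
  proof -
    obtain i where "i < length L" "L ! i = s"
      using setL by (metis in_set_conv_nth insertI1 insertI2)
    then have "s \<le> L ! m"
      using sorted_nth_mono[OF sortedL, of i m] len by simp
    then show ?thesis
      using bounds[of m] by simp
  qed
  define \<tau> where "\<tau> i = (if i \<le> m then L ! i else u)" for i
  define D where "D i \<omega> = B (\<tau> (Suc i)) \<omega> - B (\<tau> i) \<omega>" for i \<omega>
  have ind: "indep_vars (\<lambda>_. borel) D {..<Suc m}"
    unfolding D_def
  proof (rule B_indep)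
    show "0 \<le> \<tau> 0"
      by (simp add: \<tau>_def L0)
    show "\<tau> i \<le> \<tau> (Suc i)" if "i < Suc m" for i
      using that bounds[of i] \<open>s \<le> u\<close> sorted_nth_mono[OF sortedL, of i "Suc i"] len
      by (auto simp: \<tau>_def)
  qed
  have Dm: "D m \<omega> = B u \<omega> - B s \<omega>" for \<omega>
    by (simp add: D_def \<tau>_def Lm)
  define P where "P x \<longleftrightarrow> (\<forall>j\<in>{..m}. L ! j \<in> R \<longrightarrow> (\<Sum>i<j. x i) \<in> A (L ! j))" for x :: "nat \<Rightarrow> real"
  define S where "S = {x \<in> space (PiM {..<m} (\<lambda>_. borel)). P x}"
  have S: "S \<in> sets (PiM {..<m} (\<lambda>_. borel))"
    unfolding S_def P_def
  proof (intro sets.sets_Collect_finite_All sets.sets_Collect_imp sets.sets_Collect_const)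
    fix j assume j: "j \<in> {..m}"
    have "(\<lambda>x. \<Sum>i<j. x i) \<in> borel_measurable (PiM {..<m} (\<lambda>_. borel :: real measure))"
      using j by (intro borel_measurable_sum measurable_component_singleton) auto
    then show "{x \<in> space (Pi\<^sub>M {..<m} (\<lambda>_. borel)). (\<Sum>i<j. x i) \<in> A (L ! j)} \<in> sets (Pi\<^sub>M {..<m} (\<lambda>_. borel))"
      by (rule measurable_sets_Collect) (simp add: A)
  qed auto
  have "indep_var (PiM {..<m} (\<lambda>_. borel)) (\<lambda>\<omega>. \<lambda>i\<in>{..<m}. D i \<omega>)
      (PiM {m} (\<lambda>_. borel)) (\<lambda>\<omega>. \<lambda>i\<in>{m}. D i \<omega>)"
    by (rule indep_var_restrict[OF ind]) auto
  then have "indep_var borel (indicat_real S \<circ> (\<lambda>\<omega>. \<lambda>i\<in>{..<m}. D i \<omega>))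
      borel ((\<lambda>x. x m) \<circ> (\<lambda>\<omega>. \<lambda>i\<in>{m}. D i \<omega>))"
    by (rule indep_var_compose) (use S in \<open>auto intro!: measurable_component_singleton\<close>)
  moreover have "((\<lambda>x. x m) \<circ> (\<lambda>\<omega>. \<lambda>i\<in>{m}. D i \<omega>)) = D m"
    by auto
  moreover define I where "I = indicat_real S \<circ> (\<lambda>\<omega>. \<lambda>i\<in>{..<m}. D i \<omega>)"
  ultimately have iv: "indep_var borel I borel (D m)"
    by simp
  have Im: "I \<in> borel_measurable M"
    using iv by (rule indep_var_rv1)
  have Dm_L2: "D m \<in> L2 M"
    unfolding Dm[abs_def] using assms by (intro increment_L2) auto
  have "integrable M I"
    by (rule integrable_const_bound[of _ 1, OF _ Im]) (auto simp: I_def indicator_def)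
  then have "expectation (\<lambda>\<omega>. I \<omega> * D m \<omega>) = expectation I * expectation (D m)"
    by (intro indep_var_lebesgue_integral iv L2_integrable[OF Dm_L2])
  also have "expectation (D m) = 0"
    unfolding Dm[abs_def] using assms by (intro increment_mean) auto
  finally have zero: "expectation (\<lambda>\<omega>. I \<omega> * D m \<omega>) = 0"
    by simp
  have "AE \<omega> in M. indicator {\<omega> \<in> space M. \<forall>r\<in>R. B r \<omega> \<in> A r} \<omega> *\<^sub>R (B u \<omega> - B s \<omega>) = I \<omega> * D m \<omega>"
    using B_0
  proof (rule AE_mp, intro AE_I2 impI)
    fix \<omega> assume "\<omega> \<in> space M" and B0: "B 0 \<omega> = 0"
    have "(\<Sum>i<j. (\<lambda>i\<in>{..<m}. D i \<omega>) i) = B (L ! j) \<omega>" if "j \<le> m" for j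
    proof -
      have "(\<Sum>i<j. (\<lambda>i\<in>{..<m}. D i \<omega>) i) = (\<Sum>i<j. D i \<omega>)"
        using that by (intro sum.cong) auto
      also have "\<dots> = B (L ! j) \<omega>"
        using sum_lessThan_telescope[of "\<lambda>i. B (\<tau> i) \<omega>" j] that B0 by (simp add: D_def \<tau>_def L0)
      finally show ?thesis .
    qed
    then have "P (\<lambda>i\<in>{..<m}. D i \<omega>) \<longleftrightarrow> (\<forall>j\<in>{..m}. L ! j \<in> R \<longrightarrow> B (L ! j) \<omega> \<in> A (L ! j))"
      unfolding P_def by (intro ball_cong refl imp_cong) (simp only: atMost_iff)
    also have "\<dots> \<longleftrightarrow> (\<forall>r\<in>R. B r \<omega> \<in> A r)"
    proof
      assume *: "\<forall>j\<in>{..m}. L ! j \<in> R \<longrightarrow> B (L ! j) \<omega> \<in> A (L ! j)"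
      show "\<forall>r\<in>R. B r \<omega> \<in> A r"
      proof
        fix r assume "r \<in> R"
        then have "r \<in> set L"
          by (simp add: setL)
        then obtain j where "j < length L" "L ! j = r"
          by (auto simp: in_set_conv_nth)
        then show "B r \<omega> \<in> A r"
          using * \<open>r \<in> R\<close> len by auto
      qed
    qed auto
    finally have "(\<lambda>i\<in>{..<m}. D i \<omega>) \<in> S \<longleftrightarrow> (\<forall>r\<in>R. B r \<omega> \<in> A r)"
      by (simp add: S_def space_PiM)
    then show "indicator {\<omega> \<in> space M. \<forall>r\<in>R. B r \<omega> \<in> A r} \<omega> *\<^sub>R (B u \<omega> - B s \<omega>) = I \<omega> * D m \<omega>"
      using \<open>\<omega> \<in> space M\<close> by (simp add: I_def Dm indicator_def)
  qed
  moreover have "{\<omega> \<in> space M. \<forall>r\<in>R. B r \<omega> \<in> A r} \<in> sets M"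
  proof (rule sets.sets_Collect_finite_All[OF _ \<open>finite R\<close>])
    fix r assume "r \<in> R"
    then have "B r \<in> borel_measurable M"
      using assms(2) by (intro B_measurable) auto
    then show "{x \<in> space M. B r x \<in> A r} \<in> sets M"
      by (rule measurable_sets_Collect) (simp add: A)
  qed
  moreover have "(\<lambda>\<omega>. B u \<omega> - B s \<omega>) \<in> borel_measurable M" "(\<lambda>\<omega>. I \<omega> * D m \<omega>) \<in> borel_measurable M"
    using Im Dm_L2 assms by (auto simp: L2_iff intro!: borel_measurable_diff B_measurable)
  ultimately have "(LINT \<omega>:{\<omega> \<in> space M. \<forall>r\<in>R. B r \<omega> \<in> A r}|M. B u \<omega> - B s \<omega>)
      = expectation (\<lambda>\<omega>. I \<omega> * D m \<omega>)"
    unfolding set_lebesgue_integral_def by (intro integral_cong_AE) auto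
  with zero show ?thesis
    by simp
qed

text \<open>The events that agree almost surely with a cylinder event of the past are stable under
  intersection, and null events are among them: they agree with an empty cylinder. So they
  generate the past of \<open>B\<close> with its null sets, and the claim spreads from them by Dynkin's lemma.\<close>

lemma increment_orthogonal_past:
  assumes "A \<in> sets (generated_filtration M B s)" "0 \<le> s" "s \<le> u"
  shows "(LINT \<omega>:A|M. B u \<omega> - B s \<omega>) = 0"
proof -
  let ?X = "\<lambda>\<omega>. B u \<omega> - B s \<omega>"
  define G where "G = {A \<in> sets M. \<exists>R C. finite R \<and> R \<subseteq> {0..s} \<and> (\<forall>r. C r \<in> sets borel) \<and>
      (AE \<omega> in M. \<omega> \<in> A \<longleftrightarrow> (\<forall>r\<in>R. B r \<omega> \<in> C r))}"
  have intX: "integrable M ?X"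
    using assms by (intro L2_integrable increment_L2)
  then have set_int: "set_integrable M C ?X" if "C \<in> sets M" for C
    unfolding set_integrable_def using that integrable_mult_indicator by blast
  have gen: "A \<in> sigma_sets (space M) G"
  proof -
    have "{B r -` A \<inter> space M | r A. 0 \<le> r \<and> r \<le> s \<and> A \<in> sets borel} \<union> null_sets M \<subseteq> G"
    proof (intro Un_least subsetI)
      fix C assume "C \<in> {B r -` A \<inter> space M | r A. 0 \<le> r \<and> r \<le> s \<and> A \<in> sets borel}"
      then obtain r A where C: "C = B r -` A \<inter> space M" "0 \<le> r" "r \<le> s" "A \<in> sets borel"
        by auto
      then have "C \<in> sets M"
        using measurable_sets[OF B_measurable] by simp
      then show "C \<in> G"
        unfolding G_def using C by (intro CollectI conjI exI[of _ "{r}"] exI[of _ "\<lambda>_. A"]) auto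
    next
      fix C assume "C \<in> null_sets M"
      then have "AE \<omega> in M. \<omega> \<notin> C" "C \<in> sets M"
        by (auto simp: AE_not_in)
      then show "C \<in> G"
        unfolding G_def using \<open>0 \<le> s\<close> by (intro CollectI conjI exI[of _ "{0}"] exI[of _ "\<lambda>_. {}"]) auto
    qed
    then have "sigma_sets (space M) ({B r -` A \<inter> space M | r A. 0 \<le> r \<and> r \<le> s \<and> A \<in> sets borel} \<union> null_sets M)
        \<subseteq> sigma_sets (space M) G"
      by (rule sigma_sets_mono')
    then show ?thesis
      using assms(1) sets_generated_filtration[of M B s] by auto
  qed
  have Pow: "G \<subseteq> Pow (space M)"
    by (auto simp: G_def dest: sets.sets_into_space)
  have "Int_stable G"
  proof (rule Int_stableI)
    fix A1 A2 assume "A1 \<in> G" "A2 \<in> G"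
    then obtain R1 C1 R2 C2 where 1: "A1 \<in> sets M" "finite R1" "R1 \<subseteq> {0..s}" "\<And>r. C1 r \<in> sets borel"
        "AE \<omega> in M. \<omega> \<in> A1 \<longleftrightarrow> (\<forall>r\<in>R1. B r \<omega> \<in> C1 r)"
      and 2: "A2 \<in> sets M" "finite R2" "R2 \<subseteq> {0..s}" "\<And>r. C2 r \<in> sets borel"
        "AE \<omega> in M. \<omega> \<in> A2 \<longleftrightarrow> (\<forall>r\<in>R2. B r \<omega> \<in> C2 r)"
      unfolding G_def by blast
    define C where "C r = (if r \<in> R1 then C1 r else UNIV) \<inter> (if r \<in> R2 then C2 r else UNIV)" for r
    have "AE \<omega> in M. \<omega> \<in> A1 \<inter> A2 \<longleftrightarrow> (\<forall>r\<in>R1 \<union> R2. B r \<omega> \<in> C r)"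
      using 1(5) 2(5) by eventually_elim (auto simp: C_def)
    moreover have "C r \<in> sets borel" for r
      using 1(4) 2(4) by (auto simp: C_def)
    ultimately show "A1 \<inter> A2 \<in> G"
      unfolding G_def using 1(1-3) 2(1-3) by (intro CollectI conjI exI[of _ "R1 \<union> R2"] exI[of _ C]) auto
  qed
  from this Pow gen have "A \<in> sets M \<and> (LINT \<omega>:A|M. ?X \<omega>) = 0"
  proof (induction rule: sigma_sets_induct_disjoint)
    case (basic A)
    then obtain R C where C: "A \<in> sets M" "finite R" "R \<subseteq> {0..s}" "\<And>r. C r \<in> sets borel"
        "AE \<omega> in M. \<omega> \<in> A \<longleftrightarrow> (\<forall>r\<in>R. B r \<omega> \<in> C r)"
      unfolding G_def by blast
    have "{\<omega> \<in> space M. \<forall>r\<in>R. B r \<omega> \<in> C r} \<in> sets M"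
    proof (rule sets.sets_Collect_finite_All[OF _ \<open>finite R\<close>])
      fix r assume "r \<in> R"
      then have "B r \<in> borel_measurable M"
        using C(3) by (intro B_measurable) auto
      then show "{x \<in> space M. B r x \<in> C r} \<in> sets M"
        by (rule measurable_sets_Collect) (simp add: C(4))
    qed
    moreover have "AE \<omega> in M. indicator A \<omega> *\<^sub>R ?X \<omega> = indicator {\<omega> \<in> space M. \<forall>r\<in>R. B r \<omega> \<in> C r} \<omega> *\<^sub>R ?X \<omega>"
      using C(5) AE_space by eventually_elim (auto simp: indicator_def)
    ultimately have "(LINT \<omega>:A|M. ?X \<omega>) = (LINT \<omega>:{\<omega> \<in> space M. \<forall>r\<in>R. B r \<omega> \<in> C r}|M. ?X \<omega>)"
      unfolding set_lebesgue_integral_def using C(1) borel_measurable_integrable[OF intX]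
      by (intro integral_cong_AE) auto
    also have "\<dots> = 0"
      using C assms by (intro increment_orthogonal_cylinder) auto
    finally show ?case
      using C(1) by simp
  next
    case empty
    show ?case by (simp add: set_lebesgue_integral_def)
  next
    case (compl A)
    have "(LINT \<omega>:space M - A|M. ?X \<omega>) + (LINT \<omega>:A|M. ?X \<omega>) = (LINT \<omega>:(space M - A) \<union> A|M. ?X \<omega>)"
      using compl by (intro set_integral_Un[symmetric] set_int) auto
    also have "(space M - A) \<union> A = space M"
      using compl sets.sets_into_space by auto
    also have "(LINT \<omega>:space M|M. ?X \<omega>) = 0"
      using increment_mean[of s u] assms intX by (simp add: set_integral_space)
    finally show ?case
      using compl by auto
  next
    case (union A)
    have *: "(\<Union>i. A i) \<in> sets M"
      using union by auto
    have "(LINT \<omega>:(\<Union>i. A i)|M. ?X \<omega>) = (\<Sum>i. LINT \<omega>:A i|M. ?X \<omega>)"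
      using union set_int[OF *] by (intro lebesgue_integral_countable_add) (auto simp: disjoint_family_on_def)
    then show ?case
      using * union by simp
  qed
  then show ?thesis
    by simp
qed

lemma B_covariance:
  assumes "0 \<le> s" "0 \<le> t"
  shows "expectation (\<lambda>\<omega>. B s \<omega> * B t \<omega>) = min s t"
proof -
  have le: "expectation (\<lambda>\<omega>. B s \<omega> * B t \<omega>) = s" if st: "0 \<le> s" "s \<le> t" for s t
  proof -
    define \<tau> where "\<tau> i = (if i = 0 then 0 else if i = 1 then s else t)" for i :: nat
    define D where "D i \<omega> = B (\<tau> (Suc i)) \<omega> - B (\<tau> i) \<omega>" for i \<omega>
    have D: "D 0 = (\<lambda>\<omega>. B s \<omega> - B 0 \<omega>)" "D (Suc 0) = (\<lambda>\<omega>. B t \<omega> - B s \<omega>)"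
      by (auto simp: D_def \<tau>_def)
    have "indep_vars (\<lambda>_. borel) D {..<2}"
      unfolding D_def using st by (intro B_indep) (auto simp: \<tau>_def)
    then have "indep_var (PiM {0} (\<lambda>_. borel)) (\<lambda>\<omega>. \<lambda>i\<in>{0}. D i \<omega>)
        (PiM {1} (\<lambda>_. borel)) (\<lambda>\<omega>. \<lambda>i\<in>{1}. D i \<omega>)"
      by (rule indep_var_restrict) auto
    then have "indep_var borel ((\<lambda>x. x 0) \<circ> (\<lambda>\<omega>. \<lambda>i\<in>{0}. D i \<omega>)) borel ((\<lambda>x. x 1) \<circ> (\<lambda>\<omega>. \<lambda>i\<in>{1}. D i \<omega>))"
      by (rule indep_var_compose) (auto intro!: measurable_component_singleton)
    moreover have "((\<lambda>x. x 0) \<circ> (\<lambda>\<omega>. \<lambda>i\<in>{0}. D i \<omega>)) = D 0" "((\<lambda>x. x 1) \<circ> (\<lambda>\<omega>. \<lambda>i\<in>{1}. D i \<omega>)) = D 1"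
      by auto
    ultimately have "indep_var borel (D 0) borel (D 1)"
      by simp
    then have "expectation (\<lambda>\<omega>. D 0 \<omega> * D 1 \<omega>) = expectation (D 0) * expectation (D 1)"
      using st by (intro indep_var_lebesgue_integral L2_integrable) (auto simp: D intro!: increment_L2)
    also have "\<dots> = 0"
      using st increment_mean[of 0 s] by (simp add: D)
    finally have zero: "expectation (\<lambda>\<omega>. D 0 \<omega> * D 1 \<omega>) = 0" .
    have L2: "D 0 \<in> L2 M" "D 1 \<in> L2 M"
      using st by (auto simp: D intro!: increment_L2)
    have "AE \<omega> in M. B s \<omega> * B t \<omega> = (D 0 \<omega>)\<^sup>2 + D 0 \<omega> * D 1 \<omega>"
      using B_0 by eventually_elim (simp add: D power2_eq_square algebra_simps)
    then have "expectation (\<lambda>\<omega>. B s \<omega> * B t \<omega>) = expectation (\<lambda>\<omega>. (D 0 \<omega>)\<^sup>2 + D 0 \<omega> * D 1 \<omega>)"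
      using st L2 by (intro integral_cong_AE) (auto simp: L2_iff intro!: borel_measurable_times B_measurable)
    also have "\<dots> = expectation (\<lambda>\<omega>. (D 0 \<omega>)\<^sup>2)"
      using zero L2 L2_mult_integrable[OF L2] by (simp add: L2_iff)
    also have "\<dots> = s"
      using st increment_variance[of 0 s] by (simp add: D)
    finally show ?thesis .
  qed
  show ?thesis
    using le[of s t] le[of t s] assms by (cases "s \<le> t") (auto simp: mult.commute min_def)
qed

end

section \<open>The Wiener isometry\<close>

lemma increasing_le:
  fixes \<tau> :: "nat \<Rightarrow> real"
  assumes "\<forall>i<n. \<tau> i \<le> \<tau> (Suc i)" "i \<le> j" "j \<le> n"
  shows "\<tau> i \<le> \<tau> j"
  using assms(2,3)
proof (induction j)
  case (Suc j)
  then show ?case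
    using assms(1) by (cases "i = Suc j") (auto intro: order_trans)
qed auto

context Brownian_motion
begin

text \<open>\<open>Wiener f X\<close>: the random variable \<open>X\<close> is the Wiener integral of \<open>f\<close>. The relation is the closed
  linear span of the pairs \<open>(1\<^bsub>(0, a]\<^esub>, B a)\<close>; having the limits among the rules makes properties that
  are linear and closed provable by a single induction.\<close>

inductive Wiener :: "(real \<Rightarrow> real) \<Rightarrow> ('a \<Rightarrow> real) \<Rightarrow> bool" where
  Brownian: "0 \<le> a \<Longrightarrow> Wiener (indicat_real {0<..a}) (B a)"
| lincomb: "Wiener f X \<Longrightarrow> Wiener g Y \<Longrightarrow> Wiener (\<lambda>x. f x + c * g x) (\<lambda>\<omega>. X \<omega> + c * Y \<omega>)"
| limit: "(\<And>k. Wiener (f k) (X k)) \<Longrightarrow> f' \<in> L2 lebesgue \<Longrightarrow> X' \<in> L2 M \<Longrightarrow>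
    L2_tendsto lebesgue f f' \<Longrightarrow> L2_tendsto M X X' \<Longrightarrow> Wiener f' X'"

lemma Wiener_L2:
  assumes "Wiener f X"
  shows Wiener_L2_fun: "f \<in> L2 lebesgue" and Wiener_L2_rv: "X \<in> L2 M"
proof -
  have "f \<in> L2 lebesgue \<and> X \<in> L2 M"
    using assms
  proof induction
    case (Brownian a)
    then show ?case
      using B_L2 indicator_Ioc_L2 by auto
  qed (auto intro: L2_lincomb)
  then show "f \<in> L2 lebesgue" "X \<in> L2 M"
    by auto
qed

lemma Wiener_diff: "Wiener f X \<Longrightarrow> Wiener g Y \<Longrightarrow> Wiener (\<lambda>x. f x - g x) (\<lambda>\<omega>. X \<omega> - Y \<omega>)"
  using lincomb[of f X g Y "-1"] by simp

lemma Wiener_zero: "Wiener (\<lambda>_. 0) (\<lambda>_. 0)"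
  using Wiener_diff[OF Brownian[of 0] Brownian[of 0]] by simp

lemma Wiener_sum:
  assumes "\<And>i. i < (n::nat) \<Longrightarrow> Wiener (f i) (X i)"
  shows "Wiener (\<lambda>x. \<Sum>i<n. c i * f i x) (\<lambda>\<omega>. \<Sum>i<n. c i * X i \<omega>)"
  using assms
proof (induction n)
  case 0
  then show ?case by (simp add: Wiener_zero)
next
  case (Suc n)
  then show ?case
    using lincomb[of _ _ "f n" "X n" "c n"] by simp
qed

lemma Wiener_AE_cong:
  assumes W: "Wiener f X" and f: "AE x in lebesgue. f x = f' x"
  shows "Wiener f' X"
proof (rule limit[of "\<lambda>_. f" "\<lambda>_. X"])
  have "f' \<in> borel_measurable lebesgue"
    using L2_measurable[OF Wiener_L2_fun[OF W]] f by (rule borel_measurable_AE)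
  then show "f' \<in> L2 lebesgue"
    by (rule L2_AE_cong[OF Wiener_L2_fun[OF W] f])
  have "(LINT x|lebesgue. (f x - f' x)\<^sup>2) = 0"
    using f by (intro integral_eq_zero_AE) (auto elim: eventually_mono)
  then show "L2_tendsto lebesgue (\<lambda>_. f) f'"
    by simp
qed (use W Wiener_L2_rv[OF W] in auto)

text \<open>By bilinearity and continuity the identity reduces to the generating pairs, where it is
  \<open>E (B a * B b) = min a b = \<integral> 1\<^bsub>(0, a]\<^esub> 1\<^bsub>(0, b]\<^esub>\<close>.\<close>

lemma Wiener_inner:
  assumes "Wiener f X" "Wiener g Y"
  shows "expectation (\<lambda>\<omega>. X \<omega> * Y \<omega>) = (LINT x|lebesgue. f x * g x)"
proof -
  have B: "expectation (\<lambda>\<omega>. X \<omega> * B b \<omega>) = (LINT x|lebesgue. f x * indicator {0<..b} x)"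
    if "Wiener f X" "0 \<le> b" for f X b
    using that(1)
  proof induction
    case (Brownian a)
    have "(LINT x|lebesgue. indicat_real {0<..a} x * indicator {0<..b} x) = (LINT x|lebesgue. indicat_real {0<..min a b} x)"
      by (rule Bochner_Integration.integral_cong) (auto simp: indicator_def)
    also have "\<dots> = min a b"
      using Brownian \<open>0 \<le> b\<close> by (simp add: measure_def)
    finally show ?case
      using B_covariance[OF Brownian \<open>0 \<le> b\<close>] by simp
  next
    case (lincomb f X g Y c)
    note L2 = Wiener_L2[OF lincomb(1)] Wiener_L2[OF lincomb(2)] Wiener_L2[OF Wiener.Brownian[OF \<open>0 \<le> b\<close>]]
    show ?case
      using lincomb.IH L2 by (simp add: distrib_right mult.assoc L2_mult_integrable)
  next
    case (limit f X f' X')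
    note L2 = Wiener_L2[OF limit(1)] Wiener_L2[OF Wiener.Brownian[OF \<open>0 \<le> b\<close>]]
    have "(\<lambda>k. expectation (\<lambda>\<omega>. X k \<omega> * B b \<omega>)) \<longlonglongrightarrow> expectation (\<lambda>\<omega>. X' \<omega> * B b \<omega>)"
      using limit L2 by (intro L2_tendsto_inner) auto
    moreover have "(\<lambda>k. LINT x|lebesgue. f k x * indicator {0<..b} x) \<longlonglongrightarrow> (LINT x|lebesgue. f' x * indicator {0<..b} x)"
      using limit L2 by (intro L2_tendsto_inner) auto
    ultimately show ?case
      unfolding limit.IH by (rule LIMSEQ_unique)
  qed
  show ?thesis
    using assms(2)
  proof induction
    case (Brownian a)
    then show ?case
      using B[OF assms(1)] by simp
  next
    case (lincomb g Y g' Y' c)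
    note L2 = Wiener_L2[OF lincomb(1)] Wiener_L2[OF lincomb(2)] Wiener_L2[OF assms(1)]
    have "(\<lambda>\<omega>. X \<omega> * (Y \<omega> + c * Y' \<omega>)) = (\<lambda>\<omega>. X \<omega> * Y \<omega> + c * (X \<omega> * Y' \<omega>))"
      "(\<lambda>x. f x * (g x + c * g' x)) = (\<lambda>x. f x * g x + c * (f x * g' x))"
      by (auto simp: algebra_simps)
    then show ?case
      using lincomb.IH L2 by (simp add: L2_mult_integrable)
  next
    case (limit g Y g' Y')
    note L2 = Wiener_L2[OF limit(1)] Wiener_L2[OF assms(1)]
    have "(\<lambda>k. expectation (\<lambda>\<omega>. Y k \<omega> * X \<omega>)) \<longlonglongrightarrow> expectation (\<lambda>\<omega>. Y' \<omega> * X \<omega>)"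
      using limit L2 by (intro L2_tendsto_inner) auto
    moreover have "(\<lambda>k. LINT x|lebesgue. g k x * f x) \<longlonglongrightarrow> (LINT x|lebesgue. g' x * f x)"
      using limit L2 by (intro L2_tendsto_inner) auto
    moreover have "expectation (\<lambda>\<omega>. Y k \<omega> * X \<omega>) = (LINT x|lebesgue. g k x * f x)" for k
      using limit.IH[of k] by (simp add: mult.commute)
    ultimately have "expectation (\<lambda>\<omega>. Y' \<omega> * X \<omega>) = (LINT x|lebesgue. g' x * f x)"
      by (simp add: LIMSEQ_unique)
    then show ?case
      by (simp add: mult.commute)
  qed
qed

lemma Wiener_isometry:
  assumes "Wiener f X" "Wiener g Y"
  shows "expectation (\<lambda>\<omega>. (X \<omega> - Y \<omega>)\<^sup>2) = (LINT x|lebesgue. (f x - g x)\<^sup>2)"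
  using Wiener_inner[OF Wiener_diff[OF assms] Wiener_diff[OF assms]] by (simp add: power2_eq_square)

lemma Wiener_limit_exists:
  assumes W: "\<And>k. Wiener (f k) (X k)" and f: "f' \<in> L2 lebesgue" "L2_tendsto lebesgue f f'"
  obtains X' where "Wiener f' X'" "L2_tendsto M X X'"
proof -
  have "\<exists>K. \<forall>m\<ge>K. \<forall>n\<ge>K. expectation (\<lambda>\<omega>. (X m \<omega> - X n \<omega>)\<^sup>2) < e" if "e > 0" for e
    unfolding Wiener_isometry[OF W W]
    using L2_tendsto_Cauchy[OF Wiener_L2_fun[OF W] f that] .
  from L2_complete[of X M, OF Wiener_L2_rv[OF W] this]
  obtain X' where X': "X' \<in> L2 M" "L2_tendsto M X X'"
    by blast
  have "Wiener f' X'"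
    using W f(1) X'(1) f(2) X'(2) by (rule limit)
  then show thesis
    using X'(2) by (rule that)
qed

text \<open>The predictor \<open>Y\<close> of \<open>X\<close> from the past is obtained by restricting the integrand. For \<open>B a\<close> it is
  \<open>B (min a s)\<close>; for a limit it is the limit of the predictors, which exists because restriction
  is continuous on \<open>L\<^sup>2\<close> and the isometry makes the predictors a Cauchy sequence.\<close>

lemma Wiener_projection:
  assumes "Wiener f X" "0 \<le> s"
  shows "\<exists>Y. Wiener (\<lambda>x. f x * indicator {..s} x) Y \<and>
    (\<forall>A\<in>sets (generated_filtration M B s). expectation (\<lambda>\<omega>. (X \<omega> - Y \<omega>) * indicator A \<omega>) = 0)"
  using assms(1)
proof induction
  case (Brownian a)
  have "(\<lambda>x. indicat_real {0<..a} x * indicator {..s} x) = indicator {0<..min a s}"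
    by (auto simp: indicator_def)
  moreover have "expectation (\<lambda>\<omega>. (B a \<omega> - B (min a s) \<omega>) * indicator A \<omega>) = 0"
    if "A \<in> sets (generated_filtration M B s)" for A
    using increment_orthogonal_past[OF that \<open>0 \<le> s\<close>, of a]
    by (cases "s \<le> a") (auto simp: set_lebesgue_integral_def mult.commute min_def)
  ultimately show ?case
    using Wiener.Brownian[of "min a s"] Brownian \<open>0 \<le> s\<close> by auto
next
  case (lincomb f X g Z c)
  then obtain Y Y' where Y: "Wiener (\<lambda>x. f x * indicator {..s} x) Y"
      "\<And>A. A\<in>sets (generated_filtration M B s) \<Longrightarrow> expectation (\<lambda>\<omega>. (X \<omega> - Y \<omega>) * indicator A \<omega>) = 0"
    and Y': "Wiener (\<lambda>x. g x * indicator {..s} x) Y'"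
      "\<And>A. A\<in>sets (generated_filtration M B s) \<Longrightarrow> expectation (\<lambda>\<omega>. (Z \<omega> - Y' \<omega>) * indicator A \<omega>) = 0"
    by blast
  note L2 = Wiener_L2_rv[OF lincomb(1)] Wiener_L2_rv[OF lincomb(2)] Wiener_L2_rv[OF Y(1)] Wiener_L2_rv[OF Y'(1)]
  have "Wiener (\<lambda>x. (f x + c * g x) * indicator {..s} x) (\<lambda>\<omega>. Y \<omega> + c * Y' \<omega>)"
    using Wiener.lincomb[OF Y(1) Y'(1), of c] by (simp add: distrib_right mult.assoc)
  moreover have "expectation (\<lambda>\<omega>. (X \<omega> + c * Z \<omega> - (Y \<omega> + c * Y' \<omega>)) * indicator A \<omega>) = 0"
    if A: "A \<in> sets (generated_filtration M B s)" for A
  proof -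
    have "A \<in> sets M"
      using A subalgebra_generated_filtration[of s B M] B_measurable by (auto simp: subalgebra_def)
    then have "integrable M (\<lambda>\<omega>. (X \<omega> - Y \<omega>) * indicator A \<omega>)" "integrable M (\<lambda>\<omega>. (Z \<omega> - Y' \<omega>) * indicator A \<omega>)"
      using L2 by (auto intro!: L2_mult_integrable L2_diff indicator_L2 simp: fmeasurable_eq_sets)
    then have "expectation (\<lambda>\<omega>. (X \<omega> - Y \<omega>) * indicator A \<omega> + c * ((Z \<omega> - Y' \<omega>) * indicator A \<omega>)) = 0"
      using Y(2)[OF A] Y'(2)[OF A] by simp
    then show ?thesis
      by (simp add: algebra_simps)
  qed
  ultimately show ?case
    by blast
next
  case (limit f X f' X')
  then have "\<forall>k. \<exists>Y. Wiener (\<lambda>x. f k x * indicator {..s} x) Y \<and>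
    (\<forall>A\<in>sets (generated_filtration M B s). expectation (\<lambda>\<omega>. (X k \<omega> - Y \<omega>) * indicator A \<omega>) = 0)"
    by blast
  then obtain Y where Y: "\<And>k. Wiener (\<lambda>x. f k x * indicator {..s} x) (Y k)"
    "\<And>k A. A \<in> sets (generated_filtration M B s) \<Longrightarrow> expectation (\<lambda>\<omega>. (X k \<omega> - Y k \<omega>) * indicator A \<omega>) = 0"
    by metis
  have f: "f k \<in> L2 lebesgue" and X: "X k \<in> L2 M" for k
    using Wiener_L2[OF limit(1)] by auto
  have "(\<lambda>x. f' x * indicator {..s} x) \<in> L2 lebesgue"
    "L2_tendsto lebesgue (\<lambda>k x. f k x * indicator {..s} x) (\<lambda>x. f' x * indicator {..s} x)"
    by (rule L2_indicator_mult[OF limit(2)], simp)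
      (rule L2_tendsto_mult_indicator[OF f limit(2) limit(4)], simp)
  from Wiener_limit_exists[OF Y(1) this]
  obtain Y' where Y': "Wiener (\<lambda>x. f' x * indicator {..s} x) Y'" "L2_tendsto M Y Y'"
    by blast
  have "expectation (\<lambda>\<omega>. (X' \<omega> - Y' \<omega>) * indicator A \<omega>) = 0"
    if A: "A \<in> sets (generated_filtration M B s)" for A
  proof -
    have "A \<in> sets M"
      using A subalgebra_generated_filtration[of s B M] B_measurable by (auto simp: subalgebra_def)
    then have "indicat_real A \<in> L2 M"
      by (intro indicator_L2) (simp add: fmeasurable_eq_sets)
    then have "(\<lambda>k. expectation (\<lambda>\<omega>. (X k \<omega> - Y k \<omega>) * indicator A \<omega>)) \<longlonglongrightarrow> expectation (\<lambda>\<omega>. (X' \<omega> - Y' \<omega>) * indicator A \<omega>)"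
      using X limit Y Y' Wiener_L2_rv by (intro L2_tendsto_inner L2_diff L2_tendsto_diff) blast+
    then show ?thesis
      using Y(2)[OF A] by (simp add: LIMSEQ_const_iff)
  qed
  with Y'(1) show ?case
    by blast
qed

text \<open>Here the projection is the integral of a null function.\<close>

lemma Wiener_orthogonal_past:
  assumes W: "Wiener f X" and s: "0 \<le> s" "AE x in lebesgue. x \<le> s \<longrightarrow> f x = 0"
    and A: "A \<in> sets (generated_filtration M B s)"
  shows "expectation (\<lambda>\<omega>. X \<omega> * indicator A \<omega>) = 0"
proof -
  obtain Y where Y: "Wiener (\<lambda>x. f x * indicator {..s} x) Y"
    "expectation (\<lambda>\<omega>. (X \<omega> - Y \<omega>) * indicator A \<omega>) = 0"
    using Wiener_projection[OF W s(1)] A by blast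
  have "expectation (\<lambda>\<omega>. (Y \<omega>)\<^sup>2) = (LINT x|lebesgue. (f x * indicator {..s} x)\<^sup>2)"
    using Wiener_inner[OF Y(1) Y(1)] by (simp add: power2_eq_square)
  also have "\<dots> = 0"
    using s(2) by (intro integral_eq_zero_AE) (auto elim!: eventually_mono simp: indicator_def)
  finally have "AE \<omega> in M. (Y \<omega>)\<^sup>2 = 0"
    by (subst (asm) integral_nonneg_eq_0_iff_AE) (use Wiener_L2_rv[OF Y(1)] in \<open>auto simp: L2_iff\<close>)
  then have "AE \<omega> in M. X \<omega> * indicator A \<omega> = (X \<omega> - Y \<omega>) * indicator A \<omega>"
    by eventually_elim simp
  moreover have "A \<in> sets M"
    using A subalgebra_generated_filtration[of s B M] B_measurable by (auto simp: subalgebra_def)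
  ultimately have "expectation (\<lambda>\<omega>. X \<omega> * indicator A \<omega>) = expectation (\<lambda>\<omega>. (X \<omega> - Y \<omega>) * indicator A \<omega>)"
    using Wiener_L2_rv[OF W] Wiener_L2_rv[OF Y(1)] by (intro integral_cong_AE) (auto simp: L2_iff)
  with Y(2) show ?thesis
    by simp
qed

lemma step_integral_Wiener:
  assumes \<tau>: "0 \<le> \<tau> 0" "\<And>i. i < n \<Longrightarrow> \<tau> i \<le> \<tau> (Suc i)"
  shows "Wiener (step_function n \<tau> c) (step_integral B n \<tau> c)"
proof -
  have nonneg: "0 \<le> \<tau> i" if "i \<le> n" for i
    using increasing_le[of n \<tau> 0 i] \<tau> that by fastforce
  have "Wiener (indicator {\<tau> i<..\<tau> (Suc i)}) (\<lambda>\<omega>. B (\<tau> (Suc i)) \<omega> - B (\<tau> i) \<omega>)" if "i < n" for i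
  proof -
    have "Wiener (\<lambda>x. indicator {0<..\<tau> (Suc i)} x - indicator {0<..\<tau> i} x) (\<lambda>\<omega>. B (\<tau> (Suc i)) \<omega> - B (\<tau> i) \<omega>)"
      using that nonneg by (intro Wiener_diff Wiener.Brownian) auto
    moreover have "(\<lambda>x. indicat_real {0<..\<tau> (Suc i)} x - indicator {0<..\<tau> i} x) = indicator {\<tau> i<..\<tau> (Suc i)}"
      using \<tau>(2)[OF that] nonneg[of i] that by (auto simp: indicator_def fun_eq_iff)
    ultimately show ?thesis by simp
  qed
  then have "Wiener (\<lambda>x. \<Sum>i<n. c i * indicator {\<tau> i<..\<tau> (Suc i)} x) (\<lambda>\<omega>. \<Sum>i<n. c i * (B (\<tau> (Suc i)) \<omega> - B (\<tau> i) \<omega>))"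
    by (rule Wiener_sum)
  then show ?thesis
    by (simp add: step_function_def[abs_def] step_integral_def[abs_def])
qed

lemma Wiener_integral:
  assumes "is_Wiener_integral M B t f X"
  shows is_Wiener_integral_Wiener: "Wiener (\<lambda>s. f s * indicator {0..t} s) X"
    and is_Wiener_integral_adapted: "X \<in> borel_measurable (generated_filtration M B t)"
proof -
  obtain n \<tau> c where
    \<tau>: "\<And>k. 0 \<le> \<tau> k 0" "\<And>k i. i < n k \<Longrightarrow> \<tau> k i \<le> \<tau> k (Suc i)" "\<And>k. \<tau> k (n k) \<le> t"
    and lim: "L2_tendsto (lebesgue_on {0..t}) (\<lambda>k. step_function (n k) (\<tau> k) (c k)) f"
      "L2_tendsto M (\<lambda>k. step_integral B (n k) (\<tau> k) (c k)) X"
    and L2: "f \<in> L2 (lebesgue_on {0..t})" "X \<in> L2 M"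
    using assms unfolding is_Wiener_integral_def by blast
  note W = step_integral_Wiener[of "\<tau> k" "n k" "c k" for k, OF \<tau>(1,2)]
  have mono: "\<tau> k i \<le> \<tau> k j" if "i \<le> j" "j \<le> n k" for k i j
    using \<tau>(2) that by (intro increasing_le[of "n k" "\<tau> k"]) auto
  have bounds: "0 \<le> \<tau> k i" "\<tau> k i \<le> t" if "i \<le> n k" for k i
    using mono[of 0 i k] mono[of i "n k" k] \<tau>(1,3)[of k] that by linarith+
  have supp: "step_function (n k) (\<tau> k) (c k) s * indicator {0..t} s = step_function (n k) (\<tau> k) (c k) s" for k s
    unfolding step_function_def sum_distrib_right
  proof (rule sum.cong[OF refl])
    fix i assume "i \<in> {..<n k}"
    then show "c k i * indicator {\<tau> k i<..\<tau> k (Suc i)} s * indicator {0..t} s = c k i * indicator {\<tau> k i<..\<tau> k (Suc i)} s"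
      using bounds(1)[of i k] bounds(2)[of "Suc i" k] by (auto simp: indicator_def)
  qed
  have "(LINT s|lebesgue_on {0..t}. (step_function (n k) (\<tau> k) (c k) s - f s)\<^sup>2)
      = (LINT s|lebesgue. (step_function (n k) (\<tau> k) (c k) s - f s * indicator {0..t} s)\<^sup>2)" for k
  proof -
    have "(step_function (n k) (\<tau> k) (c k) s - f s)\<^sup>2 * indicator {0..t} s
        = (step_function (n k) (\<tau> k) (c k) s - f s * indicator {0..t} s)\<^sup>2" for s
      using supp[of k s] by (auto simp: indicator_def)
    then show ?thesis
      by (subst integral_lebesgue_on) auto
  qed
  with lim(1) have lim': "L2_tendsto lebesgue (\<lambda>k. step_function (n k) (\<tau> k) (c k)) (\<lambda>s. f s * indicator {0..t} s)"
    by simp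
  have "(\<lambda>s. f s * indicator {0..t} s) \<in> L2 lebesgue"
    using L2(1) by (simp add: L2_lebesgue_on_iff)
  from W this L2(2) lim' lim(2) show "Wiener (\<lambda>s. f s * indicator {0..t} s) X"
    by (rule limit)
  show "X \<in> borel_measurable (generated_filtration M B t)"
  proof (rule L2_limit_measurable_subalgebra[OF _ _ _ _ L2(2) lim(2)])
    show "subalgebra M (generated_filtration M B t)"
      by (rule subalgebra_generated_filtration) (simp add: B_measurable)
    show "null_sets M \<subseteq> sets (generated_filtration M B t)"
      by (rule null_sets_generated_filtration)
    show "step_integral B (n k) (\<tau> k) (c k) \<in> borel_measurable (generated_filtration M B t)" for k
      unfolding step_integral_def[abs_def]
      by (intro borel_measurable_sum borel_measurable_times borel_measurable_diff borel_measurable_const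
          measurable_generated_filtration bounds) auto
    show "step_integral B (n k) (\<tau> k) (c k) \<in> L2 M" for k
      by (rule Wiener_L2_rv[OF W])
  qed
qed

end

section \<open>Averages over fine partitions\<close>

lemma step_function_Suc:
  "step_function (Suc n) \<tau> c = (\<lambda>s. step_function n \<tau> c s + c n * indicator {\<tau> n<..\<tau> (Suc n)} s)"
  by (simp only: step_function_def[abs_def] sum.lessThan_Suc)

lemma step_function_L2: "step_function n \<tau> c \<in> L2 lebesgue"
proof (induction n)
  case 0
  then show ?case
    by (simp add: step_function_def[abs_def] L2_iff)
next
  case (Suc n)
  show ?case
    unfolding step_function_Suc by (intro L2_lincomb Suc indicator_Ioc_L2)
qed

text \<open>A sum weighted by the indicators of the cells of a partition picks the term of the cell
  that contains \<open>s\<close>. The index is stated before the weights \<open>f\<close>, so that different sums over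
  the same partition can be evaluated at the same cell.\<close>

lemma partition_cell:
  fixes \<tau> :: "nat \<Rightarrow> real"
  assumes mono: "\<forall>i<n. \<tau> i \<le> \<tau> (Suc i)"
  shows "s \<in> {\<tau> 0<..\<tau> n} \<Longrightarrow> \<exists>i<n. s \<in> {\<tau> i<..\<tau> (Suc i)} \<and>
      (\<forall>f. (\<Sum>j<n. f j * indicator {\<tau> j<..\<tau> (Suc j)} s) = (f i :: real))"
    and "s \<notin> {\<tau> 0<..\<tau> n} \<Longrightarrow> (\<Sum>j<n. f j * indicator {\<tau> j<..\<tau> (Suc j)} s) = (0 :: real)"
proof -
  note le = increasing_le[OF mono]
  assume s: "s \<in> {\<tau> 0<..\<tau> n}"
  define i where "i = (LEAST k. s \<le> \<tau> (Suc k))"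
  have "n \<noteq> 0"
    using s by (intro notI) auto
  then have ex: "s \<le> \<tau> (Suc (n - 1))"
    using s by auto
  have i: "s \<le> \<tau> (Suc i)" "i \<le> n - 1"
    unfolding i_def by (rule LeastI[of "\<lambda>k. s \<le> \<tau> (Suc k)", OF ex], rule Least_le[of "\<lambda>k. s \<le> \<tau> (Suc k)", OF ex])
  have "i < n"
    using i(2) \<open>n \<noteq> 0\<close> by simp
  have "\<tau> i < s"
  proof (cases i)
    case 0
    then show ?thesis using s by simp
  next
    case (Suc k)
    then have "\<not> s \<le> \<tau> (Suc k)"
      unfolding i_def by (intro not_less_Least) simp
    then show ?thesis
      using Suc by simp
  qed
  have "(\<Sum>j<n. f j * indicator {\<tau> j<..\<tau> (Suc j)} s) = f i" for f :: "nat \<Rightarrow> real"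
  proof -
    have "(\<Sum>j<n. f j * indicator {\<tau> j<..\<tau> (Suc j)} s) = (\<Sum>j<n. if j = i then f j else 0)"
    proof (rule sum.cong[OF refl])
      fix j assume "j \<in> {..<n}"
      then have "j < n" by simp
      consider "j < i" | "j = i" | "i < j"
        by linarith
      then show "f j * indicator {\<tau> j<..\<tau> (Suc j)} s = (if j = i then f j else 0)"
      proof cases
        case 1
        then have "\<tau> (Suc j) \<le> \<tau> i"
          using \<open>i < n\<close> by (intro le) auto
        then show ?thesis
          using 1 \<open>\<tau> i < s\<close> by (auto simp: indicator_def)
      next
        case 2
        then show ?thesis
          using i(1) \<open>\<tau> i < s\<close> by (auto simp: indicator_def)
      next
        case 3
        then have "\<tau> (Suc i) \<le> \<tau> j"
          using \<open>j < n\<close> by (intro le) auto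
        then show ?thesis
          using 3 i(1) by (auto simp: indicator_def)
      qed
    qed
    also have "\<dots> = f i"
      using \<open>i < n\<close> by simp
    finally show ?thesis .
  qed
  then show "\<exists>i<n. s \<in> {\<tau> i<..\<tau> (Suc i)} \<and> (\<forall>f. (\<Sum>j<n. f j * indicator {\<tau> j<..\<tau> (Suc j)} s) = (f i :: real))"
    using \<open>i < n\<close> \<open>\<tau> i < s\<close> i(1) by auto
next
  note le = increasing_le[OF mono]
  assume s: "s \<notin> {\<tau> 0<..\<tau> n}"
  have "s \<notin> {\<tau> j<..\<tau> (Suc j)}" if "j < n" for j
    using s le[of 0 j] le[of "Suc j" n] that by auto
  then show "(\<Sum>j<n. f j * indicator {\<tau> j<..\<tau> (Suc j)} s) = 0"
    by (intro sum.neutral) auto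
qed

text \<open>As a function of the values \<open>c\<close>, the squared distance splits into one quadratic polynomial
  for each cell.\<close>

lemma step_function_distance:
  fixes \<psi> :: "real \<Rightarrow> real"
  assumes \<psi>: "\<psi> \<in> L2 lebesgue" and mono: "\<forall>i<n. \<tau> i \<le> \<tau> (Suc i)"
  shows "(LINT s|lebesgue. (step_function n \<tau> c s - \<psi> s * indicator {\<tau> 0<..\<tau> n} s)\<^sup>2)
    = (\<Sum>i<n. (LINT s|lebesgue. (\<psi> s)\<^sup>2 * indicator {\<tau> i<..\<tau> (Suc i)} s)
        - 2 * c i * (LINT s|lebesgue. \<psi> s * indicator {\<tau> i<..\<tau> (Suc i)} s) + (c i)\<^sup>2 * (\<tau> (Suc i) - \<tau> i))"
proof -
  have int: "integrable lebesgue (\<lambda>s. (\<psi> s)\<^sup>2 * indicator {a<..b} s)"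
    "integrable lebesgue (\<lambda>s. \<psi> s * indicator {a<..b} s)"
    "integrable lebesgue (indicat_real {a<..b})" for a b
  proof -
    have "(\<lambda>s. \<psi> s * indicator {a<..b} s) \<in> L2 lebesgue"
      using \<psi> by (rule L2_indicator_mult) simp
    moreover have "(\<lambda>s. (\<psi> s * indicator {a<..b} s)\<^sup>2) = (\<lambda>s. (\<psi> s)\<^sup>2 * indicator {a<..b} s)"
      by (auto simp: indicator_def)
    ultimately show "integrable lebesgue (\<lambda>s. (\<psi> s)\<^sup>2 * indicator {a<..b} s)"
      by (simp add: L2_iff)
    show "integrable lebesgue (\<lambda>s. \<psi> s * indicator {a<..b} s)"
      by (rule L2_mult_integrable[OF \<psi> indicator_Ioc_L2])
    have "{a<..b} \<in> lmeasurable"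
      by (intro bounded_set_imp_lmeasurable) auto
    then show "integrable lebesgue (indicat_real {a<..b})"
      by (intro integrable_real_indicator) (auto simp: fmeasurable_def)
  qed
  have "(step_function n \<tau> c s - \<psi> s * indicator {\<tau> 0<..\<tau> n} s)\<^sup>2
      = (\<Sum>i<n. (c i - \<psi> s)\<^sup>2 * indicator {\<tau> i<..\<tau> (Suc i)} s)" for s
  proof (cases "s \<in> {\<tau> 0<..\<tau> n}")
    case True
    then obtain i where i: "\<And>f. (\<Sum>j<n. f j * indicator {\<tau> j<..\<tau> (Suc j)} s) = (f i :: real)"
      using partition_cell(1)[OF mono True] by blast
    show ?thesis
      unfolding step_function_def i using True by simp
  next
    case False
    show ?thesis
      unfolding step_function_def partition_cell(2)[OF mono False] using False by simp
  qed
  then have "(LINT s|lebesgue. (step_function n \<tau> c s - \<psi> s * indicator {\<tau> 0<..\<tau> n} s)\<^sup>2)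
      = (LINT s|lebesgue. (\<Sum>i<n. (c i - \<psi> s)\<^sup>2 * indicator {\<tau> i<..\<tau> (Suc i)} s))"
    by simp
  also have "\<dots> = (LINT s|lebesgue. (\<Sum>i<n. (\<psi> s)\<^sup>2 * indicator {\<tau> i<..\<tau> (Suc i)} s
      - 2 * c i * (\<psi> s * indicator {\<tau> i<..\<tau> (Suc i)} s) + (c i)\<^sup>2 * indicator {\<tau> i<..\<tau> (Suc i)} s))"
    by (intro Bochner_Integration.integral_cong refl sum.cong) (auto simp: power2_eq_square algebra_simps)
  also have "\<dots> = (\<Sum>i<n. (LINT s|lebesgue. (\<psi> s)\<^sup>2 * indicator {\<tau> i<..\<tau> (Suc i)} s)
        - 2 * c i * (LINT s|lebesgue. \<psi> s * indicator {\<tau> i<..\<tau> (Suc i)} s) + (c i)\<^sup>2 * (\<tau> (Suc i) - \<tau> i))"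
    using int mono by (subst Bochner_Integration.integral_sum) (auto intro!: sum.cong)
  finally show ?thesis .
qed

definition interval_average :: "(real \<Rightarrow> real) \<Rightarrow> (nat \<Rightarrow> real) \<Rightarrow> nat \<Rightarrow> real" where
  "interval_average \<psi> \<tau> i = 1 / (\<tau> (Suc i) - \<tau> i) * (LINT s:{\<tau> i..\<tau> (Suc i)}|lebesgue. \<psi> s)"

text \<open>On each cell the average is the minimum of the quadratic polynomial above. Comparison with
  the values of a continuous function is thereby enough to bound the error of the averages.\<close>

lemma averages_best_approximation:
  fixes \<psi> :: "real \<Rightarrow> real"
  assumes \<psi>: "\<psi> \<in> L2 lebesgue" and strict: "\<forall>i<n. \<tau> i < \<tau> (Suc i)"
  shows "(LINT s|lebesgue. (step_function n \<tau> (interval_average \<psi> \<tau>) s - \<psi> s * indicator {\<tau> 0<..\<tau> n} s)\<^sup>2)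
    \<le> (LINT s|lebesgue. (step_function n \<tau> c s - \<psi> s * indicator {\<tau> 0<..\<tau> n} s)\<^sup>2)"
proof -
  have "(LINT s:{a..b}|lebesgue. \<psi> s) = (LINT s|lebesgue. \<psi> s * indicator {a<..b} s)" for a b
    unfolding set_lebesgue_integral_def
  proof (rule integral_cong_AE)
    show "(\<lambda>s. indicator {a..b} s *\<^sub>R \<psi> s) \<in> borel_measurable lebesgue" "(\<lambda>s. \<psi> s * indicator {a<..b} s) \<in> borel_measurable lebesgue"
      using L2_measurable[OF \<psi>]
      by (auto intro!: borel_measurable_times borel_measurable_indicator)
    show "AE s in lebesgue. indicator {a..b} s *\<^sub>R \<psi> s = \<psi> s * indicator {a<..b} s"
      using AE_completion[OF AE_lborel_singleton[of a]] by eventually_elim (auto simp: indicator_def)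
  qed
  note avg = this
  have mono: "\<forall>i<n. \<tau> i \<le> \<tau> (Suc i)"
    using strict by (simp add: less_imp_le)
  show ?thesis
    unfolding step_function_distance[OF \<psi> mono]
  proof (rule sum_mono)
    fix i assume "i \<in> {..<n}"
    then have pos: "\<tau> (Suc i) - \<tau> i > 0"
      using strict by simp
    have *: "- 2 * (1 / L * S) * S + (1 / L * S)\<^sup>2 * L \<le> - 2 * x * S + x\<^sup>2 * L" if "L > 0" for S L x :: real
    proof -
      have "- 2 * x * S + x\<^sup>2 * L - (- 2 * (1 / L * S) * S + (1 / L * S)\<^sup>2 * L) = L * (x - S / L)\<^sup>2"
        using that by (simp add: field_simps power2_eq_square)
      moreover have "L * (x - S / L)\<^sup>2 \<ge> 0"
        using that by simp
      ultimately show ?thesis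
        by linarith
    qed
    show "(LINT s|lebesgue. (\<psi> s)\<^sup>2 * indicator {\<tau> i<..\<tau> (Suc i)} s)
        - 2 * interval_average \<psi> \<tau> i * (LINT s|lebesgue. \<psi> s * indicator {\<tau> i<..\<tau> (Suc i)} s)
        + (interval_average \<psi> \<tau> i)\<^sup>2 * (\<tau> (Suc i) - \<tau> i)
      \<le> (LINT s|lebesgue. (\<psi> s)\<^sup>2 * indicator {\<tau> i<..\<tau> (Suc i)} s)
        - 2 * c i * (LINT s|lebesgue. \<psi> s * indicator {\<tau> i<..\<tau> (Suc i)} s) + (c i)\<^sup>2 * (\<tau> (Suc i) - \<tau> i)"
      using *[OF pos, of "LINT s|lebesgue. \<psi> s * indicator {\<tau> i<..\<tau> (Suc i)} s" "c i"]
      unfolding interval_average_def avg by linarith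
  qed
qed

lemma bounded_L2_on_interval:
  fixes f :: "real \<Rightarrow> real"
  assumes "f \<in> borel_measurable lebesgue" "\<And>s. s \<in> {0..T} \<Longrightarrow> \<bar>f s\<bar> \<le> C"
  shows "(\<lambda>s. f s * indicator {0..T} s) \<in> L2 lebesgue"
proof -
  have "(\<lambda>s. (f s * indicator {0..T} s) * indicat_real {0..T} s) \<in> L2 lebesgue"
  proof (rule L2_bounded_mult[where C = "\<bar>C\<bar>"])
    show "indicat_real {0..T} \<in> L2 lebesgue"
      by (intro indicator_L2 bounded_set_imp_lmeasurable) auto
    show "(\<lambda>s. f s * indicator {0..T} s) \<in> borel_measurable lebesgue"
      by (intro borel_measurable_times borel_measurable_indicator assms(1)) simp
    show "\<bar>f s * indicator {0..T} s\<bar> \<le> \<bar>C\<bar>" for s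
      using assms(2)[of s] by (auto simp: indicator_def)
  qed
  moreover have "(\<lambda>s. (f s * indicator {0..T} s) * indicat_real {0..T} s) = (\<lambda>s. f s * indicator {0..T} s)"
    by (auto simp: indicator_def)
  ultimately show ?thesis
    by simp
qed

lemma continuous_lebesgue_measurable:
  fixes f :: "real \<Rightarrow> real"
  assumes "continuous_on UNIV f"
  shows "f \<in> borel_measurable lebesgue"
  using borel_measurable_continuous_onI[OF assms] by (intro measurable_completion) simp

text \<open>A measurable function is an almost everywhere limit of continuous ones. Clamping both the
  function and its approximants to \<open>[-C, C]\<close> makes dominated convergence applicable, and the
  error of clamping the function vanishes as \<open>C\<close> grows.\<close>

lemma L2_approximate_continuous:
  fixes \<psi> :: "real \<Rightarrow> real"
  assumes \<psi>: "\<psi> \<in> L2 lebesgue" and "e > 0"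
  obtains g where "continuous_on UNIV g" "(LINT s|lebesgue. ((\<psi> s - g s) * indicator {0..T} s)\<^sup>2) < e"
proof -
  define clamp :: "real \<Rightarrow> real \<Rightarrow> real" where "clamp C x = max (- C) (min C x)" for C x
  have [measurable]: "\<psi> \<in> borel_measurable lebesgue"
    using \<psi> by (rule L2_measurable)
  have [measurable]: "{0..T} \<in> sets lebesgue"
    by simp
  have [measurable]: "clamp C \<in> borel_measurable borel" for C
    unfolding clamp_def by measurable
  have "(\<lambda>n. LINT s|lebesgue. ((\<psi> s - clamp (real n) (\<psi> s)) * indicator {0..T} s)\<^sup>2) \<longlonglongrightarrow> (LINT s|(lebesgue :: real measure). 0 :: real)"
  proof (rule integral_dominated_convergence)
    show "integrable lebesgue (\<lambda>s. (\<psi> s)\<^sup>2)"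
      using \<psi> by (rule L2_integrable_square)
    show "AE s in lebesgue. (\<lambda>n. ((\<psi> s - clamp (real n) (\<psi> s)) * indicator {0..T} s)\<^sup>2) \<longlonglongrightarrow> 0"
    proof (rule AE_I2, rule tendsto_eventually)
      fix s
      show "\<forall>\<^sub>F n in sequentially. ((\<psi> s - clamp (real n) (\<psi> s)) * indicator {0..T} s)\<^sup>2 = 0"
        using eventually_ge_at_top[of "nat \<lceil>\<bar>\<psi> s\<bar>\<rceil>"]
      proof eventually_elim
        case (elim n)
        then have "\<bar>\<psi> s\<bar> \<le> real n"
          by linarith
        then show ?case
          by (auto simp: clamp_def)
      qed
    qed
    show "AE s in lebesgue. norm (((\<psi> s - clamp (real n) (\<psi> s)) * indicator {0..T} s)\<^sup>2) \<le> (\<psi> s)\<^sup>2" for n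
    proof (rule AE_I2)
      fix s
      have "\<bar>(\<psi> s - clamp (real n) (\<psi> s)) * indicator {0..T} s\<bar> \<le> \<bar>\<psi> s\<bar>"
        by (auto simp: clamp_def indicator_def)
      then show "norm (((\<psi> s - clamp (real n) (\<psi> s)) * indicator {0..T} s)\<^sup>2) \<le> (\<psi> s)\<^sup>2"
        by (simp add: abs_le_square_iff)
    qed
  qed measurable
  then have "(\<lambda>n. LINT s|lebesgue. ((\<psi> s - clamp (real n) (\<psi> s)) * indicator {0..T} s)\<^sup>2) \<longlonglongrightarrow> 0"
    by simp
  from order_tendstoD(2)[OF this, of "e / 4"] \<open>e > 0\<close>
  have "\<forall>\<^sub>F n in sequentially. (LINT s|lebesgue. ((\<psi> s - clamp (real n) (\<psi> s)) * indicator {0..T} s)\<^sup>2) < e / 4"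
    by simp
  then obtain m where m: "(LINT s|lebesgue. ((\<psi> s - clamp (real m) (\<psi> s)) * indicator {0..T} s)\<^sup>2) < e / 4"
    unfolding eventually_sequentially by blast
  define C where "C = real m"
  have clampC: "\<bar>clamp C x\<bar> \<le> C" for x
    by (auto simp: clamp_def C_def)
  have "\<psi> measurable_on UNIV"
    by (rule lebesgue_measurable_imp_measurable_on) auto
  then obtain N g where g: "negligible N" "\<And>n. continuous_on UNIV (g n)" "\<And>x. x \<notin> N \<Longrightarrow> (\<lambda>n. g n x) \<longlonglongrightarrow> \<psi> x"
    unfolding measurable_on_def by auto
  have cont: "continuous_on UNIV (\<lambda>s. clamp C (g n s))" for n
    unfolding clamp_def by (intro continuous_intros g)
  then have [measurable]: "(\<lambda>s. clamp C (g n s)) \<in> borel_measurable lebesgue" for n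
    by (rule continuous_lebesgue_measurable)
  have "AE s in lebesgue. s \<notin> N"
    using g(1) by (simp add: negligible_iff_null_sets AE_not_in)
  then have ae: "AE s in lebesgue. (\<lambda>n. g n s) \<longlonglongrightarrow> \<psi> s"
    by eventually_elim (rule g(3))
  have "(\<lambda>n. LINT s|lebesgue. ((clamp C (\<psi> s) - clamp C (g n s)) * indicator {0..T} s)\<^sup>2) \<longlonglongrightarrow> (LINT s|(lebesgue :: real measure). 0 :: real)"
  proof (rule integral_dominated_convergence)
    have "integrable lebesgue (indicat_real {0..T})"
      by (intro integrable_real_indicator) (auto simp: emeasure_lborel_Icc_eq)
    then show "integrable lebesgue (\<lambda>s. (2 * C)\<^sup>2 * indicat_real {0..T} s)"
      by simp
    show "AE s in lebesgue. (\<lambda>n. ((clamp C (\<psi> s) - clamp C (g n s)) * indicator {0..T} s)\<^sup>2) \<longlonglongrightarrow> 0"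
      using ae
    proof eventually_elim
      case (elim s)
      then have "(\<lambda>n. ((clamp C (\<psi> s) - clamp C (g n s)) * indicator {0..T} s)\<^sup>2) \<longlonglongrightarrow> ((clamp C (\<psi> s) - clamp C (\<psi> s)) * indicator {0..T} s)\<^sup>2"
        unfolding clamp_def by (intro tendsto_intros)
      then show ?case by simp
    qed
    show "AE s in lebesgue. norm (((clamp C (\<psi> s) - clamp C (g n s)) * indicator {0..T} s)\<^sup>2) \<le> (2 * C)\<^sup>2 * indicator {0..T} s" for n
    proof (rule AE_I2)
      fix s
      have "\<bar>clamp C (\<psi> s) - clamp C (g n s)\<bar> \<le> \<bar>2 * C\<bar>"
        using clampC[of "\<psi> s"] clampC[of "g n s"] by linarith
      then have "(clamp C (\<psi> s) - clamp C (g n s))\<^sup>2 \<le> (2 * C)\<^sup>2"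
        by (simp only: abs_le_square_iff)
      then show "norm (((clamp C (\<psi> s) - clamp C (g n s)) * indicator {0..T} s)\<^sup>2) \<le> (2 * C)\<^sup>2 * indicator {0..T} s"
        by (auto simp: indicator_def)
    qed
  qed measurable
  then have "(\<lambda>n. LINT s|lebesgue. ((clamp C (\<psi> s) - clamp C (g n s)) * indicator {0..T} s)\<^sup>2) \<longlonglongrightarrow> 0"
    by simp
  from order_tendstoD(2)[OF this, of "e / 4"] \<open>e > 0\<close>
  have "\<forall>\<^sub>F n in sequentially. (LINT s|lebesgue. ((clamp C (\<psi> s) - clamp C (g n s)) * indicator {0..T} s)\<^sup>2) < e / 4"
    by simp
  then obtain n where n: "(LINT s|lebesgue. ((clamp C (\<psi> s) - clamp C (g n s)) * indicator {0..T} s)\<^sup>2) < e / 4"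
    unfolding eventually_sequentially by blast
  have L2: "(\<lambda>s. (\<psi> s - clamp C (\<psi> s)) * indicator {0..T} s) \<in> L2 lebesgue"
    "(\<lambda>s. (clamp C (\<psi> s) - clamp C (g n s)) * indicator {0..T} s) \<in> L2 lebesgue"
  proof -
    have "(\<lambda>s. clamp C (\<psi> s) * indicator {0..T} s) \<in> L2 lebesgue" "(\<lambda>s. clamp C (g n s) * indicator {0..T} s) \<in> L2 lebesgue"
      by (rule bounded_L2_on_interval[where C = C]; use clampC in auto)+
    moreover have "(\<lambda>s. \<psi> s * indicator {0..T} s) \<in> L2 lebesgue"
      using \<psi> by (rule L2_indicator_mult) simp
    ultimately show "(\<lambda>s. (\<psi> s - clamp C (\<psi> s)) * indicator {0..T} s) \<in> L2 lebesgue"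
      "(\<lambda>s. (clamp C (\<psi> s) - clamp C (g n s)) * indicator {0..T} s) \<in> L2 lebesgue"
      unfolding left_diff_distrib by (auto intro: L2_diff)
  qed
  have "(LINT s|lebesgue. ((\<psi> s - clamp C (g n s)) * indicator {0..T} s)\<^sup>2)
      = (LINT s|lebesgue. ((\<psi> s - clamp C (\<psi> s)) * indicator {0..T} s + (clamp C (\<psi> s) - clamp C (g n s)) * indicator {0..T} s)\<^sup>2)"
    by (simp add: algebra_simps)
  also have "\<dots> \<le> 2 * (LINT s|lebesgue. ((\<psi> s - clamp C (\<psi> s)) * indicator {0..T} s)\<^sup>2)
      + 2 * (LINT s|lebesgue. ((clamp C (\<psi> s) - clamp C (g n s)) * indicator {0..T} s)\<^sup>2)"
    by (rule L2_square_triangle[OF L2])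
  also have "\<dots> < e"
    using m n by (simp add: C_def)
  finally show thesis
    by (rule that[OF cont])
qed

text \<open>The step function of averages is at least as close to \<open>\<psi>\<close> as the one with the values
  \<open>g (\<tau> i)\<close>, for \<open>g\<close> continuous and close to \<open>\<psi>\<close>; the latter is close to \<open>g\<close> by uniform
  continuity.\<close>

lemma averages_tendsto:
  fixes \<psi> :: "real \<Rightarrow> real"
  assumes \<psi>: "\<psi> \<in> L2 lebesgue" and "T > 0" "e > 0"
  shows "\<exists>\<delta>>0. \<forall>n \<tau>. is_partition T n \<tau> \<and> (\<forall>i<n. \<tau> (Suc i) - \<tau> i < \<delta>) \<longrightarrow>
    (LINT s|lebesgue. (step_function n \<tau> (interval_average \<psi> \<tau>) s - \<psi> s * indicator {0<..T} s)\<^sup>2) < e"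
proof -
  obtain g where g: "continuous_on UNIV g" "(LINT s|lebesgue. ((\<psi> s - g s) * indicator {0..T} s)\<^sup>2) < e / 4"
    using L2_approximate_continuous[OF \<psi>, of "e / 4" T] \<open>e > 0\<close> by auto
  \<comment> \<open>Chosen so that the modulus of continuity contributes \<open>2 * \<eta>\<^sup>2 * T = e / 2\<close>.\<close>
  define \<eta> where "\<eta> = sqrt (e / (4 * T))"
  have \<eta>: "\<eta> > 0" "\<eta>\<^sup>2 = e / (4 * T)"
    using \<open>e > 0\<close> \<open>T > 0\<close> by (auto simp: \<eta>_def)
  have cont: "continuous_on {0..T} g"
    using g(1) by (rule continuous_on_subset) simp
  then have "uniformly_continuous_on {0..T} g"
    by (intro compact_uniformly_continuous) auto
  then obtain \<delta> where \<delta>: "\<delta> > 0" "\<And>s t. s \<in> {0..T} \<Longrightarrow> t \<in> {0..T} \<Longrightarrow> \<bar>s - t\<bar> < \<delta> \<Longrightarrow> \<bar>g s - g t\<bar> < \<eta>"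
    using \<eta>(1) unfolding uniformly_continuous_on_def dist_real_def by metis
  have gm: "g \<in> borel_measurable lebesgue"
    using g(1) by (rule continuous_lebesgue_measurable)
  have "bounded (g ` {0..T})"
    using cont by (intro compact_imp_bounded compact_continuous_image) auto
  then obtain C where "\<forall>s\<in>{0..T}. \<bar>g s\<bar> \<le> C"
    by (auto simp: bounded_iff)
  then have gL2: "(\<lambda>s. g s * indicator {0..T} s) \<in> L2 lebesgue"
    by (intro bounded_L2_on_interval[OF gm, where C = C]) blast
  have main: "(LINT s|lebesgue. (step_function n \<tau> (interval_average \<psi> \<tau>) s - \<psi> s * indicator {0<..T} s)\<^sup>2) < e"
    if part: "is_partition T n \<tau>" and mesh: "\<And>i. i < n \<Longrightarrow> \<tau> (Suc i) - \<tau> i < \<delta>" for n \<tau>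
  proof -
    have \<tau>: "\<tau> 0 = 0" "\<tau> n = T" "\<forall>i<n. \<tau> i < \<tau> (Suc i)"
      using part by (auto simp: is_partition_def)
    then have mono: "\<forall>i<n. \<tau> i \<le> \<tau> (Suc i)"
      by (simp add: less_imp_le)
    note le = increasing_le[OF mono]
    let ?g = "\<lambda>i. g (\<tau> i)"
    have L2: "(\<lambda>s. (\<psi> s - g s) * indicator {0..T} s) \<in> L2 lebesgue"
      unfolding left_diff_distrib by (intro L2_diff gL2 L2_indicator_mult[OF \<psi>]) simp
    have L2': "(\<lambda>s. step_function n \<tau> ?g s - \<psi> s * indicator {0<..T} s) \<in> L2 lebesgue"
      by (intro L2_diff step_function_L2 L2_indicator_mult[OF \<psi>]) simp
    have int: "integrable lebesgue (indicat_real {0..T})"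
      by (intro integrable_real_indicator) (auto simp: emeasure_lborel_Icc_eq)
    have "(LINT s|lebesgue. (step_function n \<tau> (interval_average \<psi> \<tau>) s - \<psi> s * indicator {0<..T} s)\<^sup>2)
      \<le> (LINT s|lebesgue. (step_function n \<tau> ?g s - \<psi> s * indicator {0<..T} s)\<^sup>2)"
      using averages_best_approximation[OF \<psi> \<tau>(3), of ?g] by (simp add: \<tau>(1,2))
    also have "\<dots> \<le> (LINT s|lebesgue. 2 * ((\<psi> s - g s) * indicator {0..T} s)\<^sup>2 + 2 * (\<eta>\<^sup>2 * indicator {0..T} s))"
    proof (rule integral_mono)
      show "integrable lebesgue (\<lambda>s. (step_function n \<tau> ?g s - \<psi> s * indicator {0<..T} s)\<^sup>2)"
        using L2' by (rule L2_integrable_square)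
      show "integrable lebesgue (\<lambda>s. 2 * ((\<psi> s - g s) * indicator {0..T} s)\<^sup>2 + 2 * (\<eta>\<^sup>2 * indicator {0..T} s))"
        using L2_integrable_square[OF L2] int by auto
      fix s :: real
      show "(step_function n \<tau> ?g s - \<psi> s * indicator {0<..T} s)\<^sup>2
          \<le> 2 * ((\<psi> s - g s) * indicator {0..T} s)\<^sup>2 + 2 * (\<eta>\<^sup>2 * indicator {0..T} s)"
      proof (cases "s \<in> {0<..T}")
        case True
        then have "s \<in> {\<tau> 0<..\<tau> n}"
          by (simp add: \<tau>)
        from partition_cell(1)[OF mono this] obtain i where i: "i < n" "s \<in> {\<tau> i<..\<tau> (Suc i)}"
          "\<And>f. (\<Sum>j<n. f j * indicator {\<tau> j<..\<tau> (Suc j)} s) = (f i :: real)"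
          by blast
        have "0 \<le> \<tau> i" "\<tau> i \<le> T"
          using le[of 0 i] le[of i n] i(1) \<tau>(1,2) by auto
        then have "\<bar>g (\<tau> i) - g s\<bar> < \<eta>"
          using True i mesh[OF i(1)] by (intro \<delta>(2)) auto
        then have *: "(g (\<tau> i) - g s)\<^sup>2 \<le> \<eta>\<^sup>2"
          using \<eta>(1) by (intro abs_le_square_iff[THEN iffD1]) auto
        have "(g (\<tau> i) - \<psi> s)\<^sup>2 \<le> 2 * (\<psi> s - g s)\<^sup>2 + 2 * (g (\<tau> i) - g s)\<^sup>2"
          using zero_le_power2[of "(g (\<tau> i) - g s) + (\<psi> s - g s)"] by (simp add: power2_eq_square algebra_simps)
        then show ?thesis
          unfolding step_function_def i(3) using True * by simp
      next
        case False
        then have "s \<notin> {\<tau> 0<..\<tau> n}"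
          by (simp add: \<tau>)
        then show ?thesis
          unfolding step_function_def partition_cell(2)[OF mono \<open>s \<notin> {\<tau> 0<..\<tau> n}\<close>] using False by simp
      qed
    qed
    also have "\<dots> = 2 * (LINT s|lebesgue. ((\<psi> s - g s) * indicator {0..T} s)\<^sup>2) + 2 * (\<eta>\<^sup>2 * T)"
      using L2_integrable_square[OF L2] int \<open>T > 0\<close> by simp
    also have "\<dots> < e"
      using g(2) \<eta>(2) \<open>T > 0\<close> by simp
    finally show ?thesis .
  qed
  show ?thesis
    by (intro exI[of _ \<delta>] conjI \<delta>(1) allI impI, elim conjE, rule main) auto
qed

section \<open>The operator \<open>K\<^sub>F\<^sup>*\<close>\<close>

locale F_Gaussian = Brownian_motion M B for M :: "'a measure" and B +
  fixes F F' :: "real \<Rightarrow> real \<Rightarrow> real" and BF :: "real \<Rightarrow> 'a \<Rightarrow> real" and T :: real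
  assumes process: "F_Gaussian_process M B F BF"
    and T_pos: "T > 0"
    and derivative: "L2_time_derivative T F F'"
    and F_continuous: "continuous_on ({0..T} \<times> {0..T}) (\<lambda>(t, s). F t s)"
begin

lemma BF_Wiener: "0 \<le> t \<Longrightarrow> Wiener (\<lambda>s. F t s * indicator {0..t} s) (BF t)"
  and BF_adapted: "0 \<le> t \<Longrightarrow> BF t \<in> borel_measurable (generated_filtration M B t)"
  using process is_Wiener_integral_Wiener is_Wiener_integral_adapted
  unfolding F_Gaussian_process_def by blast+

lemma BF_measurable: "0 \<le> t \<Longrightarrow> BF t \<in> borel_measurable M"
  using Wiener_L2_rv[OF BF_Wiener] by (rule L2_measurable)

lemma AE_lebesgue_on_iff:
  "(AE s in lebesgue_on {a..b::real}. P s) \<longleftrightarrow> (AE s in lebesgue. s \<in> {a..b} \<longrightarrow> P s)"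
  by (rule AE_restrict_space_iff) simp

text \<open>Fubini's theorem for the square of \<open>F'\<close>, with \<open>N s\<close> the square integral of \<open>F'(\<cdot>, s)\<close>. As \<open>F'\<close>
  is only Lebesgue measurable in the plane, the theorem is applied to a Borel function \<open>k\<close> that
  agrees with \<open>F'\<close> almost everywhere; the coordinates are swapped because it is the second
  variable that is kept fixed.\<close>

lemma derivative_slices:
  obtains N where "integrable lebesgue N"
    "AE s in lebesgue. s \<in> {0..T} \<longrightarrow> (\<lambda>u. F' u s * indicator {0..T} u) \<in> L2 lebesgue \<and>
      (LINT u|lebesgue. (F' u s * indicator {0..T} u)\<^sup>2) \<le> N s"
proof -
  define h where "h z = (case z of (t, s) \<Rightarrow> F' t s) * indicator ({0..T} \<times> {0..T}) z" for z
  have "(\<lambda>(t, s). F' t s) \<in> L2 (lebesgue_on ({0..T} \<times> {0..T}))"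
    using derivative by (simp add: L2_time_derivative_def)
  moreover have "{0..T} \<times> {0..T} \<in> sets lebesgue"
    by (intro sets_completionI_sets) (simp add: closed_Times borel_closed)
  ultimately have h: "h \<in> L2 lebesgue"
    by (simp add: L2_lebesgue_on_iff h_def[abs_def])
  obtain k where k: "k \<in> borel_measurable lborel" "AE z in lborel. h z = k z"
    using completion_ex_borel_measurable_real[OF L2_measurable[OF h]] by auto
  have kb: "k \<in> borel_measurable (borel :: (real \<times> real) measure)"
    using k(1) by simp
  have "k \<in> L2 lebesgue"
    using L2_AE_cong[OF h AE_completion[OF k(2)]] k(1) by (simp add: measurable_completion)
  then have "integrable lborel (\<lambda>z. (k z)\<^sup>2)"
    using integrable_completion[of "\<lambda>z. (k z)\<^sup>2" lborel] k(1) by (auto simp: L2_iff)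
  then have int: "integrable (lborel \<Otimes>\<^sub>M lborel) (\<lambda>z. (k z)\<^sup>2)"
    by (simp add: lborel_prod)
  from lborel_pair.integrable_product_swap[OF int]
  have int': "integrable (lborel \<Otimes>\<^sub>M lborel) (\<lambda>(s, u). (k (u, s))\<^sup>2)" .
  have "AE z in lborel \<Otimes>\<^sub>M lborel. h z = k z"
    unfolding lborel_prod by (rule k(2))
  then have "AE z in distr (lborel \<Otimes>\<^sub>M lborel) (lborel \<Otimes>\<^sub>M lborel) (\<lambda>(x, y). (y, x)). h z = k z"
    unfolding lborel_pair.distr_pair_swap[symmetric] .
  then have "AE z in lborel \<Otimes>\<^sub>M lborel. h (case z of (x, y) \<Rightarrow> (y, x)) = k (case z of (x, y) \<Rightarrow> (y, x))"
    by (rule AE_distrD[rotated]) measurable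
  then have ae: "AE s in lborel. AE u in lborel. h (u, s) = k (u, s)"
    using lborel_pair.AE_pair by fastforce
  define N where "N s = (LINT u|lborel. (k (u, s))\<^sup>2)" for s
  have "integrable lborel N"
    using lborel_pair.integrable_fst'[OF int'] by (simp add: N_def[abs_def])
  then have "integrable lebesgue N"
    using integrable_completion[of N lborel] by (simp add: borel_measurable_integrable)
  moreover have "AE s in lborel. integrable lborel (\<lambda>u. (k (u, s))\<^sup>2)"
    using lborel_pair.AE_integrable_fst'[OF int'] by simp
  with ae have "AE s in lborel. s \<in> {0..T} \<longrightarrow> (\<lambda>u. F' u s * indicator {0..T} u) \<in> L2 lebesgue \<and>
      (LINT u|lebesgue. (F' u s * indicator {0..T} u)\<^sup>2) \<le> N s"
  proof eventually_elim
    case (elim s)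
    show ?case
    proof
      assume s: "s \<in> {0..T}"
      have hs: "h (u, s) = F' u s * indicator {0..T} u" for u
        using s by (auto simp: h_def indicator_def)
      have ks: "(\<lambda>u. k (u, s)) \<in> borel_measurable borel"
        using kb by (rule measurable_compose[rotated]) (simp add: borel_prod[symmetric])
      have "(\<lambda>u. k (u, s)) \<in> L2 lebesgue"
        using elim(2) ks integrable_completion[of "\<lambda>u. (k (u, s))\<^sup>2" lborel]
        by (auto simp: L2_iff intro: measurable_completion)
      moreover have AE: "AE u in lebesgue. k (u, s) = F' u s * indicator {0..T} u"
        using AE_completion[OF elim(1)] by eventually_elim (simp add: hs)
      ultimately have L2: "(\<lambda>u. F' u s * indicator {0..T} u) \<in> L2 lebesgue"
        by (rule L2_AE_cong) (rule borel_measurable_AE[OF measurable_completion AE], use ks in simp)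
      have "(LINT u|lebesgue. (F' u s * indicator {0..T} u)\<^sup>2) = (LINT u|lebesgue. (k (u, s))\<^sup>2)"
      proof (rule integral_cong_AE)
        show "(\<lambda>u. (F' u s * indicator {0..T} u)\<^sup>2) \<in> borel_measurable lebesgue"
          using L2_integrable_square[OF L2] by (rule borel_measurable_integrable)
        show "(\<lambda>u. (k (u, s))\<^sup>2) \<in> borel_measurable lebesgue"
          using ks by (intro borel_measurable_power measurable_completion) simp
        show "AE u in lebesgue. (F' u s * indicator {0..T} u)\<^sup>2 = (k (u, s))\<^sup>2"
          using AE by eventually_elim simp
      qed
      also have "\<dots> = N s"
        unfolding N_def using ks by (intro integral_completion) simp
      finally show "(\<lambda>u. F' u s * indicator {0..T} u) \<in> L2 lebesgue \<and>
          (LINT u|lebesgue. (F' u s * indicator {0..T} u)\<^sup>2) \<le> N s"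
        using L2 by simp
    qed
  qed
  ultimately show thesis
    by (intro that[of N] AE_completion)
qed

text \<open>\<open>K\<^sub>F\<^sup>* \<phi>\<close>, extended by \<open>0\<close> outside \<open>[0, T]\<close> so that integrals run over the whole line.\<close>

definition kernel_operator :: "(real \<Rightarrow> real) \<Rightarrow> real \<Rightarrow> real" where
  "kernel_operator \<phi> s = indicator {0..T} s * (F s s * \<phi> s + (LINT u:{s..T}|lebesgue. F' u s * \<phi> u))"

lemma derivative_product_integrable:
  assumes "(\<lambda>u. F' u s * indicator {0..T} u) \<in> L2 lebesgue" "\<phi> \<in> L2 lebesgue" "s \<in> {0..T}"
  shows "set_integrable lebesgue {s..T} (\<lambda>u. F' u s * \<phi> u)"
proof -
  have "integrable lebesgue (\<lambda>u. (F' u s * indicator {0..T} u) * (\<phi> u * indicator {s..T} u))"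
    by (rule L2_mult_integrable[OF assms(1) L2_indicator_mult[OF assms(2)]]) simp
  moreover have "(\<lambda>u. (F' u s * indicator {0..T} u) * (\<phi> u * indicator {s..T} u))
      = (\<lambda>u. indicator {s..T} u *\<^sub>R (F' u s * \<phi> u))"
    using assms(3) by (auto simp: indicator_def fun_eq_iff)
  ultimately show ?thesis
    unfolding set_integrable_def by (simp only:)
qed

lemma kernel_operator_lincomb:
  assumes "\<phi> \<in> L2 lebesgue" "\<psi> \<in> L2 lebesgue"
  shows "AE s in lebesgue. kernel_operator (\<lambda>u. \<phi> u + c * \<psi> u) s = kernel_operator \<phi> s + c * kernel_operator \<psi> s"
proof -
  obtain N where "AE s in lebesgue. s \<in> {0..T} \<longrightarrow> (\<lambda>u. F' u s * indicator {0..T} u) \<in> L2 lebesgue \<and>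
      (LINT u|lebesgue. (F' u s * indicator {0..T} u)\<^sup>2) \<le> N s"
    by (rule derivative_slices)
  then show ?thesis
  proof eventually_elim
    case (elim s)
    show ?case
    proof (cases "s \<in> {0..T}")
      case True
      then have *: "(\<lambda>u. F' u s * indicator {0..T} u) \<in> L2 lebesgue"
        using elim by blast
      have "(LINT u:{s..T}|lebesgue. F' u s * (\<phi> u + c * \<psi> u)) = (LINT u:{s..T}|lebesgue. F' u s * \<phi> u + c * (F' u s * \<psi> u))"
        by (simp add: algebra_simps)
      also have "\<dots> = (LINT u:{s..T}|lebesgue. F' u s * \<phi> u) + c * (LINT u:{s..T}|lebesgue. F' u s * \<psi> u)"
        using derivative_product_integrable[OF * assms(1) True] derivative_product_integrable[OF * assms(2) True] by simp
      finally show ?thesis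
        by (simp add: kernel_operator_def algebra_simps)
    qed (simp add: kernel_operator_def)
  qed
qed

text \<open>The diagonal term is bounded since \<open>F\<close> is bounded on the compact diagonal, the integral term by the
  Cauchy--Schwarz inequality in \<open>u\<close> for almost every \<open>s\<close>.\<close>

lemma kernel_operator_bounded:
  "\<exists>C\<ge>0. \<forall>\<phi>\<in>L2 lebesgue. (LINT s|lebesgue. (kernel_operator \<phi> s)\<^sup>2) \<le> C * (LINT s|lebesgue. (\<phi> s)\<^sup>2)"
proof -
  obtain N where N: "integrable lebesgue N"
    "AE s in lebesgue. s \<in> {0..T} \<longrightarrow> (\<lambda>u. F' u s * indicator {0..T} u) \<in> L2 lebesgue \<and>
      (LINT u|lebesgue. (F' u s * indicator {0..T} u)\<^sup>2) \<le> N s"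
    by (rule derivative_slices)
  have "continuous_on {0..T} (\<lambda>s. case (s, s) of (t, s) \<Rightarrow> F t s)"
    by (rule continuous_on_compose2[OF F_continuous]) (auto intro!: continuous_intros)
  then have "bounded ((\<lambda>s. F s s) ` {0..T})"
    by (intro compact_imp_bounded compact_continuous_image) auto
  then obtain c where c: "\<forall>s\<in>{0..T}. \<bar>F s s\<bar> \<le> c"
    by (auto simp: bounded_iff)
  define C where "C = 2 * c\<^sup>2 + 2 * (LINT s|lebesgue. \<bar>N s\<bar>)"
  have "(LINT s|lebesgue. (kernel_operator \<phi> s)\<^sup>2) \<le> C * (LINT s|lebesgue. (\<phi> s)\<^sup>2)"
    if \<phi>: "\<phi> \<in> L2 lebesgue" for \<phi>
  proof -
    let ?n = "LINT s|lebesgue. (\<phi> s)\<^sup>2"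
    have "?n \<ge> 0"
      by simp
    have "(LINT s|lebesgue. (kernel_operator \<phi> s)\<^sup>2) \<le> (LINT s|lebesgue. 2 * c\<^sup>2 * (\<phi> s)\<^sup>2 + 2 * ?n * \<bar>N s\<bar>)"
    proof (rule integral_mono_AE')
      show "integrable lebesgue (\<lambda>s. 2 * c\<^sup>2 * (\<phi> s)\<^sup>2 + 2 * ?n * \<bar>N s\<bar>)"
        using N(1) L2_integrable_square[OF \<phi>] by auto
      show "AE s in lebesgue. 0 \<le> 2 * c\<^sup>2 * (\<phi> s)\<^sup>2 + 2 * ?n * \<bar>N s\<bar>"
        using \<open>?n \<ge> 0\<close> by (intro AE_I2 add_nonneg_nonneg mult_nonneg_nonneg) auto
      show "AE s in lebesgue. (kernel_operator \<phi> s)\<^sup>2 \<le> 2 * c\<^sup>2 * (\<phi> s)\<^sup>2 + 2 * ?n * \<bar>N s\<bar>"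
        using N(2)
      proof eventually_elim
        case (elim s)
        show ?case
        proof (cases "s \<in> {0..T}")
          case True
          then have L2: "(\<lambda>u. F' u s * indicator {0..T} u) \<in> L2 lebesgue"
            and Ns: "(LINT u|lebesgue. (F' u s * indicator {0..T} u)\<^sup>2) \<le> N s"
            using elim by auto
          have L2': "(\<lambda>u. \<phi> u * indicator {s..T} u) \<in> L2 lebesgue"
            using \<phi> by (rule L2_indicator_mult) simp
          have "(LINT u:{s..T}|lebesgue. F' u s * \<phi> u) = (LINT u|lebesgue. (F' u s * indicator {0..T} u) * (\<phi> u * indicator {s..T} u))"
            unfolding set_lebesgue_integral_def using True
            by (intro Bochner_Integration.integral_cong) (auto simp: indicator_def)
          then have "(LINT u:{s..T}|lebesgue. F' u s * \<phi> u)\<^sup>2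
              \<le> (LINT u|lebesgue. (F' u s * indicator {0..T} u)\<^sup>2) * (LINT u|lebesgue. (\<phi> u * indicator {s..T} u)\<^sup>2)"
            using L2_Cauchy_Schwarz[OF L2 L2'] by simp
          also have "\<dots> \<le> \<bar>N s\<bar> * ?n"
          proof (rule mult_mono)
            show "(LINT u|lebesgue. (\<phi> u * indicator {s..T} u)\<^sup>2) \<le> ?n"
              using L2_integrable_square[OF \<phi>] L2_integrable_square[OF L2'] by (intro integral_mono) (auto simp: indicator_def)
          qed (use Ns in auto)
          finally have int: "(LINT u:{s..T}|lebesgue. F' u s * \<phi> u)\<^sup>2 \<le> \<bar>N s\<bar> * ?n" .
          have "(F s s * \<phi> s)\<^sup>2 \<le> c\<^sup>2 * (\<phi> s)\<^sup>2"
            unfolding power_mult_distrib using bspec[OF c True]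
            by (intro mult_right_mono abs_le_square_iff[THEN iffD1]) auto
          moreover have "(a + b)\<^sup>2 \<le> 2 * a\<^sup>2 + 2 * b\<^sup>2" for a b :: real
            using zero_le_power2[of "a - b"] by (simp add: power2_eq_square algebra_simps)
          then have "(kernel_operator \<phi> s)\<^sup>2 \<le> 2 * (F s s * \<phi> s)\<^sup>2 + 2 * (LINT u:{s..T}|lebesgue. F' u s * \<phi> u)\<^sup>2"
            using True by (simp add: kernel_operator_def)
          ultimately show ?thesis
            using int by (simp add: algebra_simps)
        next
          case False
          then show ?thesis
            using \<open>?n \<ge> 0\<close> by (simp add: kernel_operator_def)
        qed
      qed
    qed
    also have "\<dots> = 2 * c\<^sup>2 * ?n + 2 * ?n * (LINT s|lebesgue. \<bar>N s\<bar>)"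
      using N(1) L2_integrable_square[OF \<phi>] by simp
    also have "\<dots> = C * ?n"
      by (simp add: C_def algebra_simps)
    finally show ?thesis .
  qed
  moreover have "C \<ge> 0"
    by (simp add: C_def)
  ultimately show ?thesis
    by blast
qed

text \<open>For \<open>a < s \<le> b\<close> the diagonal term \<open>F(s, s)\<close> is the starting value from which \<open>F(\<cdot>, s)\<close>
  grows to \<open>F(b, s)\<close>; for \<open>s \<le> a\<close> it is absent and the integral is the increment over \<open>(a, b]\<close>.
  The right-hand side is the function whose Wiener integral is \<open>BF b - BF a\<close>.\<close>

lemma kernel_operator_interval:
  assumes "0 \<le> a" "a \<le> b" "b \<le> T"
  shows "AE s in lebesgue. kernel_operator (indicator {a<..b}) s = F b s * indicator {0..b} s - F a s * indicator {0..a} s"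
proof -
  have "AE s in lebesgue_on {0..T}. \<forall>t\<in>{0..T}. set_integrable lebesgue {0..t} (\<lambda>u. F' u s) \<and>
        F t s = F 0 s + (LINT u:{0..t}|lebesgue. F' u s)"
    using derivative by (simp add: L2_time_derivative_def)
  then have "AE s in lebesgue. s \<in> {0..T} \<longrightarrow> (\<forall>t\<in>{0..T}. set_integrable lebesgue {0..t} (\<lambda>u. F' u s) \<and>
        F t s = F 0 s + (LINT u:{0..t}|lebesgue. F' u s))"
    by (simp only: AE_lebesgue_on_iff)
  then show ?thesis
  proof eventually_elim
    case (elim s)
    show ?case
    proof (cases "s \<in> {0..T}")
      case True
      have diff: "(LINT u:{p<..q}|lebesgue. F' u s) = F q s - F p s" if "0 \<le> p" "p \<le> q" "q \<le> T" for p q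
      proof -
        have pq: "p \<in> {0..T}" "q \<in> {0..T}"
          using that by auto
        have *: "set_integrable lebesgue {0..q} (\<lambda>u. F' u s)" "set_integrable lebesgue {0..p} (\<lambda>u. F' u s)"
          "F q s = F 0 s + (LINT u:{0..q}|lebesgue. F' u s)" "F p s = F 0 s + (LINT u:{0..p}|lebesgue. F' u s)"
          using elim[rule_format, OF True pq(1)] elim[rule_format, OF True pq(2)] by blast+
        have "set_integrable lebesgue {p<..q} (\<lambda>u. F' u s)"
          using *(1) by (rule set_integrable_subset) (use that in auto)
        then have "(LINT u:{0..p} \<union> {p<..q}|lebesgue. F' u s) = (LINT u:{0..p}|lebesgue. F' u s) + (LINT u:{p<..q}|lebesgue. F' u s)"
          using *(2) by (intro set_integral_Un) auto
        moreover have "{0..p} \<union> {p<..q} = {0..q}"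
          using that by auto
        ultimately have "(LINT u:{0..q}|lebesgue. F' u s) = (LINT u:{0..p}|lebesgue. F' u s) + (LINT u:{p<..q}|lebesgue. F' u s)"
          by simp
        then show ?thesis
          using *(3,4) by linarith
      qed
      have K: "kernel_operator (indicator {a<..b}) s = F s s * indicator {a<..b} s + (LINT u:{s..T}|lebesgue. F' u s * indicator {a<..b} u)"
        using True by (simp add: kernel_operator_def)
      consider "s \<le> a" | "a < s" "s \<le> b" | "b < s"
        by linarith
      then show ?thesis
      proof cases
        case 1
        have "(LINT u:{s..T}|lebesgue. F' u s * indicator {a<..b} u) = (LINT u:{a<..b}|lebesgue. F' u s)"
          unfolding set_lebesgue_integral_def using 1 assms
          by (intro Bochner_Integration.integral_cong) (auto simp: indicator_def)
        then show ?thesis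
          using 1 True assms diff[of a b] by (simp add: K)
      next
        case 2
        have "(LINT u:{s..T}|lebesgue. F' u s * indicator {a<..b} u) = (LINT u:{s..b}|lebesgue. F' u s)"
          unfolding set_lebesgue_integral_def using 2 assms
          by (intro Bochner_Integration.integral_cong) (auto simp: indicator_def)
        also have "\<dots> = (LINT u:{s<..b}|lebesgue. F' u s)"
          unfolding set_lebesgue_integral_def
        proof (rule integral_cong_AE)
          have "set_integrable lebesgue {0..T} (\<lambda>u. F' u s)"
            using elim[rule_format, OF True, of T] T_pos by simp
          then have "set_integrable lebesgue {s..b} (\<lambda>u. F' u s)" "set_integrable lebesgue {s<..b} (\<lambda>u. F' u s)"
            by (rule set_integrable_subset; use True assms in auto)+
          then show "(\<lambda>u. indicator {s..b} u *\<^sub>R F' u s) \<in> borel_measurable lebesgue"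
            "(\<lambda>u. indicator {s<..b} u *\<^sub>R F' u s) \<in> borel_measurable lebesgue"
            unfolding set_integrable_def by (blast intro: borel_measurable_integrable)+
          show "AE u in lebesgue. indicator {s..b} u *\<^sub>R F' u s = indicator {s<..b} u *\<^sub>R F' u s"
            using AE_completion[OF AE_lborel_singleton[of s]] by eventually_elim (auto simp: indicator_def)
        qed
        finally show ?thesis
          using 2 True assms diff[of s b] by (simp add: K)
      next
        case 3
        have "(LINT u:{s..T}|lebesgue. F' u s * indicator {a<..b} u) = (LINT u|(lebesgue :: real measure). 0 :: real)"
          unfolding set_lebesgue_integral_def using 3
          by (intro Bochner_Integration.integral_cong) (auto simp: indicator_def)
        then show ?thesis
          using 3 assms by (simp add: K)
      qed
    next
      case False
      then have "s \<notin> {0..b}" "s \<notin> {0..a}"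
        using assms by auto
      with False show ?thesis
        by (simp add: kernel_operator_def)
    qed
  qed
qed

text \<open>A weighted sum of increments of \<open>B\<^sup>F\<close> is exactly the Wiener integral of the image under
  \<open>K\<^sub>F\<^sup>*\<close> of the corresponding step function.\<close>

lemma increments_Wiener:
  assumes "0 \<le> \<tau> 0" "\<forall>i<n. \<tau> i \<le> \<tau> (Suc i)" "\<tau> n \<le> T"
  shows "Wiener (kernel_operator (step_function n \<tau> c)) (\<lambda>\<omega>. \<Sum>i<n. c i * (BF (\<tau> (Suc i)) \<omega> - BF (\<tau> i) \<omega>))"
  using assms(2,3)
proof (induction n)
  case 0
  have "kernel_operator (step_function 0 \<tau> c) = (\<lambda>_. 0)"
    by (auto simp: kernel_operator_def step_function_def set_lebesgue_integral_def)
  then show ?case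
    by (simp add: Wiener_zero)
next
  case (Suc n)
  have "\<tau> n \<le> \<tau> (Suc n)"
    using Suc.prems by auto
  then have IH: "Wiener (kernel_operator (step_function n \<tau> c)) (\<lambda>\<omega>. \<Sum>i<n. c i * (BF (\<tau> (Suc i)) \<omega> - BF (\<tau> i) \<omega>))"
    using Suc by auto
  have "0 \<le> \<tau> n"
    using increasing_le[of "Suc n" \<tau> 0 n] Suc.prems assms(1) by auto
  let ?f = "\<lambda>s. F (\<tau> (Suc n)) s * indicator {0..\<tau> (Suc n)} s - F (\<tau> n) s * indicator {0..\<tau> n} s"
  have "Wiener ?f (\<lambda>\<omega>. BF (\<tau> (Suc n)) \<omega> - BF (\<tau> n) \<omega>)"
    using \<open>0 \<le> \<tau> n\<close> \<open>\<tau> n \<le> \<tau> (Suc n)\<close> by (intro Wiener_diff BF_Wiener) auto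
  from lincomb[OF IH this, of "c n"]
  have "Wiener (\<lambda>s. kernel_operator (step_function n \<tau> c) s + c n * ?f s)
      (\<lambda>\<omega>. \<Sum>i<Suc n. c i * (BF (\<tau> (Suc i)) \<omega> - BF (\<tau> i) \<omega>))"
    by simp
  then show ?case
  proof (rule Wiener_AE_cong)
    show "AE s in lebesgue. kernel_operator (step_function n \<tau> c) s + c n * ?f s = kernel_operator (step_function (Suc n) \<tau> c) s"
      using kernel_operator_lincomb[OF step_function_L2 indicator_Ioc_L2, of n \<tau> c "c n" "\<tau> n" "\<tau> (Suc n)"]
        kernel_operator_interval[OF \<open>0 \<le> \<tau> n\<close> \<open>\<tau> n \<le> \<tau> (Suc n)\<close> Suc.prems(2)]
      unfolding step_function_Suc by eventually_elim simp
  qed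
qed

lemma averaged_sum_Wiener:
  assumes "is_partition T n \<tau>"
  shows "Wiener (kernel_operator (step_function n \<tau> (interval_average \<psi> \<tau>))) (averaged_sum BF \<psi> n \<tau>)"
  using increments_Wiener[of \<tau> n "interval_average \<psi> \<tau>"] assms
  by (simp add: is_partition_def averaged_sum_def[abs_def] interval_average_def[abs_def] less_imp_le)

text \<open>Boundedness of \<open>K\<^sub>F\<^sup>*\<close> transports the convergence of the averages.\<close>

lemma averaged_sum_kernel_tendsto:
  assumes \<psi>: "\<psi> \<in> L2 lebesgue" and fL2: "f \<in> L2 lebesgue"
    and f: "AE s in lebesgue. kernel_operator (\<lambda>s. \<psi> s * indicator {0<..T} s) s = f s"
    and "e > 0"
  shows "\<exists>\<delta>>0. \<forall>n \<tau>. is_partition T n \<tau> \<and> (\<forall>i<n. \<tau> (Suc i) - \<tau> i < \<delta>) \<longrightarrow>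
    (LINT s|lebesgue. (kernel_operator (step_function n \<tau> (interval_average \<psi> \<tau>)) s - f s)\<^sup>2) < e"
proof -
  obtain C where C: "C \<ge> 0"
    "\<forall>\<phi>\<in>L2 lebesgue. (LINT s|lebesgue. (kernel_operator \<phi> s)\<^sup>2) \<le> C * (LINT s|lebesgue. (\<phi> s)\<^sup>2)"
    using kernel_operator_bounded by blast
  obtain \<delta> where \<delta>: "\<delta> > 0" "\<And>n \<tau>. is_partition T n \<tau> \<Longrightarrow> \<forall>i<n. \<tau> (Suc i) - \<tau> i < \<delta> \<Longrightarrow>
    (LINT s|lebesgue. (step_function n \<tau> (interval_average \<psi> \<tau>) s - \<psi> s * indicator {0<..T} s)\<^sup>2) < e / (C + 1)"
    using averages_tendsto[OF \<psi> T_pos, of "e / (C + 1)"] C(1) \<open>e > 0\<close> by auto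
  have \<psi>T: "(\<lambda>s. \<psi> s * indicator {0<..T} s) \<in> L2 lebesgue"
    using \<psi> by (rule L2_indicator_mult) simp
  have main: "(LINT s|lebesgue. (kernel_operator (step_function n \<tau> (interval_average \<psi> \<tau>)) s - f s)\<^sup>2) < e"
    if part: "is_partition T n \<tau>" "\<forall>i<n. \<tau> (Suc i) - \<tau> i < \<delta>" for n \<tau>
  proof -
    let ?\<phi> = "step_function n \<tau> (interval_average \<psi> \<tau>)"
    let ?h = "\<lambda>s. ?\<phi> s - \<psi> s * indicator {0<..T} s"
    have ae: "AE s in lebesgue. (kernel_operator ?\<phi> s - f s)\<^sup>2 = (kernel_operator ?h s)\<^sup>2"
      using kernel_operator_lincomb[OF step_function_L2 \<psi>T, of n \<tau> "interval_average \<psi> \<tau>" "-1"] f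
      by eventually_elim simp
    have f_meas: "(\<lambda>s. (kernel_operator ?\<phi> s - f s)\<^sup>2) \<in> borel_measurable lebesgue"
      using Wiener_L2_fun[OF averaged_sum_Wiener[OF part(1)]] fL2
      by (intro borel_measurable_power borel_measurable_diff L2_measurable)
    have "(LINT s|lebesgue. (kernel_operator ?\<phi> s - f s)\<^sup>2) = (LINT s|lebesgue. (kernel_operator ?h s)\<^sup>2)"
      by (rule integral_cong_AE[OF f_meas borel_measurable_AE[OF f_meas ae] ae])
    moreover have "?h \<in> L2 lebesgue"
      by (rule L2_diff[OF step_function_L2 \<psi>T])
    ultimately have "(LINT s|lebesgue. (kernel_operator ?\<phi> s - f s)\<^sup>2) \<le> C * (LINT s|lebesgue. (?h s)\<^sup>2)"
      using C(2) by simp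
    also have "\<dots> \<le> C * (e / (C + 1))"
      using \<delta>(2)[OF part] C(1) by (intro mult_left_mono) auto
    also have "\<dots> < e"
      using C(1) \<open>e > 0\<close> by (simp add: field_simps)
    finally show ?thesis .
  qed
  show ?thesis
    by (intro exI[of _ \<delta>] conjI \<delta>(1) allI impI, elim conjE, rule main) auto
qed

end

section \<open>The integral with respect to \<open>B\<^sup>F\<close>\<close>

lemma uniform_partition:
  fixes a b \<delta> :: real and N :: nat
  assumes "a < b" "\<delta> > 0" "real N > (b - a) / \<delta>"
  defines "\<tau> \<equiv> \<lambda>i. a + (b - a) * real i / real N"
  shows "\<tau> 0 = a \<and> \<tau> N = b \<and> (\<forall>i. \<tau> i < \<tau> (Suc i) \<and> \<tau> (Suc i) - \<tau> i < \<delta>)"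
proof -
  have "(b - a) / \<delta> > 0"
    using assms by simp
  then have N: "real N > 0"
    using assms(3) by linarith
  have step: "\<tau> (Suc i) - \<tau> i = (b - a) / real N" for i
    using N by (simp add: \<tau>_def field_simps)
  have "\<tau> 0 = a" "\<tau> N = b"
    using N by (auto simp: \<tau>_def)
  moreover have "(b - a) / real N > 0"
    using N assms(1) by simp
  then have "\<tau> i < \<tau> (Suc i)" for i
    using step[of i] by linarith
  moreover have "\<tau> (Suc i) - \<tau> i < \<delta>" for i
    unfolding step using assms(2,3) N by (simp add: field_simps)
  ultimately show ?thesis
    by blast
qed

text \<open>A prescribed time can be made a partition point. The sums of an integrand that vanishes after
  time \<open>t\<close> then involve \<open>B\<^sup>F\<close> up to time \<open>t\<close> only.\<close>

lemma fine_partition_through: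
  assumes "t \<in> {0..T}" "T > 0" "\<delta> > 0"
  shows "\<exists>n \<tau> m. is_partition T n \<tau> \<and> (\<forall>i<n. \<tau> (Suc i) - \<tau> i < \<delta>) \<and> m \<le> n \<and> \<tau> m = t"
proof -
  obtain N :: nat where N: "real N > T / \<delta>"
    using reals_Archimedean2 by blast
  consider "t = 0 \<or> t = T" | "0 < t" "t < T"
    using assms(1) by fastforce
  then show ?thesis
  proof cases
    case 1
    define \<tau> where "\<tau> i = 0 + (T - 0) * real i / real N" for i
    have *: "\<tau> 0 = 0" "\<tau> N = T" "\<tau> i < \<tau> (Suc i)" "\<tau> (Suc i) - \<tau> i < \<delta>" for i
      using uniform_partition[of 0 T \<delta> N] assms N unfolding \<tau>_def by simp_all
    have "\<exists>m\<le>N. \<tau> m = t"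
      using 1 *(1,2) by auto
    with * show ?thesis
      unfolding is_partition_def by blast
  next
    case 2
    define \<sigma> where "\<sigma> i = 0 + (t - 0) * real i / real N" for i
    define \<rho> where "\<rho> i = t + (T - t) * real i / real N" for i
    have "t / \<delta> < N" "(T - t) / \<delta> < N"
      using N 2 assms(3) divide_right_mono[of t T \<delta>] divide_right_mono[of "T - t" T \<delta>] by auto
    then have \<sigma>: "\<sigma> 0 = 0" "\<sigma> N = t" "\<sigma> i < \<sigma> (Suc i)" "\<sigma> (Suc i) - \<sigma> i < \<delta>"
      and \<rho>: "\<rho> 0 = t" "\<rho> N = T" "\<rho> i < \<rho> (Suc i)" "\<rho> (Suc i) - \<rho> i < \<delta>" for i
      using uniform_partition[of 0 t \<delta> N] uniform_partition[of t T \<delta> N] assms 2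
      unfolding \<sigma>_def \<rho>_def by simp_all
    define \<tau> where "\<tau> i = (if i \<le> N then \<sigma> i else \<rho> (i - N))" for i
    have \<tau>1: "\<tau> i = \<sigma> i" if "i \<le> N" for i
      using that by (simp add: \<tau>_def)
    have \<tau>2: "\<tau> i = \<rho> (i - N)" if "N \<le> i" for i
      using that \<sigma>(2) \<rho>(1) by (cases "i = N") (auto simp: \<tau>_def)
    have step: "\<tau> i < \<tau> (Suc i) \<and> \<tau> (Suc i) - \<tau> i < \<delta>" for i
    proof (cases "Suc i \<le> N")
      case True
      then show ?thesis
        using \<sigma>(3,4)[of i] by (simp add: \<tau>1)
    next
      case False
      then show ?thesis
        using \<rho>(3,4)[of "i - N"] by (simp add: \<tau>2 Suc_diff_le)
    qed
    have "\<tau> 0 = 0" "\<tau> (N + N) = T" "\<tau> N = t"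
      using \<tau>1[of 0] \<tau>1[of N] \<tau>2[of "N + N"] \<sigma>(1,2) \<rho>(2) by auto
    with step have "is_partition T (N + N) \<tau>" "\<forall>i<N + N. \<tau> (Suc i) - \<tau> i < \<delta>" "N \<le> N + N" "\<tau> N = t"
      by (auto simp: is_partition_def)
    then show ?thesis
      by blast
  qed
qed

lemma tendsto_zero_inverse_Suc_bound:
  assumes "\<And>k. 0 \<le> (x k :: real)" "\<And>k. x k < inverse (real (Suc k))"
  shows "x \<longlonglongrightarrow> 0"
  by (rule Lim_null_comparison[OF _ LIMSEQ_inverse_real_of_nat])
     (use assms in \<open>auto intro!: always_eventually less_imp_le\<close>)

lemma F_integral_close:
  assumes "is_F_integral M BF T \<Theta> \<zeta>1 \<zeta>2 \<psi> X" "\<epsilon> > 0"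
  shows "\<exists>\<delta>>0. \<forall>n \<tau>. is_partition T n \<tau> \<and> (\<forall>i<n. \<tau> (Suc i) - \<tau> i < \<delta>) \<longrightarrow>
    (LINT \<omega>|M. (averaged_sum BF \<psi> n \<tau> \<omega> - X \<omega>)\<^sup>2) < \<epsilon>"
proof -
  have "\<forall>\<epsilon>>0. \<exists>\<delta>>0. \<forall>n \<tau>. is_partition T n \<tau> \<and> (\<forall>i<n. \<tau> (Suc i) - \<tau> i < \<delta>) \<longrightarrow>
        (LINT \<omega>|M. (averaged_sum BF \<psi> n \<tau> \<omega> - X \<omega>)\<^sup>2) < \<epsilon>"
    using assms(1) unfolding is_F_integral_def by (elim conjE)
  then show ?thesis
    using assms(2) by (elim allE impE)
qed

context F_Gaussian
begin

lemma averaged_sum_L2: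
  assumes "is_partition T n \<tau>"
  shows "averaged_sum BF \<psi> n \<tau> \<in> L2 M"
  using averaged_sum_Wiener[OF assms] by (rule Wiener_L2_rv)

text \<open>The mesh bounds \<open>d\<close> leave room for a second requirement on the same partitions.\<close>

lemma fine_averages:
  assumes \<psi>: "\<psi> \<in> L2 lebesgue"
    and f: "f \<in> L2 lebesgue" "AE s in lebesgue. kernel_operator (\<lambda>s. \<psi> s * indicator {0<..T} s) s = f s"
    and d: "\<And>k. d k > 0"
  shows "\<exists>n \<tau>. (\<forall>k. is_partition T (n k) (\<tau> k)) \<and> (\<forall>k. \<forall>i<n k. \<tau> k (Suc i) - \<tau> k i < d k) \<and>
    L2_tendsto lebesgue (\<lambda>k. kernel_operator (step_function (n k) (\<tau> k) (interval_average \<psi> (\<tau> k)))) f"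
proof -
  define good where "good k n \<tau> \<longleftrightarrow> is_partition T n \<tau> \<and> (\<forall>i<n. \<tau> (Suc i) - \<tau> i < d k) \<and>
      (LINT s|lebesgue. (kernel_operator (step_function n \<tau> (interval_average \<psi> \<tau>)) s - f s)\<^sup>2) < inverse (real (Suc k))" for k n \<tau>
  have "\<exists>n \<tau>. good k n \<tau>" for k
  proof -
    have "inverse (real (Suc k)) > 0"
      by simp
    from averaged_sum_kernel_tendsto[OF \<psi> f this] obtain \<delta> where \<delta>: "\<delta> > 0"
      "\<And>n \<tau>. is_partition T n \<tau> \<Longrightarrow> \<forall>i<n. \<tau> (Suc i) - \<tau> i < \<delta> \<Longrightarrow>
      (LINT s|lebesgue. (kernel_operator (step_function n \<tau> (interval_average \<psi> \<tau>)) s - f s)\<^sup>2) < inverse (real (Suc k))"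
      by blast
    obtain n \<tau> where part: "is_partition T n \<tau>" "\<forall>i<n. \<tau> (Suc i) - \<tau> i < min \<delta> (d k)"
      using fine_partition_through[of 0 T "min \<delta> (d k)"] T_pos \<delta>(1) d by auto
    then have "\<forall>i<n. \<tau> (Suc i) - \<tau> i < \<delta>" "\<forall>i<n. \<tau> (Suc i) - \<tau> i < d k"
      by auto
    with part(1) \<delta>(2)[OF part(1)] show ?thesis
      unfolding good_def by (intro exI[of _ n] exI[of _ \<tau>] conjI) simp_all
  qed
  then obtain n \<tau> where "\<And>k. good k (n k) (\<tau> k)"
    by metis
  then have part: "\<And>k. is_partition T (n k) (\<tau> k)" "\<And>k. \<forall>i<n k. \<tau> k (Suc i) - \<tau> k i < d k"
      "\<And>k. (LINT s|lebesgue. (kernel_operator (step_function (n k) (\<tau> k) (interval_average \<psi> (\<tau> k))) s - f s)\<^sup>2)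
        < inverse (real (Suc k))"
    unfolding good_def by blast+
  have "L2_tendsto lebesgue (\<lambda>k. kernel_operator (step_function (n k) (\<tau> k) (interval_average \<psi> (\<tau> k)))) f"
    by (rule tendsto_zero_inverse_Suc_bound[OF _ part(3)]) simp
  then show ?thesis
    by (intro exI[of _ n] exI[of _ \<tau>] conjI) (intro allI part(1,2))+
qed

text \<open>The isometry turns convergence of the integrands along one sequence of partitions into existence
  of the limit, and convergence along all partitions into convergence to that limit.\<close>

lemma F_integral_exists:
  assumes \<psi>: "\<psi> \<in> KF_inverse_range T \<Theta> \<zeta>1 \<zeta>2" "\<psi> \<in> L2 lebesgue"
    and f: "f \<in> L2 lebesgue" "AE s in lebesgue. kernel_operator (\<lambda>s. \<psi> s * indicator {0<..T} s) s = f s"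
  shows "\<exists>X. is_F_integral M BF T \<Theta> \<zeta>1 \<zeta>2 \<psi> X"
proof -
  let ?K = "\<lambda>n \<tau>. kernel_operator (step_function n \<tau> (interval_average \<psi> \<tau>))"
  from fine_averages[OF \<psi>(2) f, of "\<lambda>_. 1", OF zero_less_one]
  obtain n \<tau> where part: "\<forall>k. is_partition T (n k) (\<tau> k)" "L2_tendsto lebesgue (\<lambda>k. ?K (n k) (\<tau> k)) f"
    by (elim exE conjE)
  have "Wiener (?K (n k) (\<tau> k)) (averaged_sum BF \<psi> (n k) (\<tau> k))" for k
    by (rule averaged_sum_Wiener[OF spec[OF part(1)]])
  from Wiener_limit_exists[OF this f(1) part(2)]
  obtain X where X: "Wiener f X"
    by blast
  have close: "\<exists>\<delta>>0. \<forall>n \<tau>. is_partition T n \<tau> \<and> (\<forall>i<n. \<tau> (Suc i) - \<tau> i < \<delta>) \<longrightarrow>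
      expectation (\<lambda>\<omega>. (averaged_sum BF \<psi> n \<tau> \<omega> - X \<omega>)\<^sup>2) < \<epsilon>" if eps: "\<epsilon> > 0" for \<epsilon>
  proof -
    obtain \<delta> where "\<delta> > 0" and \<delta>: "\<And>n \<tau>. is_partition T n \<tau> \<Longrightarrow> \<forall>i<n. \<tau> (Suc i) - \<tau> i < \<delta> \<Longrightarrow>
        (LINT s|lebesgue. (?K n \<tau> s - f s)\<^sup>2) < \<epsilon>"
      using averaged_sum_kernel_tendsto[OF \<psi>(2) f eps] by blast
    have "expectation (\<lambda>\<omega>. (averaged_sum BF \<psi> n \<tau> \<omega> - X \<omega>)\<^sup>2) < \<epsilon>"
      if "is_partition T n \<tau>" "\<forall>i<n. \<tau> (Suc i) - \<tau> i < \<delta>" for n \<tau>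
      unfolding Wiener_isometry[OF averaged_sum_Wiener[OF that(1)] X] by (rule \<delta>[OF that])
    with \<open>\<delta> > 0\<close> show ?thesis
      by (intro exI[of _ \<delta>] conjI allI impI) auto
  qed
  have "is_F_integral M BF T \<Theta> \<zeta>1 \<zeta>2 \<psi> X"
    unfolding is_F_integral_def by (intro conjI allI impI \<psi>(1) Wiener_L2_rv[OF X] close)
  then show ?thesis
    by (intro exI)
qed

lemma F_integral_Wiener:
  assumes \<psi>: "\<psi> \<in> L2 lebesgue"
    and f: "f \<in> L2 lebesgue" "AE s in lebesgue. kernel_operator (\<lambda>s. \<psi> s * indicator {0<..T} s) s = f s"
    and X: "is_F_integral M BF T \<Theta> \<zeta>1 \<zeta>2 \<psi> X"
  shows "Wiener f X"
proof -
  have "\<forall>k. \<exists>d>0. \<forall>n \<tau>. is_partition T n \<tau> \<and> (\<forall>i<n. \<tau> (Suc i) - \<tau> i < d) \<longrightarrow>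
      expectation (\<lambda>\<omega>. (averaged_sum BF \<psi> n \<tau> \<omega> - X \<omega>)\<^sup>2) < inverse (real (Suc k))"
    by (intro allI F_integral_close[OF X]) simp
  from choice[OF this] obtain d where d: "\<And>k. d k > 0"
    "\<And>k n \<tau>. is_partition T n \<tau> \<Longrightarrow> \<forall>i<n. \<tau> (Suc i) - \<tau> i < d k \<Longrightarrow>
      expectation (\<lambda>\<omega>. (averaged_sum BF \<psi> n \<tau> \<omega> - X \<omega>)\<^sup>2) < inverse (real (Suc k))"
    by blast
  from fine_averages[OF \<psi> f, of d, OF d(1)] obtain n \<tau> where
    part: "\<forall>k. is_partition T (n k) (\<tau> k)" "\<forall>k. \<forall>i<n k. \<tau> k (Suc i) - \<tau> k i < d k"
    and lim: "L2_tendsto lebesgue (\<lambda>k. kernel_operator (step_function (n k) (\<tau> k) (interval_average \<psi> (\<tau> k)))) f"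
    by (elim exE conjE)
  have "X \<in> L2 M"
    using X by (simp add: is_F_integral_def)
  moreover have "L2_tendsto M (\<lambda>k. averaged_sum BF \<psi> (n k) (\<tau> k)) X"
    by (rule tendsto_zero_inverse_Suc_bound[OF _ d(2)[OF spec[OF part(1)] spec[OF part(2)]]]) simp
  ultimately show ?thesis
    by (rule limit[OF averaged_sum_Wiener[OF spec[OF part(1)]] f(1) _ lim])
qed

lemma F_integral_adapted:
  assumes X: "is_F_integral M BF T \<Theta> \<zeta>1 \<zeta>2 \<psi> X" and t: "t \<in> {0..T}" and supp: "\<And>s. s > t \<Longrightarrow> \<psi> s = 0"
  shows "X \<in> borel_measurable (generated_filtration M BF t)"
proof -
  define good where "good k n \<tau> m \<longleftrightarrow> is_partition T n \<tau> \<and> m \<le> n \<and> \<tau> m = t \<and>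
      expectation (\<lambda>\<omega>. (averaged_sum BF \<psi> n \<tau> \<omega> - X \<omega>)\<^sup>2) < inverse (real (Suc k))" for k n m and \<tau> :: "nat \<Rightarrow> real"
  have "\<exists>n \<tau> m. good k n \<tau> m" for k
  proof -
    have "inverse (real (Suc k)) > 0"
      by simp
    then obtain \<delta> where "\<delta> > 0" "\<forall>n \<tau>. is_partition T n \<tau> \<and> (\<forall>i<n. \<tau> (Suc i) - \<tau> i < \<delta>) \<longrightarrow>
        expectation (\<lambda>\<omega>. (averaged_sum BF \<psi> n \<tau> \<omega> - X \<omega>)\<^sup>2) < inverse (real (Suc k))"
      using F_integral_close[OF X] by blast
    then show ?thesis
      unfolding good_def using fine_partition_through[OF t T_pos \<open>\<delta> > 0\<close>] by blast
  qed
  then obtain n \<tau> m where "\<And>k. good k (n k) (\<tau> k) (m k)"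
    by metis
  then have part: "\<And>k. is_partition T (n k) (\<tau> k)" "\<And>k. m k \<le> n k" "\<And>k. \<tau> k (m k) = t"
    and close: "\<And>k. expectation (\<lambda>\<omega>. (averaged_sum BF \<psi> (n k) (\<tau> k) \<omega> - X \<omega>)\<^sup>2) < inverse (real (Suc k))"
    unfolding good_def by blast+
  show ?thesis
  proof (rule L2_limit_measurable_subalgebra)
    show "subalgebra M (generated_filtration M BF t)"
      by (rule subalgebra_generated_filtration) (simp add: BF_measurable)
    show "null_sets M \<subseteq> sets (generated_filtration M BF t)"
      by (rule null_sets_generated_filtration)
    show "averaged_sum BF \<psi> (n k) (\<tau> k) \<in> L2 M" for k
      by (rule averaged_sum_L2[OF part(1)])
    show "X \<in> L2 M"
      using X by (simp add: is_F_integral_def)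
    show "L2_tendsto M (\<lambda>k. averaged_sum BF \<psi> (n k) (\<tau> k)) X"
      by (rule tendsto_zero_inverse_Suc_bound) (use close in auto)
    fix k
    have mono: "\<forall>i<n k. \<tau> k i \<le> \<tau> k (Suc i)" and "\<tau> k 0 = 0"
      using part(1)[of k] by (auto simp: is_partition_def less_imp_le)
    note le = increasing_le[OF mono]
    show "averaged_sum BF \<psi> (n k) (\<tau> k) \<in> borel_measurable (generated_filtration M BF t)"
      unfolding averaged_sum_def[abs_def]
    proof (rule borel_measurable_sum)
      fix i assume "i \<in> {..<n k}"
      then have i: "i < n k" by simp
      show "(\<lambda>\<omega>. 1 / (\<tau> k (Suc i) - \<tau> k i) * (LINT s:{\<tau> k i..\<tau> k (Suc i)}|lebesgue. \<psi> s) *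
          (BF (\<tau> k (Suc i)) \<omega> - BF (\<tau> k i) \<omega>)) \<in> borel_measurable (generated_filtration M BF t)"
      proof (cases "i < m k")
        case True
        then have "0 \<le> \<tau> k i" "\<tau> k i \<le> t" "0 \<le> \<tau> k (Suc i)" "\<tau> k (Suc i) \<le> t"
          using le[of 0 i] le[of 0 "Suc i"] le[of i "m k"] le[of "Suc i" "m k"] i part(2,3)[of k] \<open>\<tau> k 0 = 0\<close> by auto
        then show ?thesis
          by (intro borel_measurable_times borel_measurable_diff borel_measurable_const measurable_generated_filtration)
      next
        case False
        then have "t \<le> \<tau> k i"
          using le[of "m k" i] i part(3)[of k] by simp
        have "(LINT s:{\<tau> k i..\<tau> k (Suc i)}|lebesgue. \<psi> s) = 0"
          unfolding set_lebesgue_integral_def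
        proof (rule integral_eq_zero_AE)
          show "AE s in lebesgue. indicator {\<tau> k i..\<tau> k (Suc i)} s *\<^sub>R \<psi> s = 0"
            using AE_completion[OF AE_lborel_singleton[of t]]
          proof eventually_elim
            case (elim s)
            then show ?case
              using supp[of s] \<open>t \<le> \<tau> k i\<close> by (auto simp: indicator_def)
          qed
        qed
        then show ?thesis
          by simp
      qed
    qed
  qed
qed

end


section \<open>Kernels that are constant along diagonals\<close>

text \<open>Along \<open>y \<mapsto> (s + y, u + y)\<close> the derivative of \<open>\<Theta>\<close> is the sum of its partial derivatives.
  Total differentiability is what allows the chain rule, hence the restriction to the open
  square.\<close>

lemma constant_on_interior_diagonals:
  assumes C1: "C1_on ({0<..<T} \<times> {0<..<T}) \<Theta>"
    and transport: "\<forall>t r. 0 \<le> t \<and> t \<le> r \<and> r \<le> T \<longrightarrow>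
      (\<exists>a b. ((\<lambda>u. \<Theta> u t) has_real_derivative a) (at r within {0..T}) \<and>
            ((\<lambda>u. \<Theta> r u) has_real_derivative b) (at t within {0..T}) \<and> a + b = 0)"
    and "0 < u" "u \<le> s" "0 \<le> x" "s + x < T"
  shows "\<Theta> (s + x) (u + x) = \<Theta> s u"
proof -
  obtain D :: "real \<times> real \<Rightarrow> (real \<times> real) \<Rightarrow>\<^sub>L real" where
    D: "\<And>z. z \<in> {0<..<T} \<times> {0<..<T} \<Longrightarrow> ((\<lambda>(r, t). \<Theta> r t) has_derivative blinfun_apply (D z)) (at z)"
    using C1 unfolding C1_on_def by blast
  have deriv: "((\<lambda>y. \<Theta> (s + y) (u + y)) has_real_derivative 0) (at y)" if "0 \<le> y" "y \<le> x" for y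
  proof -
    let ?z = "(s + y, u + y)"
    have z: "?z \<in> {0<..<T} \<times> {0<..<T}"
      using assms that by auto
    have Dz: "((\<lambda>(r, t). \<Theta> r t) has_derivative blinfun_apply (D ?z)) (at ?z within X)" for X
      using D[OF z] by (rule has_derivative_at_withinI)
    have le: "0 \<le> u + y" "u + y \<le> s + y" "s + y \<le> T"
      using assms that by auto
    from spec[OF spec[OF transport, of "u + y"], of "s + y"] le obtain a b where ab: "((\<lambda>v. \<Theta> v (u + y)) has_real_derivative a) (at (s + y) within {0..T})"
      "((\<lambda>v. \<Theta> (s + y) v) has_real_derivative b) (at (u + y) within {0..T})" "a + b = 0"
      by blast
    have "at (s + y) within {0..T} = at (s + y)" "at (u + y) within {0..T} = at (u + y)"
      using z by (auto intro!: at_within_interior simp: interior_atLeastAtMost_real)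
    note ab' = ab(1)[unfolded this] ab(2)[unfolded this]
    have c1: "((\<lambda>v. (v, u + y)) has_derivative (\<lambda>h. (h, 0))) (at (s + y))"
      by (auto intro!: derivative_eq_intros)
    have "((\<lambda>v. \<Theta> v (u + y)) has_derivative (\<lambda>h. D ?z (h, 0))) (at (s + y))"
      using has_derivative_compose[OF c1, of "\<lambda>(r, t). \<Theta> r t" "blinfun_apply (D ?z)"] Dz by simp
    from has_derivative_unique[OF this ab'(1)[unfolded has_field_derivative_def]] have a: "D ?z (1, 0) = a"
      by (metis mult.right_neutral)
    have c2: "((\<lambda>v. (s + y, v)) has_derivative (\<lambda>h. (0, h))) (at (u + y))"
      by (auto intro!: derivative_eq_intros)
    have "((\<lambda>v. \<Theta> (s + y) v) has_derivative (\<lambda>h. D ?z (0, h))) (at (u + y))"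
      using has_derivative_compose[OF c2, of "\<lambda>(r, t). \<Theta> r t" "blinfun_apply (D ?z)"] Dz by simp
    from has_derivative_unique[OF this ab'(2)[unfolded has_field_derivative_def]] have b: "D ?z (0, 1) = b"
      by (metis mult.right_neutral)
    have c3: "((\<lambda>v. (s + v, u + v)) has_derivative (\<lambda>h. (h, h))) (at y)"
      by (auto intro!: derivative_eq_intros)
    have "((\<lambda>v. \<Theta> (s + v) (u + v)) has_derivative (\<lambda>h. D ?z (h, h))) (at y)"
      using has_derivative_compose[OF c3, of "\<lambda>(r, t). \<Theta> r t" "blinfun_apply (D ?z)"] Dz by simp
    moreover have "(\<lambda>h. D ?z (h, h)) = (*) 0"
    proof (rule ext)
      fix h
      have "D ?z (h, h) = D ?z (h *\<^sub>R (1, 0) + h *\<^sub>R (0, 1))"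
        by simp
      also have "\<dots> = h * (D ?z (1, 0) + D ?z (0, 1))"
        by (simp only: blinfun.add_right blinfun.scaleR_right) (simp add: algebra_simps)
      finally show "D ?z (h, h) = 0 * h"
        using ab(3) by (simp add: a b)
    qed
    ultimately show ?thesis
      unfolding has_field_derivative_def by (simp only:)
  qed
  show ?thesis
  proof (cases "x = 0")
    case False
    with \<open>0 \<le> x\<close> have "0 < x" by simp
    moreover have "continuous_on {0..x} (\<lambda>y. \<Theta> (s + y) (u + y))"
      by (intro continuous_at_imp_continuous_on ballI DERIV_isCont[OF deriv]) auto
    ultimately have "\<Theta> (s + x) (u + x) = \<Theta> (s + 0) (u + 0)"
      by (rule DERIV_isconst_end) (auto intro: deriv)
    then show ?thesis
      by simp
  qed simp
qed

text \<open>At the edge \<open>t = T\<close> only separate continuity is available. The end points \<open>(T, u + T - s)\<close> and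
  \<open>(s, u)\<close> are therefore approached in the first variable, along points \<open>(T - h, u + T - s)\<close> and
  \<open>(s - h, u)\<close>, which lie on a common diagonal inside the square.\<close>

lemma constant_on_diagonals:
  assumes C1: "C1_on ({0<..<T} \<times> {0<..<T}) \<Theta>"
    and transport: "\<forall>t r. 0 \<le> t \<and> t \<le> r \<and> r \<le> T \<longrightarrow>
      (\<exists>a b. ((\<lambda>u. \<Theta> u t) has_real_derivative a) (at r within {0..T}) \<and>
            ((\<lambda>u. \<Theta> r u) has_real_derivative b) (at t within {0..T}) \<and> a + b = 0)"
    and "0 < u" "u < s" "s < t" "t \<le> T"
  shows "\<Theta> s u = \<Theta> t (u + t - s)"
proof (cases "t < T")
  case True
  then show ?thesis
    using constant_on_interior_diagonals[OF C1 transport \<open>0 < u\<close>, of s "t - s"] assms(4,5)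
    by (simp add: algebra_simps)
next
  case False
  then have "t = T"
    using assms by simp
  define h where "h n = (s - u) / (real n + 2)" for n :: nat
  have h: "0 < h n" "h n < s - u" for n
  proof -
    show "0 < h n"
      using \<open>u < s\<close> by (simp add: h_def)
    have "h n \<le> (s - u) / 2"
      unfolding h_def using \<open>u < s\<close> by (intro divide_left_mono) auto
    then show "h n < s - u"
      using \<open>u < s\<close> by (simp add: field_simps)
  qed
  have h0: "h \<longlonglongrightarrow> 0"
    unfolding h_def by real_asymp
  have cont: "continuous (at r within {0..T}) (\<lambda>v. \<Theta> v w)" if "0 \<le> w" "w \<le> r" "r \<le> T" for r w
    using spec[OF spec[OF transport, of w], of r] that by (blast intro: DERIV_continuous)
  have eq: "\<Theta> (T - h n) (u + T - s) = \<Theta> (s - h n) u" for n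
    using constant_on_interior_diagonals[OF C1 transport \<open>0 < u\<close>, of "s - h n" "T - s"] h[of n] assms \<open>t = T\<close>
    by (simp add: algebra_simps)
  have "(\<lambda>n. \<Theta> (T - h n) (u + T - s)) \<longlonglongrightarrow> \<Theta> T (u + T - s)"
  proof (rule continuous_within_tendsto_compose'[where f = "\<lambda>v. \<Theta> v (u + T - s)"])
    show "continuous (at T within {0..T}) (\<lambda>v. \<Theta> v (u + T - s))"
      using assms \<open>t = T\<close> by (intro cont) auto
    show "T - h n \<in> {0..T}" for n
      using h[of n] assms by auto
    show "(\<lambda>n. T - h n) \<longlonglongrightarrow> T"
      using tendsto_diff[OF tendsto_const h0, of T] by simp
  qed
  moreover have "(\<lambda>n. \<Theta> (s - h n) u) \<longlonglongrightarrow> \<Theta> s u"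
  proof (rule continuous_within_tendsto_compose'[where f = "\<lambda>v. \<Theta> v u"])
    show "continuous (at s within {0..T}) (\<lambda>v. \<Theta> v u)"
      using assms by (intro cont) auto
    show "s - h n \<in> {0..T}" for n
      using h[of n] assms by auto
    show "(\<lambda>n. s - h n) \<longlonglongrightarrow> s"
      using tendsto_diff[OF tendsto_const h0, of s] by simp
  qed
  ultimately show ?thesis
    unfolding eq \<open>t = T\<close> by (rule LIMSEQ_unique[symmetric])
qed

section \<open>The martingale\<close>

lemma continuous_indicator_measurable:
  fixes f :: "real \<Rightarrow> real"
  assumes "continuous_on {a..b} f"
  shows "(\<lambda>s. f s * indicator {a..b} s) \<in> borel_measurable borel"
  using borel_measurable_continuous_on_indicator[OF _ assms] by (simp add: mult.commute)

locale martingale_kernel = F_Gaussian M B F F' BF T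
  for M :: "'a measure" and B F F' BF T +
  fixes \<Theta> :: "real \<Rightarrow> real \<Rightarrow> real" and \<zeta>1 \<zeta>2 :: "real \<Rightarrow> real"
  assumes \<Theta>_C1: "C1_on ({0<..<T} \<times> {0<..<T}) \<Theta>"
    and \<zeta>_pos: "\<forall>t\<in>{0..T}. 0 < \<zeta>1 t \<and> 0 < \<zeta>2 t"
    and \<zeta>1_L2: "\<zeta>1 \<in> L2 (lebesgue_on {0..T})"
    and inverse_\<zeta>2_L2: "(\<lambda>t. 1 / \<zeta>2 t) \<in> L2 (lebesgue_on {0..T})"
    and equations: "kernel_equations T F F' \<Theta> \<zeta>1 \<zeta>2"
begin

lemma second_kernel_equation:
  assumes "0 \<le> t" "t \<le> r" "r \<le> T"
  shows "\<Theta> r t / \<zeta>2 t * F t t + (LINT s:{t..r}|lebesgue. F' s t * (\<Theta> r s / \<zeta>2 s)) = \<zeta>1 t"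
  using equations assms unfolding kernel_equations_def by blast

lemma transport:
  "\<forall>t r. 0 \<le> t \<and> t \<le> r \<and> r \<le> T \<longrightarrow>
      (\<exists>a b. ((\<lambda>u. \<Theta> u t) has_real_derivative a) (at r within {0..T}) \<and>
            ((\<lambda>u. \<Theta> r u) has_real_derivative b) (at t within {0..T}) \<and> a + b = 0)"
  using equations unfolding kernel_equations_def by blast

lemma \<Theta>_continuous_first:
  assumes "0 \<le> u"
  shows "continuous_on {u..T} (\<lambda>s. \<Theta> s u)"
  unfolding continuous_on_eq_continuous_within
proof
  fix s assume s: "s \<in> {u..T}"
  then have "0 \<le> u \<and> u \<le> s \<and> s \<le> T"
    using assms by simp
  with spec[OF spec[OF transport, of u], of s] have "continuous (at s within {0..T}) (\<lambda>s. \<Theta> s u)"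
    by (blast intro: DERIV_continuous)
  then show "continuous (at s within {u..T}) (\<lambda>s. \<Theta> s u)"
    by (rule continuous_within_subset) (use assms in auto)
qed

lemma \<Theta>_continuous_second:
  assumes "t \<le> T"
  shows "continuous_on {0..t} (\<Theta> t)"
  unfolding continuous_on_eq_continuous_within
proof
  fix s assume s: "s \<in> {0..t}"
  then have "0 \<le> s \<and> s \<le> t \<and> t \<le> T"
    using assms by simp
  with spec[OF spec[OF transport, of s], of t] have "continuous (at s within {0..T}) (\<Theta> t)"
    by (blast intro: DERIV_continuous)
  then show "continuous (at s within {0..t}) (\<Theta> t)"
    by (rule continuous_within_subset) (use assms in auto)
qed

text \<open>Up to its sign, the derivative of \<open>u \<mapsto> \<integral>\<^sub>u\<^sup>t \<Theta>(s, u) ds\<close>.\<close>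

definition \<Theta>_upto :: "real \<Rightarrow> real \<Rightarrow> real" where
  "\<Theta>_upto t s = \<Theta> t s * indicator {0..t} s"

lemma \<Theta>_upto_measurable: "t \<le> T \<Longrightarrow> \<Theta>_upto t \<in> borel_measurable borel"
  unfolding \<Theta>_upto_def[abs_def] by (rule continuous_indicator_measurable[OF \<Theta>_continuous_second])

lemma \<Theta>_upto_lebesgue_measurable: "t \<le> T \<Longrightarrow> \<Theta>_upto t \<in> borel_measurable lebesgue"
  using \<Theta>_upto_measurable by (intro measurable_completion) simp

lemma \<Theta>_upto_bounded:
  assumes "t \<le> T"
  shows "\<exists>C. \<forall>s. \<bar>\<Theta>_upto t s\<bar> \<le> C"
proof -
  have "bounded (\<Theta> t ` {0..t})"
    using \<Theta>_continuous_second[OF assms] by (intro compact_imp_bounded compact_continuous_image) auto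
  then obtain C where C: "\<forall>s\<in>{0..t}. \<bar>\<Theta> t s\<bar> \<le> C"
    by (auto simp: bounded_iff)
  have "\<bar>\<Theta>_upto t s\<bar> \<le> \<bar>C\<bar>" for s
    using bspec[OF C, of s] by (cases "s \<in> {0..t}") (auto simp: \<Theta>_upto_def)
  then show ?thesis
    by blast
qed

lemma \<Theta>_upto_integrable:
  assumes "t \<in> {0..T}"
  shows "integrable lebesgue (\<Theta>_upto t)"
proof -
  have "set_integrable lebesgue {0..t} (\<Theta> t)"
    using \<Theta>_continuous_second[of t] assms by (intro absolutely_integrable_continuous_real) simp
  then show ?thesis
    by (simp add: set_integrable_def \<Theta>_upto_def[abs_def] mult.commute)
qed

definition integrand :: "real \<Rightarrow> real \<Rightarrow> real" where
  "integrand t s = \<Theta> t s / \<zeta>2 s * indicator {0..t} s"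

lemma integrand_L2:
  assumes "t \<in> {0..T}"
  shows "integrand t \<in> L2 lebesgue"
proof -
  obtain C where C: "\<forall>s. \<bar>\<Theta>_upto t s\<bar> \<le> C"
    using \<Theta>_upto_bounded assms by auto
  have "(\<lambda>s. \<Theta>_upto t s * (1 / \<zeta>2 s * indicator {0..T} s)) \<in> L2 lebesgue"
  proof (rule L2_bounded_mult)
    show "(\<lambda>s. 1 / \<zeta>2 s * indicator {0..T} s) \<in> L2 lebesgue"
      using inverse_\<zeta>2_L2 L2_lebesgue_on_iff[of "{0..T}" "\<lambda>s. 1 / \<zeta>2 s"] by simp
    show "\<Theta>_upto t \<in> borel_measurable lebesgue"
      using assms by (intro \<Theta>_upto_lebesgue_measurable) simp
    show "\<bar>\<Theta>_upto t s\<bar> \<le> C" for s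
      using C by blast
  qed
  moreover have "(\<lambda>s. \<Theta>_upto t s * (1 / \<zeta>2 s * indicator {0..T} s)) = integrand t"
    using assms by (auto simp: integrand_def \<Theta>_upto_def indicator_def fun_eq_iff)
  ultimately show ?thesis
    by simp
qed

text \<open>The image of \<open>integrand t\<close> under \<open>K\<^sub>F\<^sup>*\<close>.\<close>

definition wiener_integrand :: "real \<Rightarrow> real \<Rightarrow> real" where
  "wiener_integrand t s = \<zeta>1 s * indicator {0..t} s"

lemma wiener_integrand_L2:
  assumes "t \<in> {0..T}"
  shows "wiener_integrand t \<in> L2 lebesgue"
proof -
  have "(\<lambda>s. \<zeta>1 s * indicator {0..T} s) \<in> L2 lebesgue"
    using \<zeta>1_L2 L2_lebesgue_on_iff[of "{0..T}" \<zeta>1] by simp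
  then have "(\<lambda>s. (\<zeta>1 s * indicator {0..T} s) * indicator {0..t} s) \<in> L2 lebesgue"
    by (rule L2_indicator_mult) simp
  moreover have "(\<lambda>s. (\<zeta>1 s * indicator {0..T} s) * indicator {0..t} s) = wiener_integrand t"
    using assms by (auto simp: wiener_integrand_def indicator_def fun_eq_iff)
  ultimately show ?thesis
    by simp
qed

text \<open>For \<open>0 < s \<le> t\<close> this is the second kernel equation with \<open>r = t\<close>.\<close>

lemma kernel_operator_integrand:
  assumes "t \<in> {0..T}"
  shows "AE s in lebesgue. kernel_operator (\<lambda>s. integrand t s * indicator {0<..T} s) s = wiener_integrand t s"
  using AE_completion[OF AE_lborel_singleton[of 0]]
proof eventually_elim
  case (elim s)
  consider "s < 0 \<or> t < s" | "0 < s" "s \<le> t"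
    using elim by linarith
  then show ?case
  proof cases
    case 1
    have "kernel_operator (\<lambda>s. integrand t s * indicator {0<..T} s) s = 0"
    proof (cases "t < s")
      case True
      have "(LINT u:{s..T}|lebesgue. F' u s * (integrand t u * indicator {0<..T} u)) = (LINT u|(lebesgue :: real measure). 0 :: real)"
        unfolding set_lebesgue_integral_def using True
        by (intro Bochner_Integration.integral_cong) (auto simp: integrand_def indicator_def)
      then show ?thesis
        using True by (simp add: kernel_operator_def integrand_def)
    next
      case False
      then show ?thesis
        using 1 by (simp add: kernel_operator_def)
    qed
    then show ?thesis
      using 1 by (auto simp: wiener_integrand_def)
  next
    case 2
    have "(LINT u:{s..T}|lebesgue. F' u s * (integrand t u * indicator {0<..T} u))
        = (LINT u:{s..t}|lebesgue. F' u s * (\<Theta> t u / \<zeta>2 u))"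
      unfolding set_lebesgue_integral_def using 2 assms
      by (intro Bochner_Integration.integral_cong) (auto simp: integrand_def indicator_def)
    then have "kernel_operator (\<lambda>s. integrand t s * indicator {0<..T} s) s
        = \<Theta> t s / \<zeta>2 s * F s s + (LINT u:{s..t}|lebesgue. F' u s * (\<Theta> t u / \<zeta>2 u))"
      using 2 assms by (simp add: kernel_operator_def integrand_def)
    also have "\<dots> = \<zeta>1 s"
      using 2 assms by (intro second_kernel_equation) auto
    finally show ?thesis
      using 2 by (simp add: wiener_integrand_def)
  qed
qed

text \<open>Substituting \<open>s \<mapsto> u + t - s\<close> moves \<open>(s, u)\<close> along its diagonal to the line \<open>r = t\<close>.\<close>

lemma \<Theta>_reflection:
  assumes "0 < u" "u < t" "t \<le> T"
  shows "(LINT s:{u..t}|lebesgue. \<Theta> s u) = (LINT s:{u..t}|lebesgue. \<Theta> t s)"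
proof -
  define k where "k s = \<Theta> t s * indicator {u..t} s" for s
  have k: "k \<in> borel_measurable borel"
    unfolding k_def[abs_def] using \<Theta>_continuous_second[OF assms(3)] assms
    by (intro continuous_indicator_measurable) (auto intro: continuous_on_subset)
  have l: "(\<lambda>s. \<Theta> s u * indicator {u..t} s) \<in> borel_measurable borel"
    using \<Theta>_continuous_first[of u] assms
    by (intro continuous_indicator_measurable) (auto intro: continuous_on_subset)
  have k': "(\<lambda>s. k (u + t + (-1) * s)) \<in> borel_measurable borel"
    using k by (rule measurable_compose[rotated]) measurable
  have "(LINT s:{u..t}|lebesgue. \<Theta> s u) = (LINT s|lebesgue. \<Theta> s u * indicator {u..t} s)"
    by (simp add: set_lebesgue_integral_def mult.commute)
  also have "\<dots> = (LINT s|lborel. \<Theta> s u * indicator {u..t} s)"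
    using l by (intro integral_completion) simp
  also have "\<dots> = (LINT s|lborel. k (u + t + (-1) * s))"
  proof (rule integral_cong_AE)
    show "AE s in lborel. \<Theta> s u * indicator {u..t} s = k (u + t + (-1) * s)"
      using AE_lborel_singleton[of u] AE_lborel_singleton[of t]
    proof eventually_elim
      case (elim s)
      show ?case
      proof (cases "s \<in> {u..t}")
        case True
        then have "\<Theta> s u = \<Theta> t (u + t - s)"
          using elim assms by (intro constant_on_diagonals[OF \<Theta>_C1 transport]) auto
        then show ?thesis
          using True by (auto simp: k_def indicator_def)
      next
        case False
        then show ?thesis
          by (auto simp: k_def indicator_def)
      qed
    qed
  qed (use k' l in auto)
  also have "\<dots> = (LINT s|lborel. k s)"
    using lborel_integral_real_affine[of "-1" k "u + t"] by simp
  also have "\<dots> = (LINT s|lebesgue. k s)"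
    using k by (intro integral_completion[symmetric]) simp
  also have "\<dots> = (LINT s:{u..t}|lebesgue. \<Theta> t s)"
    by (simp add: set_lebesgue_integral_def k_def mult.commute)
  finally show ?thesis .
qed

text \<open>The integrand is \<open>(K\<^sub>F\<^sup>*)\<^sup>-\<^sup>1\<close> of \<open>\<zeta>1 1\<^bsub>[0, t]\<^esub>\<close>: the primitive to be differentiated is
  \<open>\<integral>\<^sub>u\<^sup>t \<Theta>(s, u) ds\<close>, which the reflection turns into \<open>\<integral>\<^sub>u\<^sup>t \<Theta>(t, s) ds\<close>.\<close>

lemma integrand_is_KF_inverse:
  assumes t: "t \<in> {0..T}"
  shows "is_KF_inverse T \<Theta> \<zeta>1 \<zeta>2 (wiener_integrand t) (integrand t)"
proof -
  have cancel: "(\<lambda>s. indicator {u..T} s *\<^sub>R (\<Theta> s u / \<zeta>1 s * wiener_integrand t s))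
      = (\<lambda>s. indicator {u..t} s *\<^sub>R \<Theta> s u)" if "0 \<le> u" for u
  proof
    fix s
    show "indicator {u..T} s *\<^sub>R (\<Theta> s u / \<zeta>1 s * wiener_integrand t s) = indicator {u..t} s *\<^sub>R \<Theta> s u"
    proof (cases "s \<in> {u..t}")
      case True
      then have "s \<in> {0..T}"
        using t that by simp
      then have "\<zeta>1 s \<noteq> 0"
        using bspec[OF \<zeta>_pos] by fastforce
      then show ?thesis
        using True t that by (simp add: wiener_integrand_def)
    next
      case False
      then show ?thesis
        using that by (auto simp: wiener_integrand_def indicator_def)
    qed
  qed
  have "set_integrable lebesgue {u..T} (\<lambda>s. \<Theta> s u / \<zeta>1 s * wiener_integrand t s)" if "u \<in> {0..T}" for u
  proof -
    have "set_integrable lebesgue {u..t} (\<lambda>s. \<Theta> s u)"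
      using \<Theta>_continuous_first[of u] that t
      by (intro absolutely_integrable_continuous_real) (auto intro: continuous_on_subset)
    then show ?thesis
      using cancel[of u] that unfolding set_integrable_def by simp
  qed
  moreover have "has_L2_derivative T (\<lambda>u. LINT s:{u..T}|lebesgue. \<Theta> s u / \<zeta>1 s * wiener_integrand t s) (\<lambda>u. - \<Theta>_upto t u)"
    unfolding has_L2_derivative_def
  proof
    obtain C where C: "\<forall>s. \<bar>\<Theta>_upto t s\<bar> \<le> C"
      using \<Theta>_upto_bounded t by auto
    have "(\<lambda>u. - \<Theta>_upto t u * indicator {0..T} u) \<in> L2 lebesgue"
    proof (rule bounded_L2_on_interval)
      show "(\<lambda>u. - \<Theta>_upto t u) \<in> borel_measurable lebesgue"
        using \<Theta>_upto_lebesgue_measurable[of t] t by simp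
      show "\<bar>- \<Theta>_upto t u\<bar> \<le> C" for u
        using C by simp
    qed
    then show "(\<lambda>u. - \<Theta>_upto t u) \<in> L2 (lebesgue_on {0..T})"
      using L2_lebesgue_on_iff[of "{0..T}" "\<lambda>u. - \<Theta>_upto t u"] by simp
    define c where "c = (LINT v|lebesgue. \<Theta>_upto t v)"
    have "AE u in lebesgue. u \<in> {0..T} \<longrightarrow>
        (LINT s:{u..T}|lebesgue. \<Theta> s u / \<zeta>1 s * wiener_integrand t s) = c + (LINT v:{0..u}|lebesgue. - \<Theta>_upto t v)"
      using AE_completion[OF AE_lborel_singleton[of 0]] AE_completion[OF AE_lborel_singleton[of t]]
    proof eventually_elim
      case (elim u)
      show ?case
      proof
        assume u: "u \<in> {0..T}"
        have H: "(LINT s:{u..T}|lebesgue. \<Theta> s u / \<zeta>1 s * wiener_integrand t s) = (LINT s:{u..t}|lebesgue. \<Theta> s u)"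
          using cancel[of u] u unfolding set_lebesgue_integral_def by (simp only: atLeastAtMost_iff)
        have int: "set_integrable lebesgue A (\<Theta>_upto t)" if "A \<in> sets lebesgue" for A
          unfolding set_integrable_def by (rule integrable_mult_indicator[OF that \<Theta>_upto_integrable[OF t]])
        have R: "c + (LINT v:{0..u}|lebesgue. - \<Theta>_upto t v) = c - (LINT v:{0..u}|lebesgue. \<Theta>_upto t v)"
          by (simp add: set_lebesgue_integral_def)
        show "(LINT s:{u..T}|lebesgue. \<Theta> s u / \<zeta>1 s * wiener_integrand t s) = c + (LINT v:{0..u}|lebesgue. - \<Theta>_upto t v)"
        proof (cases "u < t")
          case True
          have "c = (LINT v:{0..u} \<union> {u<..t}|lebesgue. \<Theta>_upto t v)"
            unfolding c_def set_lebesgue_integral_def using u True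
            by (intro Bochner_Integration.integral_cong) (auto simp: \<Theta>_upto_def indicator_def)
          also have "\<dots> = (LINT v:{0..u}|lebesgue. \<Theta>_upto t v) + (LINT v:{u<..t}|lebesgue. \<Theta>_upto t v)"
            by (intro set_integral_Un int) auto
          also have "(LINT v:{u<..t}|lebesgue. \<Theta>_upto t v) = (LINT v:{u..t}|lebesgue. \<Theta>_upto t v)"
            unfolding set_lebesgue_integral_def
          proof (rule integral_cong_AE)
            show "AE v in lebesgue. indicator {u<..t} v *\<^sub>R \<Theta>_upto t v = indicator {u..t} v *\<^sub>R \<Theta>_upto t v"
              using AE_completion[OF AE_lborel_singleton[of u]] by eventually_elim (auto simp: indicator_def)
          qed (use int[of "{u<..t}"] int[of "{u..t}"] in \<open>auto simp: set_integrable_def dest: borel_measurable_integrable\<close>)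
          also have "\<dots> = (LINT v:{u..t}|lebesgue. \<Theta> t v)"
            unfolding set_lebesgue_integral_def using u
            by (intro Bochner_Integration.integral_cong) (auto simp: \<Theta>_upto_def indicator_def)
          also have "\<dots> = (LINT s:{u..t}|lebesgue. \<Theta> s u)"
            using u elim True t by (intro \<Theta>_reflection[symmetric]) auto
          finally show ?thesis
            unfolding H R by simp
        next
          case False
          then have "t < u"
            using elim by simp
          then have "(LINT v:{0..u}|lebesgue. \<Theta>_upto t v) = c"
            unfolding c_def set_lebesgue_integral_def
            by (intro Bochner_Integration.integral_cong) (auto simp: \<Theta>_upto_def indicator_def)
          moreover have "(LINT s:{u..t}|lebesgue. \<Theta> s u) = 0"
            using \<open>t < u\<close> by (simp add: set_lebesgue_integral_def)
          ultimately show ?thesis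
            unfolding H R by simp
        qed
      qed
    qed
    then show "\<exists>c. AE u in lebesgue_on {0..T}.
        (LINT s:{u..T}|lebesgue. \<Theta> s u / \<zeta>1 s * wiener_integrand t s) = c + (LINT v:{0..u}|lebesgue. - \<Theta>_upto t v)"
      by (intro exI[of _ c]) (simp only: AE_lebesgue_on_iff)
  qed
  moreover have "integrand t u = - (1 / \<zeta>2 u) * (- \<Theta>_upto t u)" for u
    by (simp add: integrand_def \<Theta>_upto_def)
  ultimately show ?thesis
    unfolding is_KF_inverse_def AE_lebesgue_on_iff
    by (intro conjI exI[of _ "\<lambda>u. - \<Theta>_upto t u"]) auto
qed

lemma integrand_in_range:
  assumes "t \<in> {0..T}"
  shows "integrand t \<in> KF_inverse_range T \<Theta> \<zeta>1 \<zeta>2"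
proof -
  have "(\<lambda>s. wiener_integrand t s * indicator {0..T} s) \<in> L2 lebesgue"
    using wiener_integrand_L2[OF assms] by (rule L2_indicator_mult) simp
  then have "wiener_integrand t \<in> L2 (lebesgue_on {0..T})"
    by (simp add: L2_lebesgue_on_iff)
  then show ?thesis
    unfolding KF_inverse_range_def using integrand_is_KF_inverse[OF assms] by blast
qed

lemma F_integral_upto_iff:
  "is_F_integral_upto M BF T \<Theta> \<zeta>1 \<zeta>2 t (\<lambda>s. \<Theta> t s / \<zeta>2 s) X \<longleftrightarrow> is_F_integral M BF T \<Theta> \<zeta>1 \<zeta>2 (integrand t) X"
  by (simp add: is_F_integral_upto_def integrand_def[abs_def])

lemma integral_exists:
  assumes "t \<in> {0..T}"
  shows "\<exists>X. is_F_integral_upto M BF T \<Theta> \<zeta>1 \<zeta>2 t (\<lambda>s. \<Theta> t s / \<zeta>2 s) X"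
  unfolding F_integral_upto_iff
  by (rule F_integral_exists[OF integrand_in_range integrand_L2 wiener_integrand_L2 kernel_operator_integrand]) (rule assms)+

lemma integral_Wiener:
  assumes "t \<in> {0..T}" "is_F_integral_upto M BF T \<Theta> \<zeta>1 \<zeta>2 t (\<lambda>s. \<Theta> t s / \<zeta>2 s) X"
  shows "Wiener (wiener_integrand t) X"
  by (rule F_integral_Wiener[OF integrand_L2 wiener_integrand_L2 kernel_operator_integrand])
    (use assms in \<open>simp_all add: F_integral_upto_iff\<close>)

lemma integral_adapted:
  assumes "t \<in> {0..T}" "is_F_integral_upto M BF T \<Theta> \<zeta>1 \<zeta>2 t (\<lambda>s. \<Theta> t s / \<zeta>2 s) X"
  shows "X \<in> borel_measurable (generated_filtration M BF t)"
  using assms(2) unfolding F_integral_upto_iff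
  by (rule F_integral_adapted[OF _ assms(1)]) (simp add: integrand_def)

text \<open>The past of \<open>B\<^sup>F\<close> is contained in the past of \<open>B\<close>, so that the increment of the Wiener integral
  is orthogonal to it.\<close>

lemma integrals_martingale:
  assumes Mt: "\<And>t. t \<in> {0..T} \<Longrightarrow> is_F_integral_upto M BF T \<Theta> \<zeta>1 \<zeta>2 t (\<lambda>s. \<Theta> t s / \<zeta>2 s) (Mt t)"
  shows "martingale_on M (generated_filtration M BF) {0..T} Mt"
proof -
  let ?G = "generated_filtration M BF"
  have sub: "subalgebra M (?G t)" for t
    by (rule subalgebra_generated_filtration) (simp add: BF_measurable)
  have adapted: "Mt t \<in> borel_measurable (?G t)" if "t \<in> {0..T}" for t
    using that Mt[OF that] by (rule integral_adapted)
  have W: "Wiener (wiener_integrand t) (Mt t)" if "t \<in> {0..T}" for t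
    using that Mt[OF that] by (rule integral_Wiener)
  have int: "integrable M (Mt t)" if "t \<in> {0..T}" for t
    using Wiener_L2_rv[OF W[OF that]] by (rule L2_integrable)
  have "AE \<omega> in M. real_cond_exp M (?G s) (Mt t) \<omega> = Mt s \<omega>"
    if s: "s \<in> {0..T}" and t: "t \<in> {0..T}" and "s \<le> t" for s t
  proof -
    interpret G: finite_measure_subalgebra M "?G s"
      by unfold_locales (rule sub)
    show ?thesis
    proof (rule G.real_cond_exp_charact)
      fix A assume A: "A \<in> sets (?G s)"
      have "sets (?G s) \<subseteq> sets (generated_filtration M B s)"
      proof (rule generated_filtration_subset)
        show "subalgebra M (generated_filtration M B s)"
          by (rule subalgebra_generated_filtration) (simp add: B_measurable)
        show "null_sets M \<subseteq> sets (generated_filtration M B s)"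
          by (rule null_sets_generated_filtration)
        show "BF r \<in> borel_measurable (generated_filtration M B s)" if "0 \<le> r" "r \<le> s" for r
          using BF_adapted[OF that(1)] generated_filtration_mono[OF that(2), of M B]
          by (auto simp: measurable_def)
      qed
      then have AB: "A \<in> sets (generated_filtration M B s)"
        using A by blast
      have AM: "A \<in> sets M"
        using A sub by (auto simp: subalgebra_def)
      have "expectation (\<lambda>\<omega>. (Mt t \<omega> - Mt s \<omega>) * indicator A \<omega>) = 0"
      proof (rule Wiener_orthogonal_past[OF Wiener_diff[OF W[OF t] W[OF s]] _ _ AB])
        show "AE x in lebesgue. x \<le> s \<longrightarrow> wiener_integrand t x - wiener_integrand s x = 0"
          using \<open>s \<le> t\<close> by (intro AE_I2) (auto simp: wiener_integrand_def indicator_def)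
      qed (use s in simp)
      then have "expectation (\<lambda>\<omega>. indicator A \<omega> *\<^sub>R Mt t \<omega> - indicator A \<omega> *\<^sub>R Mt s \<omega>) = 0"
        by (simp add: algebra_simps)
      then show "(LINT \<omega>:A|M. Mt t \<omega>) = (LINT \<omega>:A|M. Mt s \<omega>)"
        unfolding set_lebesgue_integral_def
        using integrable_mult_indicator[OF AM int[OF t]] integrable_mult_indicator[OF AM int[OF s]] by simp
    qed (use int adapted s t in auto)
  qed
  then show ?thesis
    unfolding martingale_on_def using sub adapted int generated_filtration_mono by blast
qed

end

theorem theorem7p1:
  fixes M :: "'a measure" and B BF :: "real \<Rightarrow> 'a \<Rightarrow> real"
    and F F' \<Theta> :: "real \<Rightarrow> real \<Rightarrow> real" and \<zeta>1 \<zeta>2 :: "real \<Rightarrow> real" and T :: real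
  assumes "prob_space M" and "complete_measure M"
    and "standard_Brownian_motion M B"
    and "Gaussian_kernel F"
    and "F_Gaussian_process M B F BF"
    and "T > 0"
    and "L2_time_derivative T F F'"
    and "continuous_on ({0..T} \<times> {0..T}) (\<lambda>(t, s). F t s)"
    and "(\<lambda>(r, t). \<Theta> r t) \<in> L2 (lebesgue_on ({0..T} \<times> {0..T}))"
    and "C1_on ({0<..<T} \<times> {0<..<T}) \<Theta>"
    and "\<forall>t\<in>{0..T}. 0 < \<zeta>1 t \<and> 0 < \<zeta>2 t"
    and "\<zeta>1 \<in> L2 (lebesgue_on {0..T})" and "\<zeta>2 \<in> L2 (lebesgue_on {0..T})"
    and "(\<lambda>t. 1 / \<zeta>1 t) \<in> L2 (lebesgue_on {0..T})"
    and "(\<lambda>t. 1 / \<zeta>2 t) \<in> L2 (lebesgue_on {0..T})"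
    and "kernel_equations T F F' \<Theta> \<zeta>1 \<zeta>2"
  shows "(\<forall>t\<in>{0..T}. \<exists>X. is_F_integral_upto M BF T \<Theta> \<zeta>1 \<zeta>2 t (\<lambda>s. \<Theta> t s / \<zeta>2 s) X) \<and>
         (\<forall>Mt :: real \<Rightarrow> 'a \<Rightarrow> real.
            (\<forall>t\<in>{0..T}. is_F_integral_upto M BF T \<Theta> \<zeta>1 \<zeta>2 t (\<lambda>s. \<Theta> t s / \<zeta>2 s) (Mt t)) \<longrightarrow>
            martingale_on M (generated_filtration M BF) {0..T} Mt)"
proof -
  interpret prob_space M
    by fact
  interpret martingale_kernel M B F F' BF T \<Theta> \<zeta>1 \<zeta>2
    by unfold_locales fact+
  show ?thesis
    using integral_exists integrals_martingale by blast
qed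

end
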